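(* Let $k$ be a field and let $B$ and $C$ be two preadic noetherian $k$-algebras, with respective ideals of definition $\mathfrak{m}$ and $\mathfrak{n}$. If the ring $(B/\mathfrak{m})\otimes_k(C/\mathfrak{n})$ is noetherian, then $B\widehat{\otimes}_k C$ is flat over $B$ and over $C$.
   Context: All rings are commutative and unital. A preadic ring is a topological ring having an ideal (an ideal of definition) whose powers form a fundamental system of neighbourhoods of $0$ (neither separated nor complete is required). The completed tensor product $B\widehat{\otimes}_k C$ is the separated completion of $B\otimes_k C$ for the tensor product topology, defined by the submodules $\operatorname{Im}(\mathfrak{m}^i\otimes_k C)+\operatorname{Im}(B\otimes_k\mathfrak{n}^j)$; equivalently $B\widehat{\otimes}_k C=\varprojlim_n (B\otimes_k C)/\mathfrak{r}^n$ with $\mathfrak{r}=\operatorname{Im}(\mathfrak{m}\otimes_k C)+\operatorname{Im}(B\otimes_k \mathfrak{n})$. *)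

theory Defs
  imports "HOL-Analysis.Product_Topology" "HOL-Algebra.Free_Abelian_Groups" "HOL-Algebra.Algebra"
begin

section \<open>Preadic rings\<close>

abbreviation ideal_power :: "('a, 'x) ring_scheme \<Rightarrow> 'a set \<Rightarrow> nat \<Rightarrow> 'a set" where
  "ideal_power R I n \<equiv> I [^]\<^bsub>ideals_set R\<^esub> n"

definition topological_ring :: "('a, 'x) ring_scheme \<Rightarrow> 'a topology \<Rightarrow> bool" where
  "topological_ring R T \<longleftrightarrow>
     ring R \<and> topspace T = carrier R \<and>
     continuous_map (prod_topology T T) T (\<lambda>(x, y). x \<oplus>\<^bsub>R\<^esub> y) \<and>
     continuous_map T T (\<lambda>x. \<ominus>\<^bsub>R\<^esub> x) \<and>
     continuous_map (prod_topology T T) T (\<lambda>(x, y). x \<otimes>\<^bsub>R\<^esub> y)"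

definition nhd_of_zero :: "('a, 'x) ring_scheme \<Rightarrow> 'a topology \<Rightarrow> 'a set \<Rightarrow> bool" where
  "nhd_of_zero R T V \<longleftrightarrow> V \<subseteq> topspace T \<and> (\<exists>U. openin T U \<and> \<zero>\<^bsub>R\<^esub> \<in> U \<and> U \<subseteq> V)"

definition ideal_of_definition :: "('a, 'x) ring_scheme \<Rightarrow> 'a topology \<Rightarrow> 'a set \<Rightarrow> bool" where
  "ideal_of_definition R T I \<longleftrightarrow>
     ideal I R \<and>
     (\<forall>n. nhd_of_zero R T (ideal_power R I n)) \<and>
     (\<forall>V. nhd_of_zero R T V \<longrightarrow> (\<exists>n. ideal_power R I n \<subseteq> V))"

definition preadic_ring :: "('a, 'x) ring_scheme \<Rightarrow> 'a topology \<Rightarrow> bool" where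
  "preadic_ring R T \<longleftrightarrow> cring R \<and> topological_ring R T \<and> (\<exists>I. ideal_of_definition R T I)"


section \<open>Tensor products of modules and flatness\<close>

definition tensor_rels ::
  "('r, 'x) ring_scheme \<Rightarrow> ('r, 'm, 'y) module_scheme \<Rightarrow> ('r, 'n, 'z) module_scheme \<Rightarrow>
     ('m \<times> 'n \<Rightarrow>\<^sub>0 int) set" where
  "tensor_rels R M N =
     {frag_of (x \<oplus>\<^bsub>M\<^esub> x', y) - frag_of (x, y) - frag_of (x', y) | x x' y.
        x \<in> carrier M \<and> x' \<in> carrier M \<and> y \<in> carrier N} \<union>
     {frag_of (x, y \<oplus>\<^bsub>N\<^esub> y') - frag_of (x, y) - frag_of (x, y') | x y y'.
        x \<in> carrier M \<and> y \<in> carrier N \<and> y' \<in> carrier N} \<union>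
     {frag_of (a \<odot>\<^bsub>M\<^esub> x, y) - frag_of (x, a \<odot>\<^bsub>N\<^esub> y) | a x y.
        a \<in> carrier R \<and> x \<in> carrier M \<and> y \<in> carrier N}"

definition tensor_subgroup ::
  "('r, 'x) ring_scheme \<Rightarrow> ('r, 'm, 'y) module_scheme \<Rightarrow> ('r, 'n, 'z) module_scheme \<Rightarrow>
     ('m \<times> 'n \<Rightarrow>\<^sub>0 int) set" where
  "tensor_subgroup R M N =
     generate (free_Abelian_group (carrier M \<times> carrier N)) (tensor_rels R M N)"

text \<open>The underlying abelian group of the tensor product \<open>M \<otimes>\<^sub>R N\<close>
  (written multiplicatively, as \<^const>\<open>free_Abelian_group\<close> is).\<close>

definition tensor_group ::
  "('r, 'x) ring_scheme \<Rightarrow> ('r, 'm, 'y) module_scheme \<Rightarrow> ('r, 'n, 'z) module_scheme \<Rightarrow>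
     ('m \<times> 'n \<Rightarrow>\<^sub>0 int) set monoid" where
  "tensor_group R M N =
     free_Abelian_group (carrier M \<times> carrier N) Mod tensor_subgroup R M N"

text \<open>The map \<open>id \<otimes> f : M \<otimes>\<^sub>R N \<rightarrow> M \<otimes>\<^sub>R P\<close> induced by a linear map \<open>f : N \<rightarrow> P\<close>.
  All representatives of a coset have the same image, whence \<^const>\<open>the_elem\<close>.\<close>

definition tensor_map ::
  "('r, 'x) ring_scheme \<Rightarrow> ('r, 'm, 'y) module_scheme \<Rightarrow> ('r, 'p, 'z) module_scheme \<Rightarrow>
     ('n \<Rightarrow> 'p) \<Rightarrow> ('m \<times> 'n \<Rightarrow>\<^sub>0 int) set \<Rightarrow> ('m \<times> 'p \<Rightarrow>\<^sub>0 int) set" where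
  "tensor_map R M P f Z =
     the_elem ((\<lambda>z. tensor_subgroup R M P #>\<^bsub>free_Abelian_group (carrier M \<times> carrier P)\<^esub>
                      frag_extend (\<lambda>(x, y). frag_of (x, f y)) z) ` Z)"

definition linear_maps ::
  "('r, 'x) ring_scheme \<Rightarrow> ('r, 'm, 'y) module_scheme \<Rightarrow> ('r, 'n, 'z) module_scheme \<Rightarrow>
     ('m \<Rightarrow> 'n) set" where
  "linear_maps R M N =
     {f \<in> carrier M \<rightarrow> carrier N.
        (\<forall>x\<in>carrier M. \<forall>y\<in>carrier M. f (x \<oplus>\<^bsub>M\<^esub> y) = f x \<oplus>\<^bsub>N\<^esub> f y) \<and>
        (\<forall>a\<in>carrier R. \<forall>x\<in>carrier M. f (a \<odot>\<^bsub>M\<^esub> x) = a \<odot>\<^bsub>N\<^esub> f x)}"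

text \<open>\<open>M\<close> is flat over \<open>R\<close> if \<open>M \<otimes>\<^sub>R _\<close> preserves injectivity of linear maps \<open>N \<rightarrow> P\<close>.
  A definition cannot quantify over the types of the elements of \<open>N\<close> and \<open>P\<close>, so they are
  parameters. In the conclusion of a theorem they are to be left as type variables, which
  are universally quantified, so that flatness is asserted for all modules \<open>N\<close>, \<open>P\<close>.\<close>

definition flat_module ::
  "('r, 'x) ring_scheme \<Rightarrow> ('r, 'm, 'y) module_scheme \<Rightarrow> 'n itself \<Rightarrow> 'p itself \<Rightarrow> bool" where
  "flat_module R M (_ :: 'n itself) (_ :: 'p itself) \<longleftrightarrow>
     module R M \<and>
     (\<forall>(N :: ('r, 'n) module) (P :: ('r, 'p) module) f.
        module R N \<and> module R P \<and> f \<in> linear_maps R N P \<and> inj_on f (carrier N) \<longrightarrow>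
        inj_on (tensor_map R M P f) (carrier (tensor_group R M N)))"

text \<open>A ring \<open>A\<close> as a module over the source of a ring homomorphism \<open>h\<close> into \<open>A\<close>.\<close>

definition module_via :: "('r \<Rightarrow> 'a) \<Rightarrow> 'a ring \<Rightarrow> ('r, 'a) module" where
  "module_via h A = ring.extend A (module.fields (\<lambda>b x. h b \<otimes>\<^bsub>A\<^esub> x))"


section \<open>Tensor products of algebras\<close>

text \<open>The monoid ring (over the integers) of the product of the multiplicative monoids
  of \<open>B\<close> and \<open>C\<close>.\<close>

definition pair_ring ::
  "('b, 'y) ring_scheme \<Rightarrow> ('c, 'z) ring_scheme \<Rightarrow> ('b \<times> 'c \<Rightarrow>\<^sub>0 int) ring" where
  "pair_ring B C =
     \<lparr>carrier = carrier (free_Abelian_group (carrier B \<times> carrier C)),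
      monoid.mult = (\<lambda>f g. frag_extend (\<lambda>(b, c).
                 frag_extend (\<lambda>(b', c'). frag_of (b \<otimes>\<^bsub>B\<^esub> b', c \<otimes>\<^bsub>C\<^esub> c')) g) f),
      one = frag_of (\<one>\<^bsub>B\<^esub>, \<one>\<^bsub>C\<^esub>),
      ring.zero = 0,
      ring.add = (+)\<rparr>"

text \<open>\<^const>\<open>tensor_rels\<close> is stable under multiplication by the elements \<open>frag_of (b, c)\<close>, so the
  ideal it generates is the subgroup \<^const>\<open>tensor_subgroup\<close>. The quotient is thus
  \<^const>\<open>tensor_group\<close> with the product \<open>(b \<otimes> c) (b' \<otimes> c') = b b' \<otimes> c c'\<close>.\<close>

definition tensor_algebra ::
  "('k, 'x) ring_scheme \<Rightarrow> ('k, 'b, 'y) module_scheme \<Rightarrow> ('k, 'c, 'z) module_scheme \<Rightarrow>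
     ('b \<times> 'c \<Rightarrow>\<^sub>0 int) set ring" where
  "tensor_algebra k B C = pair_ring B C Quot genideal (pair_ring B C) (tensor_rels k B C)"

definition pure_tensor ::
  "('k, 'x) ring_scheme \<Rightarrow> ('k, 'b, 'y) module_scheme \<Rightarrow> ('k, 'c, 'z) module_scheme \<Rightarrow>
     'b \<Rightarrow> 'c \<Rightarrow> ('b \<times> 'c \<Rightarrow>\<^sub>0 int) set" where
  "pure_tensor k B C b c =
     genideal (pair_ring B C) (tensor_rels k B C) +>\<^bsub>pair_ring B C\<^esub> frag_of (b, c)"

definition quotient_algebra ::
  "('k, 'b, 'y) module_scheme \<Rightarrow> 'b set \<Rightarrow> ('k, 'b set) module" where
  "quotient_algebra B I =
     ring.extend (B Quot I) (module.fields (\<lambda>a S. \<Union>x\<in>S. I +>\<^bsub>B\<^esub> (a \<odot>\<^bsub>B\<^esub> x)))"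


section \<open>Completed tensor products\<close>

text \<open>The inverse limit of the rings \<open>A / I^n\<close>. The transition map sends a coset of
  \<open>I^(n+1)\<close> to the coset of \<open>I^n\<close> containing it.\<close>

definition adic_completion :: "('a, 'x) ring_scheme \<Rightarrow> 'a set \<Rightarrow> (nat \<Rightarrow> 'a set) ring" where
  "adic_completion A I =
     \<lparr>carrier = {x. (\<forall>n. x n \<in> carrier (A Quot ideal_power A I n)) \<and> (\<forall>n. x (Suc n) \<subseteq> x n)},
      monoid.mult = (\<lambda>x y n. x n \<otimes>\<^bsub>A Quot ideal_power A I n\<^esub> y n),
      one = (\<lambda>n. \<one>\<^bsub>A Quot ideal_power A I n\<^esub>),
      ring.zero = (\<lambda>n. \<zero>\<^bsub>A Quot ideal_power A I n\<^esub>),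
      ring.add = (\<lambda>x y n. x n \<oplus>\<^bsub>A Quot ideal_power A I n\<^esub> y n)\<rparr>"

definition completion_map :: "('a, 'x) ring_scheme \<Rightarrow> 'a set \<Rightarrow> 'a \<Rightarrow> nat \<Rightarrow> 'a set" where
  "completion_map A I a = (\<lambda>n. ideal_power A I n +>\<^bsub>A\<^esub> a)"

text \<open>\<open>Im (U \<otimes> V)\<close> in \<open>B \<otimes>\<^sub>k C\<close>, for submodules \<open>U\<close> of \<open>B\<close> and \<open>V\<close> of \<open>C\<close>.\<close>

definition tensor_image ::
  "('k, 'x) ring_scheme \<Rightarrow> ('k, 'b, 'y) module_scheme \<Rightarrow> ('k, 'c, 'z) module_scheme \<Rightarrow>
     'b set \<Rightarrow> 'c set \<Rightarrow> ('b \<times> 'c \<Rightarrow>\<^sub>0 int) set set" where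
  "tensor_image k B C U V =
     generate (add_monoid (tensor_algebra k B C)) {pure_tensor k B C u v | u v. u \<in> U \<and> v \<in> V}"

definition tensor_ideal ::
  "('k, 'x) ring_scheme \<Rightarrow> ('k, 'b, 'y) module_scheme \<Rightarrow> ('k, 'c, 'z) module_scheme \<Rightarrow>
     'b set \<Rightarrow> 'c set \<Rightarrow> ('b \<times> 'c \<Rightarrow>\<^sub>0 int) set set" where
  "tensor_ideal k B C m n =
     tensor_image k B C m (carrier C) <+>\<^bsub>tensor_algebra k B C\<^esub> tensor_image k B C (carrier B) n"

definition completed_tensor ::
  "('k, 'x) ring_scheme \<Rightarrow> ('k, 'b, 'y) module_scheme \<Rightarrow> ('k, 'c, 'z) module_scheme \<Rightarrow>
     'b set \<Rightarrow> 'c set \<Rightarrow> (nat \<Rightarrow> ('b \<times> 'c \<Rightarrow>\<^sub>0 int) set set) ring" where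
  "completed_tensor k B C m n =
     adic_completion (tensor_algebra k B C) (tensor_ideal k B C m n)"

definition completed_inl ::
  "('k, 'x) ring_scheme \<Rightarrow> ('k, 'b, 'y) module_scheme \<Rightarrow> ('k, 'c, 'z) module_scheme \<Rightarrow>
     'b set \<Rightarrow> 'c set \<Rightarrow> 'b \<Rightarrow> nat \<Rightarrow> ('b \<times> 'c \<Rightarrow>\<^sub>0 int) set set" where
  "completed_inl k B C m n b =
     completion_map (tensor_algebra k B C) (tensor_ideal k B C m n) (pure_tensor k B C b \<one>\<^bsub>C\<^esub>)"

definition completed_inr ::
  "('k, 'x) ring_scheme \<Rightarrow> ('k, 'b, 'y) module_scheme \<Rightarrow> ('k, 'c, 'z) module_scheme \<Rightarrow>
     'b set \<Rightarrow> 'c set \<Rightarrow> 'c \<Rightarrow> nat \<Rightarrow> ('b \<times> 'c \<Rightarrow>\<^sub>0 int) set set" where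
  "completed_inr k B C m n c =
     completion_map (tensor_algebra k B C) (tensor_ideal k B C m n) (pure_tensor k B C \<one>\<^bsub>B\<^esub> c)"

end

(* Tensoring over the field k with a filtered vector space is exact, so the completed tensor product
   behaves over B like the m-adic completion of a free module, which is flat because B is
   noetherian.

   Flatness of a B-module M is tested by the colon condition (IM : a) = (I : a)M for all ideals I
   and elements a of B; it yields Lazard's factorization of finitely many relations in M through
   free modules, and hence injectivity of tensored injections. In B (x) C, a relation
   a u = 0 modulo I and modulo a power of r = m (x) C + B (x) n is rewritten with
   k-linear algebra in C, where y_j lies in n^(o_j): u = sum b_j (x) y_j with a b_j = 0 modulo I
   and modulo a power of m depending on o_j. A weak Artin-Rees lemma in B then shows that
   u is in (I : a) times a power of r, up to a higher power of r, and the colon condition for the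
   completion follows by successive approximation. *)
theory Submission
  imports Defs
begin

section \<open>Functional relations in modules\<close>

text \<open>In the completion, I M consists of finite sums and is not known to be closed, so the
  colon condition cannot be had by passing to a limit inside I M. The limit is taken in
  coefficients: (I : a) has a fixed finite set of generators, and each correction needs coefficients
  in the q-th step of the filtration, with q growing. Hence the shape of the approximation lemmas:
  the exponent p on the input depends only on the wanted order q of the coefficients, not on the
  precision N' of the remainder, and q = 0 gives p = 0, so that the process can start at an
  arbitrary element. Some p for each q is enough, so a weak Artin-Rees lemma without a linear bound
  does the job. The other obstacle is that r mixes two filtrations. A k-basis of C adapted to all
  powers of n would separate them, but for C = k[[x]] there is none. Relations with degrees cut off
  at a finite T replace it: they handle finitely many elements at a time and keep track of their
  degrees.\<close>

definition list_sum :: "('a, 'x) ring_scheme \<Rightarrow> 'a list \<Rightarrow> 'a" where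
  "list_sum G xs = foldr (\<lambda>x y. x \<oplus>\<^bsub>G\<^esub> y) xs \<zero>\<^bsub>G\<^esub>"

lemma list_sum_simps [simp]:
  "list_sum G [] = \<zero>\<^bsub>G\<^esub>" "list_sum G (x # xs) = x \<oplus>\<^bsub>G\<^esub> list_sum G xs"
  by (simp_all add: list_sum_def)

lemma (in abelian_group) list_sum_closed [intro]:
  "set xs \<subseteq> carrier G \<Longrightarrow> list_sum G xs \<in> carrier G"
  by (induction xs) auto

text \<open>A list of pairs \<open>(c, x)\<close> stands for the linear relation \<open>\<Sum> c x = 0\<close> between elements of a
  module; \<open>rel_ring\<close> and \<open>rel_module\<close> evaluate it after substituting values for the \<open>x\<close>.\<close>

definition rel_ring :: "('r, 'x) ring_scheme \<Rightarrow> ('r \<times> 'm) list \<Rightarrow> ('m \<Rightarrow> 'r) \<Rightarrow> 'r" where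
  "rel_ring R \<rho> \<phi> = list_sum R (map (\<lambda>(c, x). c \<otimes>\<^bsub>R\<^esub> \<phi> x) \<rho>)"

definition rel_module :: "('r, 'm, 'y) module_scheme \<Rightarrow> ('r \<times> 'm) list \<Rightarrow> ('m \<Rightarrow> 'm) \<Rightarrow> 'm" where
  "rel_module M \<rho> g = list_sum M (map (\<lambda>(c, x). c \<odot>\<^bsub>M\<^esub> g x) \<rho>)"

lemma rel_simps [simp]:
  "rel_ring R [] \<phi> = \<zero>\<^bsub>R\<^esub>"
  "rel_ring R ((c, x) # \<rho>) \<phi> = c \<otimes>\<^bsub>R\<^esub> \<phi> x \<oplus>\<^bsub>R\<^esub> rel_ring R \<rho> \<phi>"
  "rel_module M [] g = \<zero>\<^bsub>M\<^esub>"
  "rel_module M ((c, x) # \<rho>) g = c \<odot>\<^bsub>M\<^esub> g x \<oplus>\<^bsub>M\<^esub> rel_module M \<rho> g"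
  by (simp_all add: rel_ring_def rel_module_def)

definition valid_rels :: "('r, 'x) ring_scheme \<Rightarrow> ('r, 'm, 'y) module_scheme \<Rightarrow> ('r \<times> 'm) list list \<Rightarrow> bool" where
  "valid_rels R M D \<longleftrightarrow>
     (\<forall>\<rho>\<in>set D. set \<rho> \<subseteq> carrier R \<times> carrier M \<and> rel_module M \<rho> id = \<zero>\<^bsub>M\<^esub>)"

definition rel_functions :: "('r, 'x) ring_scheme \<Rightarrow> ('r \<times> 'm) list list \<Rightarrow> ('m \<Rightarrow> 'r) set" where
  "rel_functions R D = {\<phi>. (\<forall>x. \<phi> x \<in> carrier R) \<and> (\<forall>\<rho>\<in>set D. rel_ring R \<rho> \<phi> = \<zero>\<^bsub>R\<^esub>)}"

text \<open>A member is a function into a free module R^l, with the \<phi> as coordinates, followed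
  by the linear map R^l -> M given by the y. The \<phi> need not be linear; they are only asked to
  satisfy finitely many relations. A member that is the identity on a finite set U factors U through
  R^l.\<close>

inductive_set fun_span :: "('r, 'm, 'y) module_scheme \<Rightarrow> (('x \<Rightarrow> 'r) \<times> 'm) set \<Rightarrow> ('x \<Rightarrow> 'm) set"
  for M and \<Gamma> where
    zero: "(\<lambda>_. \<zero>\<^bsub>M\<^esub>) \<in> fun_span M \<Gamma>"
  | step: "(\<phi>, y) \<in> \<Gamma> \<Longrightarrow> g \<in> fun_span M \<Gamma> \<Longrightarrow> (\<lambda>x. \<phi> x \<odot>\<^bsub>M\<^esub> y \<oplus>\<^bsub>M\<^esub> g x) \<in> fun_span M \<Gamma>"

text \<open>For an ideal this is the submodule I M. An arbitrary set I is allowed so that the values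
  of a relation on a set of functions can be inserted as they are.\<close>

inductive_set ideal_span :: "('r, 'm, 'y) module_scheme \<Rightarrow> 'r set \<Rightarrow> 'm set" for M and I where
    zero: "\<zero>\<^bsub>M\<^esub> \<in> ideal_span M I"
  | step: "i \<in> I \<Longrightarrow> y \<in> carrier M \<Longrightarrow> t \<in> ideal_span M I \<Longrightarrow> i \<odot>\<^bsub>M\<^esub> y \<oplus>\<^bsub>M\<^esub> t \<in> ideal_span M I"

definition colon_ideal :: "('r, 'x) ring_scheme \<Rightarrow> 'r set \<Rightarrow> 'r \<Rightarrow> 'r set" where
  "colon_ideal R I a = {c \<in> carrier R. c \<otimes>\<^bsub>R\<^esub> a \<in> I}"

text \<open>Multiplication by a induces an injection R/(I : a) -> R/I. The condition says that it
  stays injective after tensoring with M, in the form M/(I : a)M -> M/IM; it speaks of elements of R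
  and M only, without any further module.\<close>

definition colon_flat :: "('r, 'x) ring_scheme \<Rightarrow> ('r, 'm, 'y) module_scheme \<Rightarrow> bool" where
  "colon_flat R M \<longleftrightarrow>
     (\<forall>I a. \<forall>y\<in>carrier M. ideal I R \<and> a \<in> carrier R \<and> a \<odot>\<^bsub>M\<^esub> y \<in> ideal_span M I \<longrightarrow>
        y \<in> ideal_span M (colon_ideal R I a))"

lemma fun_span_mono: "g \<in> fun_span M \<Gamma> \<Longrightarrow> \<Gamma> \<subseteq> \<Gamma>' \<Longrightarrow> g \<in> fun_span M \<Gamma>'"
  by (induction rule: fun_span.induct) (auto intro: fun_span.intros)

text \<open>The recursion on the list matches \<open>fun_span_kernel\<close>, which removes one
  generator at a time and compares it with the span of the remaining ones.\<close>

primrec lin_comb :: "('r, 'x) ring_scheme \<Rightarrow> ('i \<Rightarrow> 'r) list \<Rightarrow> ('i \<Rightarrow> 'r) set" where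
  "lin_comb R [] = {\<lambda>_. \<zero>\<^bsub>R\<^esub>}"
| "lin_comb R (\<phi> # \<phi>s) = {\<lambda>x. b \<otimes>\<^bsub>R\<^esub> \<phi> x \<oplus>\<^bsub>R\<^esub> \<psi> x | b \<psi>. b \<in> carrier R \<and> \<psi> \<in> lin_comb R \<phi>s}"

section \<open>Linearity of the evaluation of relations\<close>

context module
begin

lemma rel_ring_closed:
  "set \<rho> \<subseteq> carrier R \<times> U \<Longrightarrow> (\<And>x. \<phi> x \<in> carrier R) \<Longrightarrow> rel_ring R \<rho> \<phi> \<in> carrier R"
  by (induction \<rho>) auto

lemma rel_module_closed:
  "set \<rho> \<subseteq> carrier R \<times> U \<Longrightarrow> (\<And>x. g x \<in> carrier M) \<Longrightarrow> rel_module M \<rho> g \<in> carrier M"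
  by (induction \<rho>) auto

lemma rel_ring_add:
  assumes "set \<rho> \<subseteq> carrier R \<times> U" "\<And>x. \<phi> x \<in> carrier R" "\<And>x. \<psi> x \<in> carrier R"
  shows "rel_ring R \<rho> (\<lambda>x. \<phi> x \<oplus> \<psi> x) = rel_ring R \<rho> \<phi> \<oplus> rel_ring R \<rho> \<psi>"
  using assms by (induction \<rho>) (auto simp: rel_ring_closed[of _ U] R.r_distr R.a_ac)

lemma rel_ring_smult:
  assumes "set \<rho> \<subseteq> carrier R \<times> U" "\<And>x. \<phi> x \<in> carrier R" "b \<in> carrier R"
  shows "rel_ring R \<rho> (\<lambda>x. b \<otimes> \<phi> x) = b \<otimes> rel_ring R \<rho> \<phi>"
  using assms by (induction \<rho>) (auto simp: rel_ring_closed[of _ U] R.r_distr R.m_lcomm)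

lemma rel_ring_zero:
  "set \<rho> \<subseteq> carrier R \<times> U \<Longrightarrow> rel_ring R \<rho> (\<lambda>x. \<zero>) = \<zero>"
  by (induction \<rho>) auto

lemma rel_module_add:
  assumes "set \<rho> \<subseteq> carrier R \<times> U" "\<And>x. g x \<in> carrier M" "\<And>x. h x \<in> carrier M"
  shows "rel_module M \<rho> (\<lambda>x. g x \<oplus>\<^bsub>M\<^esub> h x) = rel_module M \<rho> g \<oplus>\<^bsub>M\<^esub> rel_module M \<rho> h"
  using assms by (induction \<rho>) (auto simp: rel_module_closed[of _ U] smult_r_distr M.a_ac)

lemma rel_module_smult:
  assumes "set \<rho> \<subseteq> carrier R \<times> U" "\<And>x. \<phi> x \<in> carrier R" "y \<in> carrier M"
  shows "rel_module M \<rho> (\<lambda>x. \<phi> x \<odot>\<^bsub>M\<^esub> y) = rel_ring R \<rho> \<phi> \<odot>\<^bsub>M\<^esub> y"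
  using assms by (induction \<rho>) (auto simp: rel_ring_closed[of _ U] smult_l_distr smult_assoc1)

lemma rel_module_zero:
  "set \<rho> \<subseteq> carrier R \<times> U \<Longrightarrow> rel_module M \<rho> (\<lambda>x. \<zero>\<^bsub>M\<^esub>) = \<zero>\<^bsub>M\<^esub>"
  by (induction \<rho>) auto

lemma rel_module_cong:
  "(\<And>c x. (c, x) \<in> set \<rho> \<Longrightarrow> g x = h x) \<Longrightarrow> rel_module M \<rho> g = rel_module M \<rho> h"
  unfolding rel_module_def by (intro arg_cong[of _ _ "list_sum M"] map_cong) auto

lemma fun_span_closed:
  assumes "g \<in> fun_span M \<Gamma>" "\<Gamma> \<subseteq> (UNIV \<rightarrow> carrier R) \<times> carrier M"
  shows "g x \<in> carrier M"
  using assms by (induction arbitrary: x rule: fun_span.induct) (auto simp: Pi_def)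

lemma fun_span_add:
  assumes "g \<in> fun_span M \<Gamma>" "h \<in> fun_span M \<Gamma>"
    "\<Gamma> \<subseteq> (UNIV \<rightarrow> carrier R) \<times> carrier M"
  shows "(\<lambda>x. g x \<oplus>\<^bsub>M\<^esub> h x) \<in> fun_span M \<Gamma>"
  using assms
proof (induction rule: fun_span.induct)
  case zero
  have "(\<lambda>x. \<zero>\<^bsub>M\<^esub> \<oplus>\<^bsub>M\<^esub> h x) = h"
    using fun_span_closed[OF zero] by simp
  then show ?case using zero by simp
next
  case (step \<phi> y g)
  have "(\<lambda>x. \<phi> x \<odot>\<^bsub>M\<^esub> y \<oplus>\<^bsub>M\<^esub> g x \<oplus>\<^bsub>M\<^esub> h x) = (\<lambda>x. \<phi> x \<odot>\<^bsub>M\<^esub> y \<oplus>\<^bsub>M\<^esub> (g x \<oplus>\<^bsub>M\<^esub> h x))"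
  proof (intro ext M.a_assoc smult_closed)
    have "\<phi> \<in> UNIV \<rightarrow> carrier R" "y \<in> carrier M" using step(1,5) by blast+
    then show "\<phi> x \<in> carrier R" "y \<in> carrier M" for x by auto
  qed (use fun_span_closed[OF step(4,5)] fun_span_closed[OF step(2,5)] in auto)
  then show ?case using fun_span.step[OF step(1) step.IH[OF step.prems]] by simp
qed

lemma ideal_span_closed:
  assumes "t \<in> ideal_span M I" "I \<subseteq> carrier R"
  shows "t \<in> carrier M"
  using assms by (induction rule: ideal_span.induct) auto

lemma ideal_span_add:
  assumes "s \<in> ideal_span M I" "t \<in> ideal_span M I" "I \<subseteq> carrier R"
  shows "s \<oplus>\<^bsub>M\<^esub> t \<in> ideal_span M I"
  using assms
proof (induction rule: ideal_span.induct)
  case zero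
  then show ?case using ideal_span_closed by simp
next
  case (step i y s)
  have "i \<odot>\<^bsub>M\<^esub> y \<oplus>\<^bsub>M\<^esub> s \<oplus>\<^bsub>M\<^esub> t = i \<odot>\<^bsub>M\<^esub> y \<oplus>\<^bsub>M\<^esub> (s \<oplus>\<^bsub>M\<^esub> t)"
    using step ideal_span_closed by (intro M.a_assoc) auto
  then show ?case using step ideal_span.step by simp
qed

lemma ideal_span_minus:
  assumes "t \<in> ideal_span M I" "ideal I R"
  shows "\<ominus>\<^bsub>M\<^esub> t \<in> ideal_span M I"
  using assms
proof (induction rule: ideal_span.induct)
  case zero
  then show ?case by (simp add: M.add.inv_one[folded a_inv_def] ideal_span.zero)
next
  case (step i y s)
  interpret I: ideal I R by fact
  have "\<ominus>\<^bsub>M\<^esub> (i \<odot>\<^bsub>M\<^esub> y \<oplus>\<^bsub>M\<^esub> s) = (\<ominus> i) \<odot>\<^bsub>M\<^esub> y \<oplus>\<^bsub>M\<^esub> (\<ominus>\<^bsub>M\<^esub> s)"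
    using step ideal_span_closed[OF step(3) I.a_subset] by (simp add: M.minus_add smult_l_minus)
  moreover have "(\<ominus> i) \<odot>\<^bsub>M\<^esub> y \<oplus>\<^bsub>M\<^esub> (\<ominus>\<^bsub>M\<^esub> s) \<in> ideal_span M I"
    using step by (intro ideal_span.step) auto
  ultimately show ?case by simp
qed

lemma lin_comb_closed:
  "\<psi> \<in> lin_comb R \<phi>s \<Longrightarrow> set \<phi>s \<subseteq> UNIV \<rightarrow> carrier R \<Longrightarrow> \<psi> x \<in> carrier R"
  by (induction \<phi>s arbitrary: \<psi>) (auto simp: Pi_def)

lemma lin_comb_subset: "set \<phi>s \<subseteq> UNIV \<rightarrow> carrier R \<Longrightarrow> lin_comb R \<phi>s \<subseteq> UNIV \<rightarrow> carrier R"
  by (intro subsetI Pi_I) (rule lin_comb_closed)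

lemma lin_comb_rel_functions:
  assumes "set D \<subseteq> {\<rho>. set \<rho> \<subseteq> carrier R \<times> U}"
  shows "\<psi> \<in> lin_comb R \<phi>s \<Longrightarrow> set \<phi>s \<subseteq> rel_functions R D \<Longrightarrow> \<psi> \<in> rel_functions R D"
proof (induction \<phi>s arbitrary: \<psi>)
  case Nil
  then show ?case using assms by (auto simp: rel_functions_def rel_ring_zero[of _ U])
next
  case (Cons \<phi> \<phi>s)
  then obtain b \<xi> where b: "b \<in> carrier R" "\<xi> \<in> lin_comb R \<phi>s"
    and \<psi>: "\<psi> = (\<lambda>x. b \<otimes> \<phi> x \<oplus> \<xi> x)" by auto
  have "\<xi> \<in> rel_functions R D" "\<phi> \<in> rel_functions R D" using Cons b by auto
  then show ?case using assms b(1)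
    by (auto simp: \<psi> rel_functions_def rel_ring_add[of _ U] rel_ring_smult[of _ U] subset_iff)
qed

lemma lin_comb_zero:
  "set \<phi>s \<subseteq> UNIV \<rightarrow> carrier R \<Longrightarrow> (\<lambda>_. \<zero>) \<in> lin_comb R \<phi>s"
proof (induction \<phi>s)
  case (Cons \<phi> \<phi>s)
  then have "(\<lambda>x. \<zero> \<otimes> \<phi> x \<oplus> \<zero>) = (\<lambda>_. \<zero>)" by (simp add: Pi_def)
  moreover have "(\<lambda>x. \<zero>) \<in> lin_comb R \<phi>s" using Cons by simp
  ultimately show ?case unfolding lin_comb.simps mem_Collect_eq using R.zero_closed
    by (intro exI[of _ \<zero>] exI[of _ "\<lambda>_. \<zero>"]) simp
qed simp

lemma lin_comb_add:
  "\<psi> \<in> lin_comb R \<phi>s \<Longrightarrow> \<xi> \<in> lin_comb R \<phi>s \<Longrightarrow> set \<phi>s \<subseteq> UNIV \<rightarrow> carrier R \<Longrightarrow>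
   (\<lambda>x. \<psi> x \<oplus> \<xi> x) \<in> lin_comb R \<phi>s"
proof (induction \<phi>s arbitrary: \<psi> \<xi>)
  case (Cons \<phi> \<phi>s)
  then obtain b \<psi>' c \<xi>' where b: "b \<in> carrier R" "\<psi>' \<in> lin_comb R \<phi>s" "\<psi> = (\<lambda>x. b \<otimes> \<phi> x \<oplus> \<psi>' x)"
    and c: "c \<in> carrier R" "\<xi>' \<in> lin_comb R \<phi>s" "\<xi> = (\<lambda>x. c \<otimes> \<phi> x \<oplus> \<xi>' x)" by auto
  have cl: "\<And>x. \<psi>' x \<in> carrier R" "\<And>x. \<xi>' x \<in> carrier R" "\<And>x. \<phi> x \<in> carrier R"
    using lin_comb_closed[OF b(2)] lin_comb_closed[OF c(2)] Cons.prems(3) by (auto simp: Pi_def)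
  have "(\<lambda>x. \<psi> x \<oplus> \<xi> x) = (\<lambda>x. (b \<oplus> c) \<otimes> \<phi> x \<oplus> (\<psi>' x \<oplus> \<xi>' x))"
    unfolding b(3) c(3) using cl b(1) c(1) by (intro ext) (simp add: R.l_distr R.a_ac)
  moreover have "(\<lambda>x. \<psi>' x \<oplus> \<xi>' x) \<in> lin_comb R \<phi>s"
    using Cons b c by auto
  ultimately show ?case unfolding lin_comb.simps mem_Collect_eq using b(1) c(1)
    by (intro exI[of _ "b \<oplus> c"] exI[of _ "\<lambda>x. \<psi>' x \<oplus> \<xi>' x"]) simp
qed simp

lemma lin_comb_smult:
  "\<psi> \<in> lin_comb R \<phi>s \<Longrightarrow> a \<in> carrier R \<Longrightarrow> set \<phi>s \<subseteq> UNIV \<rightarrow> carrier R \<Longrightarrow>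
   (\<lambda>x. a \<otimes> \<psi> x) \<in> lin_comb R \<phi>s"
proof (induction \<phi>s arbitrary: \<psi>)
  case (Cons \<phi> \<phi>s)
  then obtain b \<psi>' where b: "b \<in> carrier R" "\<psi>' \<in> lin_comb R \<phi>s" "\<psi> = (\<lambda>x. b \<otimes> \<phi> x \<oplus> \<psi>' x)" by auto
  have cl: "\<And>x. \<psi>' x \<in> carrier R" "\<And>x. \<phi> x \<in> carrier R"
    using lin_comb_closed[OF b(2)] Cons.prems(3) by (auto simp: Pi_def)
  have "(\<lambda>x. a \<otimes> \<psi> x) = (\<lambda>x. (a \<otimes> b) \<otimes> \<phi> x \<oplus> a \<otimes> \<psi>' x)"
    unfolding b(3) using cl b(1) Cons.prems(2) by (intro ext) (simp add: R.r_distr R.m_assoc)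
  moreover have "(\<lambda>x. a \<otimes> \<psi>' x) \<in> lin_comb R \<phi>s"
    using Cons b by auto
  ultimately show ?case unfolding lin_comb.simps mem_Collect_eq using b(1) Cons.prems(2)
    by (intro exI[of _ "a \<otimes> b"] exI[of _ "\<lambda>x. a \<otimes> \<psi>' x"]) simp
qed simp

text \<open>Each coefficient is b \<phi> + \<xi> with \<xi> in the span of the tail. Moving b to the
  module element collects all multiples of \<phi> in one term, which isolates the generator to be
  eliminated.\<close>

lemma fun_span_lin_comb_Cons:
  assumes "g \<in> fun_span M (lin_comb R (\<phi> # \<phi>s) \<times> carrier M)"
    "set (\<phi> # \<phi>s) \<subseteq> UNIV \<rightarrow> carrier R"
  shows "\<exists>y\<in>carrier M. \<exists>h\<in>fun_span M (lin_comb R \<phi>s \<times> carrier M). g = (\<lambda>x. \<phi> x \<odot>\<^bsub>M\<^esub> y \<oplus>\<^bsub>M\<^esub> h x)"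
  using assms(1)
proof (induction rule: fun_span.induct)
  case zero
  have "(\<lambda>x. \<phi> x \<odot>\<^bsub>M\<^esub> \<zero>\<^bsub>M\<^esub> \<oplus>\<^bsub>M\<^esub> \<zero>\<^bsub>M\<^esub>) = (\<lambda>_. \<zero>\<^bsub>M\<^esub>)" using assms(2) by (simp add: Pi_def)
  then show ?case
    by (intro bexI[OF bexI[OF _ fun_span.zero] M.zero_closed]) simp
next
  case (step \<psi> z g)
  then obtain y h where y: "y \<in> carrier M" and h: "h \<in> fun_span M (lin_comb R \<phi>s \<times> carrier M)"
    and g: "g = (\<lambda>x. \<phi> x \<odot>\<^bsub>M\<^esub> y \<oplus>\<^bsub>M\<^esub> h x)" by auto
  from step(1) obtain b \<xi> where b: "b \<in> carrier R" and \<xi>: "\<xi> \<in> lin_comb R \<phi>s"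
    and \<psi>: "\<psi> = (\<lambda>x. b \<otimes> \<phi> x \<oplus> \<xi> x)" and z: "z \<in> carrier M" by auto
  have cl: "\<And>x. \<phi> x \<in> carrier R" "\<And>x. \<xi> x \<in> carrier R" "\<And>x. h x \<in> carrier M"
    using lin_comb_closed[OF \<xi>] fun_span_closed[OF h] lin_comb_subset[of \<phi>s] assms(2)
    by (auto simp: Pi_def)
  have e: "(\<lambda>x. \<psi> x \<odot>\<^bsub>M\<^esub> z \<oplus>\<^bsub>M\<^esub> g x) =
        (\<lambda>x. \<phi> x \<odot>\<^bsub>M\<^esub> (b \<odot>\<^bsub>M\<^esub> z \<oplus>\<^bsub>M\<^esub> y) \<oplus>\<^bsub>M\<^esub> (\<xi> x \<odot>\<^bsub>M\<^esub> z \<oplus>\<^bsub>M\<^esub> h x))"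
    unfolding \<psi> g using cl b(1) y z
    by (intro ext) (simp add: smult_l_distr smult_r_distr R.m_comm[of b] smult_assoc1 M.a_ac)
  have s: "(\<lambda>x. \<xi> x \<odot>\<^bsub>M\<^esub> z \<oplus>\<^bsub>M\<^esub> h x) \<in> fun_span M (lin_comb R \<phi>s \<times> carrier M)"
    using h \<xi> z by (intro fun_span.step) auto
  have "b \<odot>\<^bsub>M\<^esub> z \<oplus>\<^bsub>M\<^esub> y \<in> carrier M" using b(1) y z by simp
  then show ?case using e s by (intro rev_bexI)
qed

text \<open>Only finitely many coefficient functions occur in a member. Listing them makes an
  induction over generators possible.\<close>

lemma fun_span_finite_support:
  assumes "g \<in> fun_span M (\<Lambda> \<times> carrier M)" "\<Lambda> \<subseteq> UNIV \<rightarrow> carrier R"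
  shows "\<exists>\<phi>s. set \<phi>s \<subseteq> \<Lambda> \<and> g \<in> fun_span M (lin_comb R \<phi>s \<times> carrier M)"
  using assms(1)
proof (induction rule: fun_span.induct)
  case zero
  then show ?case by (intro exI[of _ "[]"]) (auto intro: fun_span.zero)
next
  case (step \<psi> z g)
  then obtain \<phi>s where \<phi>s: "set \<phi>s \<subseteq> \<Lambda>" and g: "g \<in> fun_span M (lin_comb R \<phi>s \<times> carrier M)" by auto
  have cl: "set \<phi>s \<subseteq> UNIV \<rightarrow> carrier R" "\<And>x. \<psi> x \<in> carrier R" "\<psi> \<in> \<Lambda>" "z \<in> carrier M"
    using \<phi>s assms(2) step by (auto simp: Pi_def)
  have "\<xi> \<in> lin_comb R (\<psi> # \<phi>s)" if "\<xi> \<in> lin_comb R \<phi>s" for \<xi>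
  proof -
    have "\<xi> = (\<lambda>x. \<zero> \<otimes> \<psi> x \<oplus> \<xi> x)" using lin_comb_closed[OF that] cl(1,2) by simp
    then show ?thesis using that by auto
  qed
  then have 1: "g \<in> fun_span M (lin_comb R (\<psi> # \<phi>s) \<times> carrier M)"
    using g by (elim fun_span_mono) auto
  have "\<psi> = (\<lambda>x. \<one> \<otimes> \<psi> x \<oplus> \<zero>)" using cl by simp
  then have 2: "\<psi> \<in> lin_comb R (\<psi> # \<phi>s)" using lin_comb_zero[of \<phi>s] cl(1) by force
  have "(\<lambda>x. \<psi> x \<odot>\<^bsub>M\<^esub> z \<oplus>\<^bsub>M\<^esub> g x) \<in> fun_span M (lin_comb R (\<psi> # \<phi>s) \<times> carrier M)"
    using 1 2 cl(4) by (intro fun_span.step) auto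
  then show ?case using \<phi>s cl(3) by (intro exI[of _ "\<psi> # \<phi>s"]) auto
qed


section \<open>Kernels of relations and factorization through free modules\<close>

lemma rel_module_fun_span:
  assumes "g \<in> fun_span M (\<Lambda> \<times> carrier M)" "\<Lambda> \<subseteq> UNIV \<rightarrow> carrier R"
    "set \<rho> \<subseteq> carrier R \<times> U"
  shows "rel_module M \<rho> g \<in> ideal_span M (rel_ring R \<rho> ` \<Lambda>)"
  using assms(1)
proof (induction rule: fun_span.induct)
  case zero
  then show ?case using assms(3) by (simp add: rel_module_zero ideal_span.zero)
next
  case (step \<phi> y g)
  have cl: "\<And>x. g x \<in> carrier M" "\<And>x. \<phi> x \<in> carrier R" "y \<in> carrier M"
    using fun_span_closed[OF step(2)] assms(2) step(1) by auto
  have "rel_module M \<rho> (\<lambda>x. \<phi> x \<odot>\<^bsub>M\<^esub> y \<oplus>\<^bsub>M\<^esub> g x) = rel_ring R \<rho> \<phi> \<odot>\<^bsub>M\<^esub> y \<oplus>\<^bsub>M\<^esub> rel_module M \<rho> g"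
    using cl assms(3) by (simp add: rel_module_add[of _ U] rel_module_smult[of _ U])
  then show ?case using step cl(3) by (auto intro!: ideal_span.step)
qed

text \<open>Supplies the ideal I to which \<open>fun_span_kernel\<close> applies the colon
  condition; the closure properties come from the linearity of \<open>rel_ring\<close>.\<close>

lemma ideal_rel_ring_lin_comb:
  assumes "set \<phi>s \<subseteq> UNIV \<rightarrow> carrier R" "set \<rho> \<subseteq> carrier R \<times> U"
  shows "ideal (rel_ring R \<rho> ` lin_comb R \<phi>s) R"
proof (rule idealI)
  have cl: "\<psi> x \<in> carrier R" if "\<psi> \<in> lin_comb R \<phi>s" for \<psi> x
    using lin_comb_closed[OF that assms(1)] .
  note lin = rel_ring_add[OF assms(2) cl cl] rel_ring_smult[OF assms(2) cl]
  have carr: "rel_ring R \<rho> \<psi> \<in> carrier R" if "\<psi> \<in> lin_comb R \<phi>s" for \<psi>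
    using rel_ring_closed[OF assms(2)] cl[OF that] by blast
  have sm: "x \<otimes> a \<in> rel_ring R \<rho> ` lin_comb R \<phi>s"
    if a: "a \<in> rel_ring R \<rho> ` lin_comb R \<phi>s" and x: "x \<in> carrier R" for a x
  proof -
    obtain \<psi> where \<psi>: "\<psi> \<in> lin_comb R \<phi>s" "a = rel_ring R \<rho> \<psi>" using a by blast
    show ?thesis using imageI[OF lin_comb_smult[OF \<psi>(1) x assms(1)], of "rel_ring R \<rho>"]
      by (simp only: lin(2)[OF \<psi>(1) x] \<psi>(2))
  qed
  show "ring R" by (rule R.ring_axioms)
  show "subgroup (rel_ring R \<rho> ` lin_comb R \<phi>s) (add_monoid R)"
  proof (rule R.add.subgroupI)
    show "rel_ring R \<rho> ` lin_comb R \<phi>s \<subseteq> carrier R" using carr by auto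
    show "rel_ring R \<rho> ` lin_comb R \<phi>s \<noteq> {}" using lin_comb_zero[OF assms(1)] by auto
    show "\<ominus> a \<in> rel_ring R \<rho> ` lin_comb R \<phi>s" if "a \<in> rel_ring R \<rho> ` lin_comb R \<phi>s" for a
      using sm[OF that, of "\<ominus> \<one>"] that carr by (auto simp add: R.l_minus)
    show "a \<oplus> b \<in> rel_ring R \<rho> ` lin_comb R \<phi>s"
      if ab: "a \<in> rel_ring R \<rho> ` lin_comb R \<phi>s" "b \<in> rel_ring R \<rho> ` lin_comb R \<phi>s" for a b
    proof -
      obtain \<psi> \<xi> where \<psi>: "\<psi> \<in> lin_comb R \<phi>s" "a = rel_ring R \<rho> \<psi>"
        and \<xi>: "\<xi> \<in> lin_comb R \<phi>s" "b = rel_ring R \<rho> \<xi>" using ab by blast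
      show ?thesis using imageI[OF lin_comb_add[OF \<psi>(1) \<xi>(1) assms(1)], of "rel_ring R \<rho>"]
        by (simp only: lin(1)[OF \<psi>(1) \<xi>(1)] \<psi>(2) \<xi>(2))
    qed
  qed
  show "x \<otimes> a \<in> rel_ring R \<rho> ` lin_comb R \<phi>s"
    if "a \<in> rel_ring R \<rho> ` lin_comb R \<phi>s" "x \<in> carrier R" for a x using sm that .
  show "a \<otimes> x \<in> rel_ring R \<rho> ` lin_comb R \<phi>s"
    if "a \<in> rel_ring R \<rho> ` lin_comb R \<phi>s" "x \<in> carrier R" for a x
    using sm[OF that] that carr by (auto simp: R.m_comm)
qed

lemma rel_functions_subset: "rel_functions R D \<subseteq> UNIV \<rightarrow> carrier R"
  by (auto simp: rel_functions_def)

text \<open>Write g = \<phi> y + h with h over the remaining generators, and let a be the value of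
  \<rho> at \<phi> and I the ideal of its values on the remaining span. Since \<rho> kills g, a y is
  minus a member of I M, so y lies in (I : a) M. Each c in (I : a) allows c \<phi> to be corrected
  by a member of the remaining span so that it satisfies \<rho>. What is left over involves fewer
  generators.\<close>

lemma fun_span_kernel:
  assumes "colon_flat R M" and D: "set D \<subseteq> {\<rho>. set \<rho> \<subseteq> carrier R \<times> carrier M}"
    and \<rho>: "set \<rho> \<subseteq> carrier R \<times> carrier M"
  shows "set \<phi>s \<subseteq> rel_functions R D \<Longrightarrow> g \<in> fun_span M (lin_comb R \<phi>s \<times> carrier M) \<Longrightarrow>
    rel_module M \<rho> g = \<zero>\<^bsub>M\<^esub> \<Longrightarrow> g \<in> fun_span M (rel_functions R (\<rho> # D) \<times> carrier M)"
proof (induction \<phi>s arbitrary: g)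
  case Nil
  have "(\<lambda>_. \<zero>) \<in> rel_functions R (\<rho> # D)"
    using D \<rho> by (auto simp: rel_functions_def rel_ring_zero[of _ "carrier M"])
  then show ?case using Nil(2) by (elim fun_span_mono) auto
next
  case (Cons \<phi> \<phi>s)
  define \<Lambda> where "\<Lambda> = rel_functions R (\<rho> # D)"
  define L where "L = lin_comb R \<phi>s"
  have cl: "set (\<phi> # \<phi>s) \<subseteq> UNIV \<rightarrow> carrier R"
    using Cons.prems(1) rel_functions_subset by (rule subset_trans)
  then have cl': "set \<phi>s \<subseteq> UNIV \<rightarrow> carrier R" by simp
  have cl\<Lambda>: "\<Lambda> \<subseteq> UNIV \<rightarrow> carrier R" unfolding \<Lambda>_def by (rule rel_functions_subset)
  have clL: "L \<subseteq> UNIV \<rightarrow> carrier R" unfolding L_def using lin_comb_subset[OF cl'] .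
  have clS: "\<Lambda> \<times> carrier M \<subseteq> (UNIV \<rightarrow> carrier R) \<times> carrier M"
    "L \<times> carrier M \<subseteq> (UNIV \<rightarrow> carrier R) \<times> carrier M" using cl\<Lambda> clL by auto
  have cl\<phi>: "\<And>x. \<phi> x \<in> carrier R" using cl by (auto simp: Pi_def)
  obtain y h where y: "y \<in> carrier M" and h: "h \<in> fun_span M (L \<times> carrier M)"
    and g: "g = (\<lambda>x. \<phi> x \<odot>\<^bsub>M\<^esub> y \<oplus>\<^bsub>M\<^esub> h x)"
    unfolding L_def using fun_span_lin_comb_Cons[OF Cons.prems(2) cl] by auto
  define I where "I = rel_ring R \<rho> ` L"
  define a where "a = rel_ring R \<rho> \<phi>"
  have idI: "ideal I R" unfolding I_def L_def using ideal_rel_ring_lin_comb[OF cl' \<rho>] .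
  have acarr: "a \<in> carrier R" unfolding a_def using rel_ring_closed[OF \<rho> cl\<phi>] .
  have hM: "\<And>x. h x \<in> carrier M" using fun_span_closed[OF h clS(2)] .
  have rh: "rel_module M \<rho> h \<in> ideal_span M I"
    unfolding I_def using rel_module_fun_span[OF h clL \<rho>] .
  have rhM: "rel_module M \<rho> h \<in> carrier M" using rel_module_closed[OF \<rho> hM] .
  have "a \<odot>\<^bsub>M\<^esub> y \<oplus>\<^bsub>M\<^esub> rel_module M \<rho> h = \<zero>\<^bsub>M\<^esub>"
    using Cons.prems(3) unfolding g a_def
    by (simp add: rel_module_add[OF \<rho>] rel_module_smult[OF \<rho>] cl\<phi> y hM)
  then have "a \<odot>\<^bsub>M\<^esub> y = \<ominus>\<^bsub>M\<^esub> rel_module M \<rho> h"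
    using acarr y rhM by (simp add: M.minus_equality)
  then have "a \<odot>\<^bsub>M\<^esub> y \<in> ideal_span M I" using ideal_span_minus[OF rh idI] by simp
  then have "y \<in> ideal_span M (colon_ideal R I a)"
    using assms(1) y idI acarr unfolding colon_flat_def by blast
  then have "\<exists>g1\<in>fun_span M (\<Lambda> \<times> carrier M). \<exists>h1\<in>fun_span M (L \<times> carrier M).
      (\<lambda>x. \<phi> x \<odot>\<^bsub>M\<^esub> y) = (\<lambda>x. g1 x \<oplus>\<^bsub>M\<^esub> h1 x)"
  proof (induction rule: ideal_span.induct)
    case zero
    show ?case
      by (rule bexI[OF bexI[OF _ fun_span.zero] fun_span.zero]) (use cl\<phi> in simp)
  next
    case (step c z t)
    from step.IH obtain g1 h1 where g1: "g1 \<in> fun_span M (\<Lambda> \<times> carrier M)"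
      and h1: "h1 \<in> fun_span M (L \<times> carrier M)"
      and t: "(\<lambda>x. \<phi> x \<odot>\<^bsub>M\<^esub> t) = (\<lambda>x. g1 x \<oplus>\<^bsub>M\<^esub> h1 x)" by auto
    have c: "c \<in> carrier R" "c \<otimes> a \<in> I" using step(1) by (auto simp: colon_ideal_def)
    then obtain \<psi> where \<psi>: "\<psi> \<in> L" "c \<otimes> a = rel_ring R \<rho> \<psi>" unfolding I_def by auto
    \<comment> \<open>As c a lies in I, some \<psi> in the remaining span has the same \<rho>-value
      as c \<phi>; the difference \<xi> satisfies \<rho> in addition to D.\<close>
    define \<xi> where "\<xi> = (\<lambda>x. c \<otimes> \<phi> x \<oplus> (\<ominus> \<one>) \<otimes> \<psi> x)"
    have tM: "t \<in> carrier M"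
      using ideal_span_closed[OF step(3)] by (auto simp: colon_ideal_def)
    have cl\<psi>: "\<And>x. \<psi> x \<in> carrier R" using clL \<psi>(1) by (auto simp: Pi_def)
    have "rel_ring R \<rho>' \<xi> = c \<otimes> rel_ring R \<rho>' \<phi> \<oplus> (\<ominus> \<one>) \<otimes> rel_ring R \<rho>' \<psi>"
      if "set \<rho>' \<subseteq> carrier R \<times> carrier M" for \<rho>'
      unfolding \<xi>_def using that c(1) cl\<psi> cl\<phi>
      by (simp add: rel_ring_add[OF that] rel_ring_smult[OF that])
    moreover have "\<psi> \<in> rel_functions R D" "\<phi> \<in> rel_functions R D"
      using lin_comb_rel_functions[OF D] \<psi>(1) Cons.prems(1) unfolding L_def by auto
    ultimately have \<xi>: "\<xi> \<in> \<Lambda>"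
      unfolding \<Lambda>_def using D \<rho> c \<psi>(2) cl\<phi> cl\<psi> rel_ring_closed[OF \<rho> cl\<psi>] unfolding a_def
      by (auto simp: rel_functions_def subset_iff \<xi>_def R.l_minus R.r_neg)
    then have "(\<lambda>x. \<xi> x \<odot>\<^bsub>M\<^esub> z \<oplus>\<^bsub>M\<^esub> g1 x) \<in> fun_span M (\<Lambda> \<times> carrier M)"
      using step(2) g1 by (intro fun_span.step) auto
    moreover have "(\<lambda>x. \<psi> x \<odot>\<^bsub>M\<^esub> z \<oplus>\<^bsub>M\<^esub> h1 x) \<in> fun_span M (L \<times> carrier M)"
      using step(2) h1 \<psi> by (intro fun_span.step) auto
    moreover have cl\<xi>: "\<And>x. \<xi> x \<in> carrier R" using \<xi> cl\<Lambda> by (auto simp: Pi_def)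
    have "\<phi> x \<odot>\<^bsub>M\<^esub> (c \<odot>\<^bsub>M\<^esub> z \<oplus>\<^bsub>M\<^esub> t) = (\<xi> x \<odot>\<^bsub>M\<^esub> z \<oplus>\<^bsub>M\<^esub> g1 x) \<oplus>\<^bsub>M\<^esub> (\<psi> x \<odot>\<^bsub>M\<^esub> z \<oplus>\<^bsub>M\<^esub> h1 x)" for x
    proof -
      have M: "g1 x \<in> carrier M" "h1 x \<in> carrier M"
        using fun_span_closed[OF g1 clS(1)] fun_span_closed[OF h1 clS(2)] .
      have tx: "\<phi> x \<odot>\<^bsub>M\<^esub> t = g1 x \<oplus>\<^bsub>M\<^esub> h1 x" using t by metis
      have "c \<otimes> \<phi> x = \<xi> x \<oplus> \<psi> x"
        unfolding \<xi>_def using c(1) cl\<phi> cl\<psi> by (simp add: R.l_minus R.a_assoc R.l_neg)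
      then have "\<phi> x \<odot>\<^bsub>M\<^esub> (c \<odot>\<^bsub>M\<^esub> z) = \<xi> x \<odot>\<^bsub>M\<^esub> z \<oplus>\<^bsub>M\<^esub> \<psi> x \<odot>\<^bsub>M\<^esub> z"
        using c(1) cl\<phi> cl\<psi> step(2) cl\<xi> by (metis R.m_comm smult_assoc1 smult_l_distr)
      then show ?thesis
        using tx M c(1) cl\<phi> cl\<psi> step(2) tM cl\<xi>
        by (simp add: smult_r_distr M.a_ac)
    qed
    ultimately show ?case
      by (intro bexI[of _ "\<lambda>x. \<xi> x \<odot>\<^bsub>M\<^esub> z \<oplus>\<^bsub>M\<^esub> g1 x"] bexI[of _ "\<lambda>x. \<psi> x \<odot>\<^bsub>M\<^esub> z \<oplus>\<^bsub>M\<^esub> h1 x"]) simp_all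
  qed
  then obtain g1 h1 where g1: "g1 \<in> fun_span M (\<Lambda> \<times> carrier M)"
    and h1: "h1 \<in> fun_span M (L \<times> carrier M)"
    and e: "(\<lambda>x. \<phi> x \<odot>\<^bsub>M\<^esub> y) = (\<lambda>x. g1 x \<oplus>\<^bsub>M\<^esub> h1 x)" by auto
  have M: "\<And>x. g1 x \<in> carrier M" "\<And>x. h1 x \<in> carrier M"
    using fun_span_closed[OF g1 clS(1)] fun_span_closed[OF h1 clS(2)] .
  \<comment> \<open>\<open>h2\<close> gathers everything that uses only the remaining generators.
    The part \<open>g1\<close> is killed by \<rho>, hence so is \<open>h2\<close>, and the induction
    hypothesis applies to it.\<close>
  define h2 where "h2 = (\<lambda>x. h1 x \<oplus>\<^bsub>M\<^esub> h x)"
  have h2M: "\<And>x. h2 x \<in> carrier M" unfolding h2_def using M hM by simp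
  have h2: "h2 \<in> fun_span M (L \<times> carrier M)"
    unfolding h2_def using fun_span_add[OF h1 h clS(2)] .
  have g': "g = (\<lambda>x. g1 x \<oplus>\<^bsub>M\<^esub> h2 x)"
    unfolding g h2_def using M hM fun_cong[OF e] by (auto simp: M.a_assoc)
  have "rel_module M \<rho> g1 \<in> ideal_span M (rel_ring R \<rho> ` \<Lambda>)"
    using rel_module_fun_span[OF g1 cl\<Lambda> \<rho>] .
  moreover have "rel_ring R \<rho> ` \<Lambda> \<subseteq> {\<zero>}" unfolding \<Lambda>_def rel_functions_def by auto
  moreover have "t = \<zero>\<^bsub>M\<^esub>" if "t \<in> ideal_span M S" "S \<subseteq> {\<zero>}" for t S
    using that by (induction rule: ideal_span.induct) auto
  ultimately have "rel_module M \<rho> g1 = \<zero>\<^bsub>M\<^esub>" by blast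
  then have "rel_module M \<rho> h2 = \<zero>\<^bsub>M\<^esub>"
    using Cons.prems(3) rel_module_closed[OF \<rho> h2M] unfolding g'
    by (simp add: rel_module_add[OF \<rho> M(1) h2M])
  then have h2': "h2 \<in> fun_span M (\<Lambda> \<times> carrier M)"
    unfolding \<Lambda>_def using Cons.IH[OF _ h2[unfolded L_def]] Cons.prems(1) by simp
  show ?case
    unfolding g' \<Lambda>_def[symmetric] by (rule fun_span_add[OF g1 h2' clS(1)])
qed

text \<open>On U the identity is the sum of the products of the indicator of a with a. This is the
  factorization that the induction over relations starts from.\<close>

lemma fun_span_indicator:
  assumes "finite U" "U \<subseteq> carrier M" "\<And>a. a \<in> U \<Longrightarrow> (\<lambda>x. if x = a then \<one> else \<zero>, a) \<in> \<Gamma>"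
  shows "(\<lambda>x. if x \<in> U then x else \<zero>\<^bsub>M\<^esub>) \<in> fun_span M \<Gamma>"
  using assms
proof (induction U rule: finite_induct)
  case empty
  then show ?case using fun_span.zero[of M] by simp
next
  case (insert a U)
  define \<phi> where "\<phi> = (\<lambda>x. if x = a then \<one> else \<zero>)"
  have "(\<lambda>x. if x \<in> insert a U then x else \<zero>\<^bsub>M\<^esub>) =
        (\<lambda>x. \<phi> x \<odot>\<^bsub>M\<^esub> a \<oplus>\<^bsub>M\<^esub> (if x \<in> U then x else \<zero>\<^bsub>M\<^esub>))"
  proof
    fix x
    show "(if x \<in> insert a U then x else \<zero>\<^bsub>M\<^esub>) = \<phi> x \<odot>\<^bsub>M\<^esub> a \<oplus>\<^bsub>M\<^esub> (if x \<in> U then x else \<zero>\<^bsub>M\<^esub>)"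
      using insert.hyps(2) insert.prems by (cases "x = a"; cases "x \<in> U") (simp_all add: \<phi>_def subset_iff)
  qed
  moreover have "(\<phi>, a) \<in> \<Gamma>" unfolding \<phi>_def using insert.prems by blast
  ultimately show ?case using insert by (auto intro!: fun_span.step)
qed

text \<open>Start from the identity on a finite set and impose the relations of D one after the
  other. \<Gamma> is left abstract because the same induction serves flat modules and filtered
  vector spaces, which differ only in the single step.\<close>

lemma factorization:
  assumes D: "valid_rels R M D" and U: "finite U" "U \<subseteq> carrier M"
    and base: "\<And>V. finite V \<Longrightarrow> V \<subseteq> carrier M \<Longrightarrow>
      (\<lambda>x. if x \<in> V then x else \<zero>\<^bsub>M\<^esub>) \<in> fun_span M (\<Gamma> [])"
    and step: "\<And>D' \<rho> g. (\<And>\<rho>'. \<rho>' \<in> set D' \<Longrightarrow> set \<rho>' \<subseteq> carrier R \<times> carrier M) \<Longrightarrow>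
      set \<rho> \<subseteq> carrier R \<times> carrier M \<Longrightarrow> g \<in> fun_span M (\<Gamma> D') \<Longrightarrow>
      rel_module M \<rho> g = \<zero>\<^bsub>M\<^esub> \<Longrightarrow> g \<in> fun_span M (\<Gamma> (\<rho> # D'))"
  shows "\<exists>g\<in>fun_span M (\<Gamma> D). \<forall>x\<in>U. g x = x"
proof -
  \<comment> \<open>V also contains the elements that occur in D, so that g acts as the identity
    inside every relation and therefore satisfies it.\<close>
  define V where "V = U \<union> (\<Union>\<rho>\<in>set D. snd ` set \<rho>)"
  have V: "finite V" "V \<subseteq> carrier M"
    using D U unfolding V_def valid_rels_def by fastforce+
  define g where "g = (\<lambda>x. if x \<in> V then x else \<zero>\<^bsub>M\<^esub>)"
  have "g \<in> fun_span M (\<Gamma> D')" if "set D' \<subseteq> set D" for D'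
    using that
  proof (induction D')
    case Nil
    then show ?case unfolding g_def using base[OF V] by simp
  next
    case (Cons \<rho> D')
    then have \<rho>: "\<rho> \<in> set D" "set \<rho> \<subseteq> carrier R \<times> carrier M" using D by (auto simp: valid_rels_def)
    have D': "set \<rho>' \<subseteq> carrier R \<times> carrier M" if "\<rho>' \<in> set D'" for \<rho>'
      using Cons.prems D that by (auto simp: valid_rels_def)
    have "x \<in> V" if "(c, x) \<in> set \<rho>" for c x
      using \<rho>(1) that unfolding V_def by (metis UN_I UnI2 image_eqI snd_conv)
    then have "rel_module M \<rho> g = rel_module M \<rho> id"
      by (intro rel_module_cong) (auto simp: g_def)
    also have "\<dots> = \<zero>\<^bsub>M\<^esub>" using \<rho>(1) D by (auto simp: valid_rels_def)
    finally show ?case using step[OF D' \<rho>(2)] Cons by simp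
  qed
  from this[of D] show ?thesis by (intro bexI[of _ g]) (auto simp: g_def V_def)
qed

text \<open>A form of Lazard's theorem.\<close>

lemma flat_factorization:
  assumes "colon_flat R M" "valid_rels R M D" "finite U" "U \<subseteq> carrier M"
  shows "\<exists>g\<in>fun_span M (rel_functions R D \<times> carrier M). \<forall>x\<in>U. g x = x"
proof (rule factorization[where \<Gamma> = "\<lambda>D. rel_functions R D \<times> carrier M", OF assms(2-4)])
  show "(\<lambda>x. if x \<in> V then x else \<zero>\<^bsub>M\<^esub>) \<in> fun_span M (rel_functions R [] \<times> carrier M)"
    if "finite V" "V \<subseteq> carrier M" for V
    using that by (intro fun_span_indicator) (auto simp: rel_functions_def)
next
  fix D' \<rho> g
  assume D': "\<And>\<rho>'. \<rho>' \<in> set D' \<Longrightarrow> set \<rho>' \<subseteq> carrier R \<times> carrier M" and \<rho>: "set \<rho> \<subseteq> carrier R \<times> carrier M"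
    and g: "g \<in> fun_span M (rel_functions R D' \<times> carrier M)" "rel_module M \<rho> g = \<zero>\<^bsub>M\<^esub>"
  obtain \<phi>s where \<phi>s: "set \<phi>s \<subseteq> rel_functions R D'" "g \<in> fun_span M (lin_comb R \<phi>s \<times> carrier M)"
    using fun_span_finite_support[OF g(1) rel_functions_subset] by blast
  show "g \<in> fun_span M (rel_functions R (\<rho> # D') \<times> carrier M)"
    using fun_span_kernel[OF assms(1) _ \<rho> \<phi>s g(2)] D' by auto
qed

end

section \<open>The tensor product and flatness\<close>

lemma (in abelian_group) add_minus_both:
  "x \<in> carrier G \<Longrightarrow> y \<in> carrier G \<Longrightarrow> (x \<oplus> y) \<oplus> (\<ominus> x) \<oplus> (\<ominus> y) = \<zero>"
  using r_neg[of "x \<oplus> y"] by (simp add: minus_add a_assoc)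

lemmas frag_induct = free_Abelian_group_induct[consumes 1, case_names zero diff of]

text \<open>\<open>\<phi> \<otimes> id\<close>, on the level of the free abelian group and for an arbitrary function \<open>\<phi>\<close>.\<close>

definition frag_slice ::
  "('r, 'm, 'y) module_scheme \<Rightarrow> ('r, 'n, 'z) module_scheme \<Rightarrow> ('m \<Rightarrow> 'r) \<Rightarrow> ('m \<times> 'n \<Rightarrow>\<^sub>0 int) \<Rightarrow> 'n" where
  "frag_slice M N \<phi> = (SOME h. h \<in> hom (free_Abelian_group (carrier M \<times> carrier N)) (add_monoid N) \<and>
     (\<forall>x\<in>carrier M. \<forall>y\<in>carrier N. h (frag_of (x, y)) = \<phi> x \<odot>\<^bsub>N\<^esub> y))"

section \<open>Relations of the tensor product and their slices\<close>

context
  fixes R :: "('r, 'x) ring_scheme" and M :: "('r, 'm, 'y) module_scheme" and N :: "('r, 'n, 'z) module_scheme"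
  assumes M: "module R M" and N: "module R N"
begin

interpretation M: module R M by (rule M)
interpretation N: module R N by (rule N)

abbreviation (input) "F \<equiv> free_Abelian_group (carrier M \<times> carrier N)"

lemma tensor_rels_subset: "tensor_rels R M N \<subseteq> carrier F"
proof
  fix z assume "z \<in> tensor_rels R M N"
  moreover have d: "a - b \<in> carrier F" if "a \<in> carrier F" "b \<in> carrier F" for a b
    using that keys_diff[of a b] by auto
  ultimately show "z \<in> carrier F" unfolding tensor_rels_def
    by (elim UnE CollectE exE conjE) (simp only:, intro d; simp)+
qed

lemma subgroup_tensor_subgroup: "subgroup (tensor_subgroup R M N) F"
  unfolding tensor_subgroup_def
  by (rule group.generate_is_subgroup[OF group_free_Abelian_group tensor_rels_subset])

lemma tensor_subgroup_keys: "z \<in> tensor_subgroup R M N \<Longrightarrow> Poly_Mapping.keys z \<subseteq> carrier M \<times> carrier N"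
  using subsetD[OF subgroup.subset[OF subgroup_tensor_subgroup], of z] by simp

lemma tensor_subgroup_zero: "0 \<in> tensor_subgroup R M N"
  using subgroup.one_closed[OF subgroup_tensor_subgroup] by simp

lemma tensor_subgroup_add:
  "x \<in> tensor_subgroup R M N \<Longrightarrow> y \<in> tensor_subgroup R M N \<Longrightarrow> x + y \<in> tensor_subgroup R M N"
  using subgroup.m_closed[OF subgroup_tensor_subgroup] by simp

lemma tensor_subgroup_uminus:
  "x \<in> tensor_subgroup R M N \<Longrightarrow> - x \<in> tensor_subgroup R M N"
  using subgroup.m_inv_closed[OF subgroup_tensor_subgroup, of x] tensor_subgroup_keys by simp

lemma tensor_subgroup_diff:
  "x \<in> tensor_subgroup R M N \<Longrightarrow> y \<in> tensor_subgroup R M N \<Longrightarrow> x - y \<in> tensor_subgroup R M N"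
  using tensor_subgroup_add[of x "- y"] tensor_subgroup_uminus[of y] by simp

lemma tensor_rels_in_subgroup: "z \<in> tensor_rels R M N \<Longrightarrow> z \<in> tensor_subgroup R M N"
  unfolding tensor_subgroup_def by (rule generate.incl)

lemma tensor_rel_add_left:
  "x \<in> carrier M \<Longrightarrow> x' \<in> carrier M \<Longrightarrow> y \<in> carrier N \<Longrightarrow>
   frag_of (x \<oplus>\<^bsub>M\<^esub> x', y) - frag_of (x, y) - frag_of (x', y) \<in> tensor_subgroup R M N"
  by (rule tensor_rels_in_subgroup) (auto simp: tensor_rels_def)

lemma tensor_rel_add_right:
  "x \<in> carrier M \<Longrightarrow> y \<in> carrier N \<Longrightarrow> y' \<in> carrier N \<Longrightarrow>
   frag_of (x, y \<oplus>\<^bsub>N\<^esub> y') - frag_of (x, y) - frag_of (x, y') \<in> tensor_subgroup R M N"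
  by (rule tensor_rels_in_subgroup) (auto simp: tensor_rels_def)

lemma tensor_rel_smult:
  "a \<in> carrier R \<Longrightarrow> x \<in> carrier M \<Longrightarrow> y \<in> carrier N \<Longrightarrow>
   frag_of (a \<odot>\<^bsub>M\<^esub> x, y) - frag_of (x, a \<odot>\<^bsub>N\<^esub> y) \<in> tensor_subgroup R M N"
  by (rule tensor_rels_in_subgroup) (auto simp: tensor_rels_def)

lemma tensor_zero_left: "y \<in> carrier N \<Longrightarrow> frag_of (\<zero>\<^bsub>M\<^esub>, y) \<in> tensor_subgroup R M N"
  using tensor_subgroup_uminus[OF tensor_rel_add_left[of "\<zero>\<^bsub>M\<^esub>" "\<zero>\<^bsub>M\<^esub>" y]] by simp

lemma tensor_zero_right: "x \<in> carrier M \<Longrightarrow> frag_of (x, \<zero>\<^bsub>N\<^esub>) \<in> tensor_subgroup R M N"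
  using tensor_subgroup_uminus[OF tensor_rel_add_right[of x "\<zero>\<^bsub>N\<^esub>" "\<zero>\<^bsub>N\<^esub>"]] by simp

text \<open>\<open>frag_extend e\<close> is additive, so its values on the defining relations
  decide. S is only required to contain 0 and be closed under differences, so that it may be another
  tensor subgroup or an ideal.\<close>

lemma tensor_subgroup_image:
  assumes "z \<in> tensor_subgroup R M N" "\<And>z. z \<in> tensor_rels R M N \<Longrightarrow> frag_extend e z \<in> S"
    and "0 \<in> S" "\<And>u v. u \<in> S \<Longrightarrow> v \<in> S \<Longrightarrow> u - v \<in> S"
  shows "frag_extend e z \<in> S"
  using assms(1) unfolding tensor_subgroup_def
proof (induction rule: generate.induct)
  case (inv z)
  then have "Poly_Mapping.keys z \<subseteq> carrier M \<times> carrier N"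
    using subsetD[OF tensor_rels_subset, of z] by simp
  then show ?case using assms(4)[OF assms(3) assms(2)[OF inv]] by (simp add: frag_extend_minus)
next
  case (eng z w)
  then show ?case using assms(4)[OF eng(3) assms(4)[OF assms(3) eng(4)]] by (simp add: frag_extend_add)
qed (simp_all add: assms)

context
  fixes \<phi> :: "'m \<Rightarrow> 'r"
  assumes \<phi>: "\<phi> \<in> UNIV \<rightarrow> carrier R"
begin

lemma frag_slice_hom: "frag_slice M N \<phi> \<in> hom F (add_monoid N)"
  and frag_slice_of: "x \<in> carrier M \<Longrightarrow> y \<in> carrier N \<Longrightarrow> frag_slice M N \<phi> (frag_of (x, y)) = \<phi> x \<odot>\<^bsub>N\<^esub> y"
proof -
  have "(\<lambda>(x, y). \<phi> x \<odot>\<^bsub>N\<^esub> y) ` (carrier M \<times> carrier N) \<subseteq> carrier (add_monoid N)"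
    using \<phi> by auto
  then obtain h where "h \<in> hom F (add_monoid N)"
    "\<And>p. p \<in> carrier M \<times> carrier N \<Longrightarrow> h (frag_of p) = (\<lambda>(x, y). \<phi> x \<odot>\<^bsub>N\<^esub> y) p"
    using comm_group.free_Abelian_group_universal[OF N.M.a_comm_group] by metis
  then have "\<exists>h. h \<in> hom F (add_monoid N) \<and> (\<forall>x\<in>carrier M. \<forall>y\<in>carrier N. h (frag_of (x, y)) = \<phi> x \<odot>\<^bsub>N\<^esub> y)"
    by (intro exI[of _ h]) simp
  from someI_ex[OF this] show "frag_slice M N \<phi> \<in> hom F (add_monoid N)"
    "x \<in> carrier M \<Longrightarrow> y \<in> carrier N \<Longrightarrow> frag_slice M N \<phi> (frag_of (x, y)) = \<phi> x \<odot>\<^bsub>N\<^esub> y"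
    unfolding frag_slice_def by blast+
qed

interpretation h: group_hom F "add_monoid N" "frag_slice M N \<phi>"
  using frag_slice_hom by (intro group_hom.intro group_hom_axioms.intro N.M.a_group) auto

lemma frag_slice_zero: "frag_slice M N \<phi> 0 = \<zero>\<^bsub>N\<^esub>"
  using h.hom_one by simp

lemma frag_slice_closed:
  "Poly_Mapping.keys z \<subseteq> carrier M \<times> carrier N \<Longrightarrow> frag_slice M N \<phi> z \<in> carrier N"
  using h.hom_closed[of z] by simp

lemma frag_slice_add:
  assumes "Poly_Mapping.keys z \<subseteq> carrier M \<times> carrier N" "Poly_Mapping.keys w \<subseteq> carrier M \<times> carrier N"
  shows "frag_slice M N \<phi> (z + w) = frag_slice M N \<phi> z \<oplus>\<^bsub>N\<^esub> frag_slice M N \<phi> w"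
    and "frag_slice M N \<phi> (- z) = \<ominus>\<^bsub>N\<^esub> frag_slice M N \<phi> z"
    and "frag_slice M N \<phi> (z - w) = frag_slice M N \<phi> z \<ominus>\<^bsub>N\<^esub> frag_slice M N \<phi> w"
proof -
  have neg: "frag_slice M N \<phi> (- u) = \<ominus>\<^bsub>N\<^esub> frag_slice M N \<phi> u"
    if "Poly_Mapping.keys u \<subseteq> carrier M \<times> carrier N" for u
    using h.hom_inv[of u] that by (simp add: a_inv_def)
  show "frag_slice M N \<phi> (z + w) = frag_slice M N \<phi> z \<oplus>\<^bsub>N\<^esub> frag_slice M N \<phi> w"
    using h.hom_mult[of z w] assms by simp
  show "frag_slice M N \<phi> (- z) = \<ominus>\<^bsub>N\<^esub> frag_slice M N \<phi> z" using neg assms by simp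
  show "frag_slice M N \<phi> (z - w) = frag_slice M N \<phi> z \<ominus>\<^bsub>N\<^esub> frag_slice M N \<phi> w"
    using h.hom_mult[of z "- w"] neg[of w] assms by (simp add: a_minus_def)
qed

end

text \<open>An element vanishes in \<open>M \<otimes> N\<close> because of finitely many relations between elements
  of \<open>M\<close>; hence it is killed by all \<open>\<phi> \<otimes> id\<close> for functions \<open>\<phi>\<close> that satisfy these relations,
  although \<open>\<phi>\<close> need not be linear on all of \<open>M\<close>.\<close>

lemma tensor_zero_criterion:
  assumes "z \<in> tensor_subgroup R M N"
  shows "\<exists>D. valid_rels R M D \<and> (\<forall>\<phi>\<in>rel_functions R D. frag_slice M N \<phi> z = \<zero>\<^bsub>N\<^esub>)"
  using assms unfolding tensor_subgroup_def
proof (induction rule: generate.induct)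
  case one
  then show ?case using frag_slice_zero M.rel_functions_subset[of "[]"]
    by (intro exI[of _ "[]"]) (auto simp: valid_rels_def)
next
  have rel: "\<exists>D. valid_rels R M D \<and> (\<forall>\<phi>\<in>rel_functions R D. frag_slice M N \<phi> z = \<zero>\<^bsub>N\<^esub>)"
    if z: "z \<in> tensor_rels R M N" for z
  proof -
    have k: "Poly_Mapping.keys (frag_of p - frag_of q) \<subseteq> carrier M \<times> carrier N"
      if "p \<in> carrier M \<times> carrier N" "q \<in> carrier M \<times> carrier N" for p q
      using that by (intro order_trans[OF keys_diff]) simp
    have D: "\<exists>D. valid_rels R M D \<and> (\<forall>\<phi>\<in>rel_functions R D. frag_slice M N \<phi> z = \<zero>\<^bsub>N\<^esub>)"
      if "valid_rels R M D" "\<And>\<phi>. \<phi> \<in> rel_functions R D \<Longrightarrow> \<phi> \<in> UNIV \<rightarrow> carrier R \<Longrightarrow>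
        (\<And>x. \<phi> x \<in> carrier R) \<Longrightarrow> frag_slice M N \<phi> z = \<zero>\<^bsub>N\<^esub>" for D
      using that M.rel_functions_subset[of D] by blast
    from z consider
      (l) x x' y where "z = frag_of (x \<oplus>\<^bsub>M\<^esub> x', y) - frag_of (x, y) - frag_of (x', y)"
        "x \<in> carrier M" "x' \<in> carrier M" "y \<in> carrier N"
    | (r) x y y' where "z = frag_of (x, y \<oplus>\<^bsub>N\<^esub> y') - frag_of (x, y) - frag_of (x, y')"
        "x \<in> carrier M" "y \<in> carrier N" "y' \<in> carrier N"
    | (s) a x y where "z = frag_of (a \<odot>\<^bsub>M\<^esub> x, y) - frag_of (x, a \<odot>\<^bsub>N\<^esub> y)"
        "a \<in> carrier R" "x \<in> carrier M" "y \<in> carrier N"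
      unfolding tensor_rels_def by blast
    then show ?thesis
    proof cases
      case l
      \<comment> \<open>This is the valid relation (x + x') - x - x' = 0. A function satisfying it
        is additive at this one pair, which is what the generator at hand requires.\<close>
      let ?\<rho> = "[(\<one>\<^bsub>R\<^esub>, x \<oplus>\<^bsub>M\<^esub> x'), (\<ominus>\<^bsub>R\<^esub> \<one>\<^bsub>R\<^esub>, x), (\<ominus>\<^bsub>R\<^esub> \<one>\<^bsub>R\<^esub>, x')]"
      show ?thesis
      proof (rule D[of "[?\<rho>]"])
        show "valid_rels R M [?\<rho>]" using l
          by (simp add: valid_rels_def M.smult_l_minus M.M.minus_add[symmetric] M.M.r_neg)
        fix \<phi> assume \<phi>: "\<phi> \<in> rel_functions R [?\<rho>]" "\<phi> \<in> UNIV \<rightarrow> carrier R" and c: "\<And>x. \<phi> x \<in> carrier R"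
        have "\<phi> (x \<oplus>\<^bsub>M\<^esub> x') \<ominus>\<^bsub>R\<^esub> (\<phi> x \<oplus>\<^bsub>R\<^esub> \<phi> x') = \<zero>\<^bsub>R\<^esub>"
          using \<phi>(1) l c by (simp add: rel_functions_def M.R.l_minus M.R.minus_add a_minus_def)
        then have "\<phi> (x \<oplus>\<^bsub>M\<^esub> x') = \<phi> x \<oplus>\<^bsub>R\<^esub> \<phi> x'" using c by simp
        then show "frag_slice M N \<phi> z = \<zero>\<^bsub>N\<^esub>" using l c
          by (simp add: frag_slice_add(3)[OF \<phi>(2)] frag_slice_of[OF \<phi>(2)] k N.smult_l_distr a_minus_def N.M.add_minus_both)
      qed
    next
      case r
      \<comment> \<open>Additivity in the second argument is that of scalar multiplication in N, so
        the empty list of relations serves.\<close>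
      show ?thesis
        by (rule D[of "[]"], simp add: valid_rels_def)
          (use r in \<open>simp add: frag_slice_add(3) frag_slice_of k N.smult_r_distr a_minus_def N.M.add_minus_both\<close>)
    next
      case s
      \<comment> \<open>The relation (a x) - a x = 0 makes \<phi> homogeneous at this one pair a,
        x.\<close>
      let ?\<rho> = "[(\<one>\<^bsub>R\<^esub>, a \<odot>\<^bsub>M\<^esub> x), (\<ominus>\<^bsub>R\<^esub> a, x)]"
      show ?thesis
      proof (rule D[of "[?\<rho>]"])
        show "valid_rels R M [?\<rho>]" using s by (simp add: valid_rels_def M.smult_l_minus M.M.r_neg)
        fix \<phi> assume \<phi>: "\<phi> \<in> rel_functions R [?\<rho>]" "\<phi> \<in> UNIV \<rightarrow> carrier R" and c: "\<And>x. \<phi> x \<in> carrier R"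
        have "\<phi> (a \<odot>\<^bsub>M\<^esub> x) \<ominus>\<^bsub>R\<^esub> (a \<otimes>\<^bsub>R\<^esub> \<phi> x) = \<zero>\<^bsub>R\<^esub>"
          using \<phi>(1) s c by (simp add: rel_functions_def M.R.l_minus a_minus_def)
        then have "\<phi> (a \<odot>\<^bsub>M\<^esub> x) = \<phi> x \<otimes>\<^bsub>R\<^esub> a" using c s by (simp add: M.R.m_comm)
        then show "frag_slice M N \<phi> z = \<zero>\<^bsub>N\<^esub>" using s c
          by (simp add: frag_slice_add(3)[OF \<phi>(2)] frag_slice_of[OF \<phi>(2)] N.smult_assoc1 a_minus_def N.M.r_neg)
      qed
    qed
  qed
  {
    case (incl z)
    then show ?case by (rule rel)
  next
    case (inv z)
    have k: "Poly_Mapping.keys z \<subseteq> carrier M \<times> carrier N"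
      using subsetD[OF tensor_rels_subset inv] by simp
    from rel[OF inv] obtain D where "valid_rels R M D" "\<forall>\<phi>\<in>rel_functions R D. frag_slice M N \<phi> z = \<zero>\<^bsub>N\<^esub>"
      by blast
    then show ?case
      using k frag_slice_add(2)[OF subsetD[OF M.rel_functions_subset] k k]
      by (intro exI[of _ D]) (simp add: N.M.add.inv_one)
  next
    case (eng z w)
    from eng obtain D D' where D: "valid_rels R M D" "valid_rels R M D'"
      "\<forall>\<phi>\<in>rel_functions R D. frag_slice M N \<phi> z = \<zero>\<^bsub>N\<^esub>" "\<forall>\<phi>\<in>rel_functions R D'. frag_slice M N \<phi> w = \<zero>\<^bsub>N\<^esub>"
      by blast
    have k: "Poly_Mapping.keys z \<subseteq> carrier M \<times> carrier N" "Poly_Mapping.keys w \<subseteq> carrier M \<times> carrier N"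
      using eng(1,2) tensor_subgroup_keys unfolding tensor_subgroup_def by auto
    have "\<phi> \<in> rel_functions R D \<and> \<phi> \<in> rel_functions R D'" if "\<phi> \<in> rel_functions R (D @ D')" for \<phi>
      using that by (auto simp: rel_functions_def)
    moreover have "valid_rels R M (D @ D')" using D by (auto simp: valid_rels_def)
    ultimately show ?case
      using D(3,4) frag_slice_add(1)[OF subsetD[OF M.rel_functions_subset] k]
      by (intro exI[of _ "D @ D'"]) simp
  }
qed

text \<open>For g a sum of terms \<phi> y, applying g to the left entries of z gives the sum of the
  tensors of y with the slice of z at \<phi>, and these slices vanish. As g is not linear, the
  statement is made in the free abelian group.\<close>

lemma fun_span_tensor:
  assumes z: "Poly_Mapping.keys z \<subseteq> carrier M \<times> carrier N"
    and \<Lambda>: "\<Lambda> \<subseteq> UNIV \<rightarrow> carrier R" and kill: "\<And>\<phi>. \<phi> \<in> \<Lambda> \<Longrightarrow> frag_slice M N \<phi> z = \<zero>\<^bsub>N\<^esub>"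
    and g: "g \<in> fun_span M (\<Lambda> \<times> carrier M)"
  shows "frag_extend (\<lambda>(x, y). frag_of (g x, y)) z \<in> tensor_subgroup R M N"
  using g
proof (induction rule: fun_span.induct)
  case zero
  show ?case using z
    by (induction z rule: frag_induct)
      (auto simp: frag_extend_diff tensor_subgroup_zero tensor_subgroup_diff tensor_zero_left)
next
  case (step \<phi> y g)
  have \<phi>: "\<And>x. \<phi> x \<in> carrier R" "\<phi> \<in> \<Lambda>" "\<phi> \<in> UNIV \<rightarrow> carrier R" and y: "y \<in> carrier M"
    using step(1) \<Lambda> by auto
  have gM: "\<And>x. g x \<in> carrier M" using M.fun_span_closed[OF step(2)] \<Lambda> by auto
  define E where "E = (\<lambda>g. frag_extend (\<lambda>(x :: 'm, n :: 'n). frag_of (g x :: 'm, n)))"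
  let ?h = "frag_slice M N \<phi>"
  have 1: "E (\<lambda>x. \<phi> x \<odot>\<^bsub>M\<^esub> y \<oplus>\<^bsub>M\<^esub> g x) z - E (\<lambda>x. \<phi> x \<odot>\<^bsub>M\<^esub> y) z - E g z \<in> tensor_subgroup R M N"
    using z
  proof (induction z rule: frag_induct)
    case (diff u v)
    then show ?case using tensor_subgroup_diff[OF diff(3,4)]
      by (simp add: E_def frag_extend_diff algebra_simps)
  qed (use \<phi> y gM in \<open>auto simp: E_def tensor_subgroup_zero tensor_rel_add_left\<close>)
  \<comment> \<open>The scalars \<phi> x move across the tensor sign, so all terms get the same left
    entry y and their right entries add up to the slice of z.\<close>
  have 2: "E (\<lambda>x. \<phi> x \<odot>\<^bsub>M\<^esub> y) z - frag_of (y, ?h z) \<in> tensor_subgroup R M N"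
    using z
  proof (induction z rule: frag_induct)
    case zero
    then show ?case using tensor_subgroup_uminus[OF tensor_zero_right[OF y]] frag_slice_zero[OF \<phi>(3)]
      by (simp add: E_def)
  next
    case (diff u v)
    have hc: "?h u \<in> carrier N" "?h v \<in> carrier N" using frag_slice_closed[OF \<phi>(3)] diff(1,2) by auto
    have e: "?h (u - v) \<oplus>\<^bsub>N\<^esub> ?h v = ?h u" "?h (u - v) \<in> carrier N"
      using frag_slice_add(3)[OF \<phi>(3) diff(1,2)] hc by (simp_all add: a_minus_def N.M.a_assoc N.M.l_neg)
    then have "frag_of (y, ?h u) - frag_of (y, ?h (u - v)) - frag_of (y, ?h v) \<in> tensor_subgroup R M N"
      using tensor_rel_add_right[OF y _ hc(2), of "?h (u - v)"] by simp
    from tensor_subgroup_add[OF tensor_subgroup_diff[OF diff(3,4)] this]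
    show ?case by (simp add: E_def frag_extend_diff algebra_simps)
  next
    case (of p)
    then show ?case using frag_slice_of[OF \<phi>(3)] \<phi>(1) y tensor_rel_smult by (auto simp: E_def)
  qed
  have "E (\<lambda>x. \<phi> x \<odot>\<^bsub>M\<^esub> y) z \<in> tensor_subgroup R M N"
    using tensor_subgroup_add[OF 2 tensor_zero_right[OF y]] kill[OF \<phi>(2)] by simp
  from tensor_subgroup_add[OF 1 tensor_subgroup_add[OF this step.IH[folded E_def]]]
  show ?case by (simp add: E_def)
qed

end

section \<open>Injectivity of tensored maps from the colon condition\<close>

lemma tensor_subgroup_map:
  assumes M: "module R M" and N: "module R N" and P: "module R P" and f: "f \<in> linear_maps R N P"
    and z: "z \<in> tensor_subgroup R M N"
  shows "frag_extend (\<lambda>(x, y). frag_of (x, f y)) z \<in> tensor_subgroup R M P"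
proof (rule tensor_subgroup_image[OF M N z])
  interpret M: module R M by (rule M)
  interpret N: module R N by (rule N)
  have f': "\<And>y y'. y \<in> carrier N \<Longrightarrow> y' \<in> carrier N \<Longrightarrow> f (y \<oplus>\<^bsub>N\<^esub> y') = f y \<oplus>\<^bsub>P\<^esub> f y'"
    "\<And>a y. a \<in> carrier R \<Longrightarrow> y \<in> carrier N \<Longrightarrow> f (a \<odot>\<^bsub>N\<^esub> y) = a \<odot>\<^bsub>P\<^esub> f y"
    "\<And>y. y \<in> carrier N \<Longrightarrow> f y \<in> carrier P"
    using f by (auto simp: linear_maps_def)
  note P' = tensor_rel_add_left[OF M P] tensor_rel_add_right[OF M P] tensor_rel_smult[OF M P]
  show "frag_extend (\<lambda>(x, y). frag_of (x, f y)) z \<in> tensor_subgroup R M P" if "z \<in> tensor_rels R M N" for z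
    using that unfolding tensor_rels_def
    by (elim UnE CollectE exE conjE) (simp_all add: frag_extend_diff P' f')
qed (use tensor_subgroup_zero[OF M P] tensor_subgroup_diff[OF M P] in auto)

text \<open>If the image of z vanishes, this is due to finitely many relations D in M. Slices at
  functions satisfying D kill the image, hence z, by injectivity of f. Flatness factors the identity
  on the left entries of z through such functions, so z vanishes too.\<close>

theorem colon_flat_imp_flat:
  fixes R :: "('r, 'x) ring_scheme" and M :: "('r, 'm, 'y) module_scheme"
  assumes M: "module R M" and flat: "colon_flat R M"
  shows "flat_module R M TYPE('n) TYPE('p)"
  unfolding flat_module_def
proof (intro conjI allI impI M)
  fix N :: "('r, 'n) module" and P :: "('r, 'p) module" and f
  assume "module R N \<and> module R P \<and> f \<in> linear_maps R N P \<and> inj_on f (carrier N)"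
  then have N: "module R N" and P: "module R P" and f: "f \<in> linear_maps R N P"
    and inj: "inj_on f (carrier N)" by auto
  interpret M: module R M by (rule M)
  interpret N: module R N by (rule N)
  interpret P: module R P by (rule P)
  define FN where "FN = free_Abelian_group (carrier M \<times> carrier N)"
  define FP where "FP = free_Abelian_group (carrier M \<times> carrier P)"
  define E where "E = frag_extend (\<lambda>(x :: 'm, y). frag_of (x, f y))"
  let ?SN = "tensor_subgroup R M N" and ?SP = "tensor_subgroup R M P"
  have f': "\<And>y y'. y \<in> carrier N \<Longrightarrow> y' \<in> carrier N \<Longrightarrow> f (y \<oplus>\<^bsub>N\<^esub> y') = f y \<oplus>\<^bsub>P\<^esub> f y'"
    "\<And>a y. a \<in> carrier R \<Longrightarrow> y \<in> carrier N \<Longrightarrow> f (a \<odot>\<^bsub>N\<^esub> y) = a \<odot>\<^bsub>P\<^esub> f y"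
    using f by (auto simp: linear_maps_def)
  have f0: "f y \<in> carrier P" if "y \<in> carrier N" for y
    using that f by (auto simp: linear_maps_def)
  interpret FN: comm_group FN unfolding FN_def by (rule abelian_free_Abelian_group)
  interpret FP: comm_group FP unfolding FP_def by (rule abelian_free_Abelian_group)
  have SN: "subgroup ?SN FN" and SP: "subgroup ?SP FP"
    unfolding FN_def FP_def using subgroup_tensor_subgroup M N P by auto
  have keysE: "Poly_Mapping.keys (E z) \<subseteq> carrier M \<times> carrier P"
    if "Poly_Mapping.keys z \<subseteq> carrier M \<times> carrier N" for z
    using that unfolding E_def
    by (intro order_trans[OF keys_frag_extend]) (use f0 in \<open>auto split: prod.splits\<close>)
  have inj0: "z \<in> ?SN" if z: "Poly_Mapping.keys z \<subseteq> carrier M \<times> carrier N" and Ez: "E z \<in> ?SP" for z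
  proof -
    obtain D where D: "valid_rels R M D"
      and kill: "\<And>\<phi>. \<phi> \<in> rel_functions R D \<Longrightarrow> frag_slice M P \<phi> (E z) = \<zero>\<^bsub>P\<^esub>"
      using tensor_zero_criterion[OF M P Ez] by blast
    have "finite (fst ` Poly_Mapping.keys z)" "fst ` Poly_Mapping.keys z \<subseteq> carrier M" using z by auto
    from M.flat_factorization[OF flat D this]
    obtain g where g: "g \<in> fun_span M (rel_functions R D \<times> carrier M)"
      "\<forall>x\<in>fst ` Poly_Mapping.keys z. g x = x" by blast
    have "frag_slice M N \<phi> z = \<zero>\<^bsub>N\<^esub>" if \<phi>: "\<phi> \<in> rel_functions R D" for \<phi>
    proof -
      have \<phi>c: "\<phi> \<in> UNIV \<rightarrow> carrier R" using \<phi> M.rel_functions_subset by blast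
      note sN = frag_slice_add(3)[OF M N \<phi>c] frag_slice_closed[OF M N \<phi>c] frag_slice_zero[OF M N \<phi>c]
        frag_slice_of[OF M N \<phi>c]
      note sP = frag_slice_add(3)[OF M P \<phi>c] frag_slice_zero[OF M P \<phi>c] frag_slice_of[OF M P \<phi>c]
      have fz: "f \<zero>\<^bsub>N\<^esub> = \<zero>\<^bsub>P\<^esub>"
        using f'(1)[of "\<zero>\<^bsub>N\<^esub>" "\<zero>\<^bsub>N\<^esub>"] f0[of "\<zero>\<^bsub>N\<^esub>"] by simp
      \<comment> \<open>Slices act on the left entries and f on the right ones, so the two commute;
        this carries vanishing from the image of z back to z.\<close>
      have "frag_slice M P \<phi> (E u) = f (frag_slice M N \<phi> u)"
        if "Poly_Mapping.keys u \<subseteq> carrier M \<times> carrier N" for u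
        using that
      proof (induction u rule: frag_induct)
        case zero
        then show ?case using fz sN(3) sP(2) by (simp add: E_def)
      next
        case (diff u v)
        let ?h = "frag_slice M N \<phi>"
        have hc: "?h u \<in> carrier N" "?h v \<in> carrier N" "?h (u - v) \<in> carrier N"
          using sN(1,2) diff(1,2) by auto
        have e: "?h (u - v) \<oplus>\<^bsub>N\<^esub> ?h v = ?h u"
          using sN(1)[OF diff(1,2)] hc by (simp add: a_minus_def N.M.a_assoc N.M.l_neg)
        have "f (?h (u - v)) \<oplus>\<^bsub>P\<^esub> f (?h v) = f (?h u)" using f'(1)[OF hc(3,2)] e by simp
        then have "f (?h (u - v)) = f (?h u) \<oplus>\<^bsub>P\<^esub> (\<ominus>\<^bsub>P\<^esub> f (?h v))"
          using f0 hc by (metis P.M.a_assoc P.M.a_inv_closed P.M.r_neg P.M.r_zero)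
        then show ?case using diff(3,4) sP(1)[OF keysE[OF diff(1)] keysE[OF diff(2)]]
          by (simp add: E_def frag_extend_diff a_minus_def)
      next
        case (of p)
        have "\<phi> x \<in> carrier R" for x using \<phi>c by auto
        then show ?case using of sN(4) sP(3) f0 f'(2) by (auto simp: E_def)
      qed
      then have "f (frag_slice M N \<phi> z) = f \<zero>\<^bsub>N\<^esub>" using z kill[OF \<phi>] fz by simp
      then show ?thesis using inj sN(2)[OF z] by (meson N.M.zero_closed inj_onD)
    qed
    then have "frag_extend (\<lambda>(x, y). frag_of (g x, y)) z \<in> ?SN"
      using fun_span_tensor[OF M N z M.rel_functions_subset _ g(1)] by blast
    \<comment> \<open>As g fixes the left entries of z, the element shown to vanish is z
      itself.\<close>
    moreover have "frag_extend (\<lambda>(x, y). frag_of (g x, y)) z = frag_extend frag_of z"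
      using g(2) by (intro frag_extend_eq) force
    ultimately show ?thesis by (simp add: frag_expansion[symmetric])
  qed
  have map: "tensor_map R M P f (?SN #>\<^bsub>FN\<^esub> z) = ?SP #>\<^bsub>FP\<^esub> E z" if z: "z \<in> carrier FN" for z
  proof -
    \<comment> \<open>All representatives of a coset have the same image, so the image set is a
      singleton and \<open>the_elem\<close> returns its member.\<close>
    have "?SP #>\<^bsub>FP\<^esub> E w = ?SP #>\<^bsub>FP\<^esub> E z" if w: "w \<in> ?SN #>\<^bsub>FN\<^esub> z" for w
    proof -
      obtain s where s: "s \<in> ?SN" "w = s + z" using w by (auto simp: r_coset_def FN_def)
      have "E w = E s \<otimes>\<^bsub>FP\<^esub> E z" using s by (simp add: E_def frag_extend_add FP_def)
      moreover have Es: "E s \<in> ?SP" unfolding E_def using tensor_subgroup_map[OF M N P f s(1)] .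
      moreover have "E z \<in> carrier FP" using keysE z by (simp add: FN_def FP_def)
      ultimately have "?SP #>\<^bsub>FP\<^esub> E w = (?SP #>\<^bsub>FP\<^esub> E s) #>\<^bsub>FP\<^esub> E z"
        using FP.coset_mult_assoc[OF subgroup.subset[OF SP] subgroup.mem_carrier[OF SP Es]] by simp
      then show ?thesis using subgroup.rcos_const[OF SP FP.is_group Es] by simp
    qed
    moreover have "z \<in> ?SN #>\<^bsub>FN\<^esub> z" using FN.rcos_self[OF z SN] .
    ultimately have "(\<lambda>w. ?SP #>\<^bsub>FP\<^esub> E w) ` (?SN #>\<^bsub>FN\<^esub> z) = {?SP #>\<^bsub>FP\<^esub> E z}" by blast
    then show ?thesis unfolding tensor_map_def FP_def[symmetric] E_def[symmetric] by simp
  qed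
  show "inj_on (tensor_map R M P f) (carrier (tensor_group R M N))"
  proof (rule inj_onI)
    fix Z W assume Z: "Z \<in> carrier (tensor_group R M N)" and W: "W \<in> carrier (tensor_group R M N)"
      and eq: "tensor_map R M P f Z = tensor_map R M P f W"
    obtain z w where z: "z \<in> carrier FN" "Z = ?SN #>\<^bsub>FN\<^esub> z" and w: "w \<in> carrier FN" "W = ?SN #>\<^bsub>FN\<^esub> w"
      using Z W by (auto simp: tensor_group_def FactGroup_def RCOSETS_def FN_def)
    have "?SP #>\<^bsub>FP\<^esub> E z = ?SP #>\<^bsub>FP\<^esub> E w" using eq map z w by simp
    moreover have "E z \<in> carrier FP" "E w \<in> carrier FP" using keysE z w by (auto simp: FN_def FP_def)
    ultimately have "E z \<in> ?SP #>\<^bsub>FP\<^esub> E w" using FP.rcos_self[OF _ SP] by metis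
    then obtain s where "s \<in> ?SP" "E z = s + E w" by (auto simp: r_coset_def FP_def)
    then have "E (z - w) \<in> ?SP" by (simp add: E_def frag_extend_diff)
    moreover have "Poly_Mapping.keys (z - w) \<subseteq> carrier M \<times> carrier N"
      using z w keys_diff[of z w] by (auto simp: FN_def)
    ultimately have "z - w \<in> ?SN" using inj0 by blast
    then have "z \<in> ?SN #>\<^bsub>FN\<^esub> w" by (auto simp: r_coset_def FN_def intro!: bexI[of _ "z - w"])
    then show "Z = W" using FN.repr_independence[OF _ w(1) SN] z w by simp
  qed
qed

section \<open>A weak Artin-Rees lemma\<close>

context cring
begin

text \<open>In particular the zeroth power of an ideal is the whole ring, the convention behind the
  truncated exponents p - d used later.\<close>

lemma ideals_set_simps [simp]:
  "\<one>\<^bsub>ideals_set R\<^esub> = carrier R" "I \<otimes>\<^bsub>ideals_set R\<^esub> J = I \<cdot> J"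
  by (simp_all add: ideals_set_def)

lemma ideal_power_Suc: "ideal_power R I (Suc n) = ideal_power R I n \<cdot> I"
  by simp

lemma ideal_ideal_power: "ideal I R \<Longrightarrow> ideal (ideal_power R I n) R"
  by (induction n) (simp_all add: oneideal ideal_prod_is_ideal)

lemma ideal_power_add:
  "ideal I R \<Longrightarrow> ideal_power R I (m + n) = ideal_power R I m \<cdot> ideal_power R I n"
proof (induction n)
  case 0
  then show ?case by (simp add: ideal_prod_one ideal_ideal_power)
next
  case (Suc n)
  then show ?case by (simp add: ideal_power_Suc ideal_prod_assoc ideal_ideal_power)
qed

lemma ideal_power_mult:
  "ideal I R \<Longrightarrow> a \<in> ideal_power R I m \<Longrightarrow> b \<in> ideal_power R I n \<Longrightarrow>
   a \<otimes> b \<in> ideal_power R I (m + n)"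
  by (simp add: ideal_power_add ideal_prod.prod)

lemma ideal_power_antimono:
  assumes "ideal I R" "m \<le> n"
  shows "ideal_power R I n \<subseteq> ideal_power R I m"
proof -
  obtain k where "n = m + k" using assms(2) le_Suc_ex by blast
  then show ?thesis using ideal_prod_inter[OF ideal_ideal_power ideal_ideal_power] assms(1)
    by (simp add: ideal_power_add)
qed

lemma ideal_power_one: "ideal I R \<Longrightarrow> ideal_power R I (Suc 0) \<subseteq> I"
  using ideal_prod_inter[OF oneideal] by (simp add: ideal_power_Suc)

lemma ideal_prod_mono: "I \<subseteq> I' \<Longrightarrow> J \<subseteq> J' \<Longrightarrow> I \<cdot> J \<subseteq> I' \<cdot> J'"
proof
  fix x assume "I \<subseteq> I'" "J \<subseteq> J'" "x \<in> I \<cdot> J"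
  from this(3,1,2) show "x \<in> I' \<cdot> J'"
    by (induction rule: ideal_prod.induct) (auto intro: ideal_prod.intros)
qed

lemma ideal_prod_subset:
  assumes "ideal K R" "\<And>i j. i \<in> I \<Longrightarrow> j \<in> J \<Longrightarrow> i \<otimes> j \<in> K"
  shows "I \<cdot> J \<subseteq> K"
proof
  fix x assume "x \<in> I \<cdot> J"
  then show "x \<in> K"
    by (induction rule: ideal_prod.induct)
      (auto simp: assms additive_subgroup.a_closed[OF ideal.axioms(1)[OF assms(1)]])
qed

lemma pow_in_ideal_power:
  "ideal I R \<Longrightarrow> x \<in> I \<Longrightarrow> x [^] (n :: nat) \<in> ideal_power R I n"
  by (induction n) (auto simp: ideal_power_Suc intro: ideal_prod.prod)

lemma set_add_ideal_iff: "x \<in> I <+>\<^bsub>R\<^esub> J \<longleftrightarrow> (\<exists>i\<in>I. \<exists>j\<in>J. x = i \<oplus> j)"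
  by (auto simp: set_add_def')

lemma set_add_subset_left:
  assumes "ideal I R" "ideal J R"
  shows "I \<subseteq> I <+>\<^bsub>R\<^esub> J"
proof
  fix x assume x: "x \<in> I"
  interpret I: ideal I R by fact
  interpret J: ideal J R by fact
  show "x \<in> I <+>\<^bsub>R\<^esub> J" unfolding set_add_ideal_iff
    using x J.zero_closed by (intro bexI[of _ x] bexI[of _ \<zero>]) auto
qed

lemma set_add_subset_right:
  assumes "ideal I R" "ideal J R"
  shows "J \<subseteq> I <+>\<^bsub>R\<^esub> J"
proof
  fix x assume x: "x \<in> J"
  interpret I: ideal I R by fact
  interpret J: ideal J R by fact
  show "x \<in> I <+>\<^bsub>R\<^esub> J" unfolding set_add_ideal_iff
    using x I.zero_closed by (intro bexI[of _ x] bexI[of _ \<zero>]) auto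
qed

lemma ideal_colon_ideal:
  assumes "ideal I R" "a \<in> carrier R"
  shows "ideal (colon_ideal R I a) R"
proof -
  interpret I: ideal I R by fact
  show ?thesis
  proof (rule idealI)
    show "subgroup (colon_ideal R I a) (add_monoid R)"
      using assms(2)
      by (intro add.subgroupI) (auto simp: colon_ideal_def l_distr l_minus intro: exI[of _ \<zero>])
    show "x \<otimes> c \<in> colon_ideal R I a" if "c \<in> colon_ideal R I a" "x \<in> carrier R" for c x
      using that assms(2) I.I_l_closed[of "c \<otimes> a" x] by (simp add: colon_ideal_def m_assoc)
    then show "c \<otimes> x \<in> colon_ideal R I a" if "c \<in> colon_ideal R I a" "x \<in> carrier R" for c x
      using that by (metis (no_types, lifting) colon_ideal_def m_comm mem_Collect_eq)
  qed (rule ring_axioms)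
qed

text \<open>An ideal with finitely many generators is nilpotent modulo L if each generator is. Two
  nested inductions avoid a multinomial expansion: one over the generators, one over the exponent s
  of the new generator x, with L replaced by the larger ideal (L : x).\<close>

lemma genideal_power_subset:
  assumes "finite S" "S \<subseteq> carrier R" "ideal L R" "\<And>x. x \<in> S \<Longrightarrow> \<exists>s::nat. x [^] s \<in> L"
  shows "\<exists>p. ideal_power R (Idl S) p \<subseteq> L"
  using assms
proof (induction S arbitrary: L rule: finite_induct)
  case empty
  have "ideal_power R (Idl {}) (Suc 0) \<subseteq> Idl {}" by (intro ideal_power_one genideal_ideal) auto
  also have "\<dots> \<subseteq> L" using genideal_minimal[OF empty(2)] by simp
  finally show ?case by blast
next
  case (insert x S)
  define M where "M = Idl (insert x S)"
  define M' where "M' = Idl S"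
  have x: "x \<in> carrier R" and S: "S \<subseteq> carrier R" using insert.prems(1) by auto
  have M: "ideal M R" and M': "ideal M' R" and px: "ideal (PIdl x) R"
    unfolding M_def M'_def using insert.prems(1) by (auto intro: genideal_ideal cgenideal_ideal)
  have "M \<subseteq> M' <+>\<^bsub>R\<^esub> PIdl x" unfolding M_def
  proof (rule genideal_minimal[OF add_ideals[OF M' px]])
    show "insert x S \<subseteq> M' <+>\<^bsub>R\<^esub> PIdl x"
      using set_add_subset_left[OF M' px] set_add_subset_right[OF M' px] cgenideal_self[OF x]
        genideal_self[OF S] unfolding M'_def by blast
  qed
  \<comment> \<open>Modulo x, the powers of the large ideal are those of the ideal without
    x.\<close>
  have pw: "ideal_power R M j \<subseteq> ideal_power R M' j <+>\<^bsub>R\<^esub> PIdl x" for j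
  proof (induction j)
    case 0
    then show ?case using set_add_subset_left[OF oneideal px] by simp
  next
    case (Suc j)
    have Mj: "ideal (ideal_power R M' j) R" "ideal (ideal_power R M' (Suc j)) R"
      using ideal_ideal_power[OF M', of j] ideal_ideal_power[OF M', of "Suc j"] by auto
    show ?case unfolding ideal_power_Suc[of M]
    proof (rule ideal_prod_subset[OF add_ideals[OF Mj(2) px]])
      fix u v assume "u \<in> ideal_power R M j" "v \<in> M"
      then obtain u1 u2 v1 v2 where
        u: "u1 \<in> ideal_power R M' j" "u2 \<in> PIdl x" "u = u1 \<oplus> u2" and
        v: "v1 \<in> M'" "v2 \<in> PIdl x" "v = v1 \<oplus> v2"
        using Suc \<open>M \<subseteq> M' <+>\<^bsub>R\<^esub> PIdl x\<close> unfolding set_add_ideal_iff[symmetric] by (meson set_add_ideal_iff subsetD)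
      have c: "u1 \<in> carrier R" "u2 \<in> carrier R" "v1 \<in> carrier R" "v2 \<in> carrier R"
        using u v Mj(1) M' px by (meson ideal.Icarr)+
      have "u \<otimes> v = u1 \<otimes> v1 \<oplus> (u1 \<otimes> v2 \<oplus> u2 \<otimes> (v1 \<oplus> v2))"
        unfolding u(3) v(3) using c by algebra
      moreover have "u1 \<otimes> v1 \<in> ideal_power R M' (Suc j)"
        unfolding ideal_power_Suc using u v by (intro ideal_prod.prod)
      moreover have "u1 \<otimes> v2 \<oplus> u2 \<otimes> (v1 \<oplus> v2) \<in> PIdl x"
        using u v c px by (intro additive_subgroup.a_closed[OF ideal.axioms(1)[OF px]]
            ideal.I_l_closed[OF px] ideal.I_r_closed[OF px]) auto
      ultimately show "u \<otimes> v \<in> ideal_power R M' (Suc j) <+>\<^bsub>R\<^esub> PIdl x"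
        unfolding set_add_ideal_iff by blast
    qed
  qed
  have "\<exists>p. ideal_power R M p \<subseteq> L" if "ideal L R" "x [^] (s::nat) \<in> L" "\<And>x. x \<in> S \<Longrightarrow> \<exists>s::nat. x [^] s \<in> L" for s L
    using that
  proof (induction s arbitrary: L)
    case 0
    then have "L = carrier R" using ideal.one_imp_carrier by simp
    then show ?case by (intro exI[of _ 0]) simp
  next
    case (Suc s)
    interpret L: ideal L R by fact
    \<comment> \<open>Passing to (L : x) lowers the exponent of x by one. If a q-th power lies in L
      + (x) and a p-th power in (L : x), their product lies in L, because x (L : x) does.\<close>
    define L1 where "L1 = colon_ideal R L x"
    have L1: "ideal L1 R" unfolding L1_def using ideal_colon_ideal[OF Suc.prems(1) x] .
    have sub: "L \<subseteq> L1" unfolding L1_def colon_ideal_def using x L.I_r_closed L.Icarr by auto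
    have "x [^] s \<in> L1" unfolding L1_def colon_ideal_def using x Suc.prems(2) by simp
    then obtain p where p: "ideal_power R M p \<subseteq> L1"
      using Suc.IH[OF L1] Suc.prems(3) sub by (meson subsetD)
    obtain q where q: "ideal_power R M' q \<subseteq> L"
      using insert.IH[OF S Suc.prems(1,3)] unfolding M'_def by blast
    have "ideal_power R M (q + p) \<subseteq> L"
      unfolding ideal_power_add[OF M]
    proof (rule ideal_prod_subset[OF Suc.prems(1)])
      fix u v assume "u \<in> ideal_power R M q" "v \<in> ideal_power R M p"
      then obtain l c where l: "l \<in> L" "c \<in> carrier R" "u = l \<oplus> c \<otimes> x" and v: "v \<in> L1"
        using pw[of q] p q unfolding cgenideal_def
        by (smt (verit) mem_Collect_eq set_add_ideal_iff subsetD)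
      have vc: "v \<in> carrier R" "v \<otimes> x \<in> L" using v unfolding L1_def colon_ideal_def by auto
      have "u \<otimes> v = l \<otimes> v \<oplus> c \<otimes> (v \<otimes> x)"
        unfolding l(3) using l(2) vc x L.Icarr[OF l(1)] by algebra
      then show "u \<otimes> v \<in> L" using l vc by (simp add: L.I_l_closed L.I_r_closed)
    qed
    then show ?case by blast
  qed
  moreover obtain s :: nat where "x [^] s \<in> L" using insert.prems(3) by blast
  ultimately show ?case using insert.prems(2,3) unfolding M_def by blast
qed

end

section \<open>Approximation of colon ideals in noetherian rings\<close>

locale noetherian_cring = noetherian_ring R + cring R for R (structure)
begin

text \<open>Herstein's argument: an ideal \<open>L\<close> maximal among those with \<open>L \<inter> J = m\<^sup>n J\<close> contains a power
  of every element of \<open>m\<close>, hence a power of \<open>m\<close>.\<close>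

lemma weak_artin_rees:
  assumes m: "ideal m R" and J: "ideal J R"
  shows "\<exists>p. J \<inter> ideal_power R m p \<subseteq> ideal_power R m n \<cdot> J"
proof -
  define K where "K = ideal_power R m n \<cdot> J"
  have K: "ideal K R" "K \<subseteq> J"
    unfolding K_def using ideal_prod_is_ideal[OF ideal_ideal_power[OF m] J]
      ideal_prod_inter[OF ideal_ideal_power[OF m] J] by auto
  define S where "S = {L. ideal L R \<and> L \<inter> J = K}"
  \<comment> \<open>In a noetherian ring a nonempty chain of ideals contains its union, so the chain
    condition of Zorn's lemma is immediate.\<close>
  have "\<exists>L\<in>S. \<forall>L'\<in>S. L \<subseteq> L' \<longrightarrow> L' = L"
  proof (rule subset_Zorn_nonempty)
    show "S \<noteq> {}" unfolding S_def using K by blast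
    fix C assume C: "C \<noteq> {}" "subset.chain S C"
    then have "subset.chain {I. ideal I R} C" unfolding pred_on.chain_def S_def by auto
    then have "\<Union>C \<in> C" using ideal_chain_is_trivial C(1) by blast
    then show "\<Union>C \<in> S" using C(2) unfolding pred_on.chain_def by auto
  qed
  then obtain L where "L \<in> S" and max: "\<And>L'. L' \<in> S \<Longrightarrow> L \<subseteq> L' \<Longrightarrow> L' = L"
    by blast
  then have L: "ideal L R" "L \<inter> J = K" unfolding S_def by auto
  interpret L: ideal L R by fact
  have "\<exists>s::nat. x [^] s \<in> L" if x: "x \<in> m" for x
  proof -
    have xc: "x \<in> carrier R" using ideal.Icarr[OF m x] .
    \<comment> \<open>The ideals (L : x^s) increase with s and hence stabilize. At the stable s,
      adding x^s to L does not enlarge the intersection with J, so maximality puts x^s into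
      L.\<close>
    define Q where "Q = (\<lambda>s::nat. colon_ideal R L (x [^] s))"
    have Q: "ideal (Q s) R" for s unfolding Q_def using ideal_colon_ideal[OF L(1)] xc by simp
    have "Q s \<subseteq> Q (Suc s)" for s
    proof
      fix b assume "b \<in> Q s"
      then have b: "b \<in> carrier R" "b \<otimes> x [^] s \<in> L" unfolding Q_def colon_ideal_def by auto
      then have "(b \<otimes> x [^] s) \<otimes> x \<in> L" using L.I_r_closed xc by blast
      then show "b \<in> Q (Suc s)" unfolding Q_def colon_ideal_def using b(1) xc by (simp add: m_assoc)
    qed
    then have mono: "s \<le> t \<Longrightarrow> Q s \<subseteq> Q t" for s t by (rule lift_Suc_mono_le)
    have "Q s \<subseteq> Q t \<or> Q t \<subseteq> Q s" for s t using mono nat_le_linear by metis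
    then have "subset.chain {I. ideal I R} (range Q)"
      unfolding subset_chain_def using Q by blast
    then have "\<Union> (range Q) \<in> range Q" using ideal_chain_is_trivial by blast
    then obtain s where s: "\<And>t. Q t \<subseteq> Q s" by auto
    define L' where "L' = L <+>\<^bsub>R\<^esub> PIdl (x [^] s)"
    have px: "ideal (PIdl (x [^] s)) R" using xc by (intro cgenideal_ideal) simp
    have L': "ideal L' R" unfolding L'_def using add_ideals[OF L(1) px] .
    have LL': "L \<subseteq> L'" unfolding L'_def using set_add_subset_left[OF L(1) px] .
    have "L' \<inter> J \<subseteq> K"
    proof
      fix z assume z: "z \<in> L' \<inter> J"
      then obtain l b where l: "l \<in> L" and b: "b \<in> carrier R" and ze: "z = l \<oplus> b \<otimes> x [^] s"
        unfolding L'_def cgenideal_def by (auto simp: set_add_ideal_iff)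
      have lc: "l \<in> carrier R" using L.Icarr[OF l] .
      \<comment> \<open>Here the choice of K enters: x^n z lies in m^n J, hence in L. So b x^(n+s)
        is in L, and stability of the colon ideals removes the factor x^n.\<close>
      have "x [^] n \<otimes> z \<in> K" unfolding K_def
        using pow_in_ideal_power[OF m x] z by (intro ideal_prod.prod) auto
      then have "x [^] n \<otimes> z \<in> L" using L(2) by auto
      moreover have "x [^] n \<otimes> l \<in> L" using L.I_l_closed[OF l] xc by simp
      moreover have "b \<otimes> (u \<otimes> v) = u \<otimes> (l \<oplus> b \<otimes> v) \<ominus> u \<otimes> l"
        if "u \<in> carrier R" "v \<in> carrier R" for u v using that b lc by algebra
      then have "b \<otimes> x [^] (n + s) = x [^] n \<otimes> z \<ominus> x [^] n \<otimes> l"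
        unfolding ze nat_pow_mult[OF xc, symmetric] using xc by simp
      ultimately have "b \<otimes> x [^] (n + s) \<in> L" using L.a_closed L.a_inv_closed by (simp add: a_minus_def)
      then have "b \<in> Q s" using s[of "n + s"] b unfolding Q_def colon_ideal_def by auto
      then have "z \<in> L" unfolding ze using l unfolding Q_def colon_ideal_def by auto
      then show "z \<in> K" using L(2) z by auto
    qed
    then have "L' \<in> S" unfolding S_def using L' LL' L(2) by auto
    then have "L' = L" using max LL' by blast
    moreover have "x [^] s \<in> L'" unfolding L'_def
      using set_add_subset_right[OF L(1) px] cgenideal_self[of "x [^] s"] xc by auto
    ultimately show ?thesis by blast
  qed
  moreover obtain A where A: "A \<subseteq> carrier R" "finite A" "m = Idl A" using finetely_gen[OF m] by blast
  ultimately obtain p where "ideal_power R m p \<subseteq> L"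
    using genideal_power_subset[OF A(2,1) L(1)] genideal_self[OF A(1)] by blast
  then show ?thesis using L(2) unfolding K_def by blast
qed

text \<open>Apply weak Artin-Rees to J = I + (a). If a \<beta> = i + \<mu> with \<mu> in m^N, then
  \<mu> is in J as well, hence in m^n J and of the form i' + a \<nu> with \<nu> in m^n. So a
  (\<beta> - \<nu>) lies in I.\<close>

lemma colon_approximation:
  assumes m: "ideal m R" and I: "ideal I R" and a: "a \<in> carrier R"
  shows "\<exists>N. \<forall>\<beta>\<in>carrier R. a \<otimes> \<beta> \<in> I <+>\<^bsub>R\<^esub> ideal_power R m N \<longrightarrow>
    \<beta> \<in> colon_ideal R I a <+>\<^bsub>R\<^esub> ideal_power R m n"
proof -
  define J where "J = I <+>\<^bsub>R\<^esub> PIdl a"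
  have pa: "ideal (PIdl a) R" using a by (rule cgenideal_ideal)
  have J: "ideal J R" unfolding J_def using add_ideals[OF I pa] .
  obtain N where N: "J \<inter> ideal_power R m N \<subseteq> ideal_power R m n \<cdot> J"
    using weak_artin_rees[OF m J] by blast
  interpret I: ideal I R by fact
  define P where "P = ideal_power R m n"
  interpret P: ideal P R unfolding P_def by (rule ideal_ideal_power[OF m])
  \<comment> \<open>Because J = I + (a), the product m^n J is contained in I + a m^n.\<close>
  have split: "\<exists>i\<in>I. \<exists>\<nu>\<in>P. x = i \<oplus> a \<otimes> \<nu>" if "x \<in> P \<cdot> J" for x
    using that
  proof (induction rule: ideal_prod.induct)
    case (prod u v)
    then obtain i c where i: "i \<in> I" "c \<in> carrier R" "v = i \<oplus> c \<otimes> a"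
      unfolding J_def cgenideal_def by (auto simp: set_add_ideal_iff)
    have "u \<otimes> v = u \<otimes> i \<oplus> a \<otimes> (u \<otimes> c)"
      unfolding i(3) using P.Icarr[OF prod(1)] I.Icarr[OF i(1)] i(2) a by algebra
    moreover have "u \<otimes> i \<in> I" "u \<otimes> c \<in> P"
      using I.I_l_closed[OF i(1)] P.I_r_closed[OF prod(1) i(2)] P.Icarr[OF prod(1)] by auto
    ultimately show ?case by blast
  next
    case (sum x y)
    then obtain i \<nu> j \<mu> where i: "i \<in> I" "\<nu> \<in> P" "x = i \<oplus> a \<otimes> \<nu>" and j: "j \<in> I" "\<mu> \<in> P" "y = j \<oplus> a \<otimes> \<mu>"
      by blast
    have "x \<oplus> y = (i \<oplus> j) \<oplus> a \<otimes> (\<nu> \<oplus> \<mu>)"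
      unfolding i(3) j(3) using a I.Icarr[OF i(1)] I.Icarr[OF j(1)] P.Icarr[OF i(2)] P.Icarr[OF j(2)]
      by algebra
    then show ?case using I.a_closed[OF i(1) j(1)] P.a_closed[OF i(2) j(2)] by blast
  qed
  show ?thesis
  proof (intro exI[of _ N] ballI impI)
    fix \<beta> assume \<beta>: "\<beta> \<in> carrier R" "a \<otimes> \<beta> \<in> I <+>\<^bsub>R\<^esub> ideal_power R m N"
    then obtain i \<mu> where i: "i \<in> I" "\<mu> \<in> ideal_power R m N" "a \<otimes> \<beta> = i \<oplus> \<mu>"
      by (auto simp: set_add_ideal_iff)
    have ic: "i \<in> carrier R" "\<mu> \<in> carrier R"
      using I.Icarr[OF i(1)] ideal.Icarr[OF ideal_ideal_power[OF m] i(2)] by auto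
    have "\<mu> = (\<ominus> i) \<oplus> \<beta> \<otimes> a" using i(3) ic \<beta> a by (metis m_comm r_neg1)
    then have "\<mu> \<in> J" unfolding J_def cgenideal_def set_add_ideal_iff using i(1) \<beta> by blast
    then obtain i' \<nu> where i': "i' \<in> I" "\<nu> \<in> P" "\<mu> = i' \<oplus> a \<otimes> \<nu>"
      using split[of \<mu>] N i(2) unfolding P_def by blast
    have c: "i' \<in> carrier R" "\<nu> \<in> carrier R" using I.Icarr P.Icarr i' by auto
    have "(\<beta> \<ominus> \<nu>) \<otimes> a = a \<otimes> \<beta> \<ominus> a \<otimes> \<nu>" using \<beta> a c by algebra
    also have "\<dots> = i \<oplus> i'" unfolding i(3) i'(3) using c ic a by algebra
    finally have "\<beta> \<ominus> \<nu> \<in> colon_ideal R I a"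
      unfolding colon_ideal_def using \<beta> c i(1) i'(1) by simp
    moreover have "\<beta> = (\<beta> \<ominus> \<nu>) \<oplus> \<nu>" using \<beta> c by algebra
    ultimately show "\<beta> \<in> colon_ideal R I a <+>\<^bsub>R\<^esub> ideal_power R m n"
      unfolding set_add_ideal_iff using i'(2) unfolding P_def by blast
  qed
qed

text \<open>The truncated subtractions encode \<open>m\<^sup>j = R\<close> for \<open>j \<le> 0\<close>; the point is that \<open>p\<close> and \<open>N\<close>
  do not depend on the shift \<open>d\<close>.\<close>

lemma shifted_colon_approximation:
  assumes m: "ideal m R" and I: "ideal I R" and a: "a \<in> carrier R"
  shows "\<exists>p\<ge>n. (n = 0 \<longrightarrow> p = 0) \<and> (\<forall>N'. \<exists>N. \<forall>d. \<forall>\<beta>\<in>ideal_power R m (p - d). a \<otimes> \<beta> \<in> I <+>\<^bsub>R\<^esub> ideal_power R m (N - d) \<longrightarrow>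
    \<beta> \<in> (ideal_power R m (n - d) \<cdot> colon_ideal R I a) <+>\<^bsub>R\<^esub> ideal_power R m (N' - d))"
proof -
  define J where "J = colon_ideal R I a"
  have J: "ideal J R" unfolding J_def using ideal_colon_ideal[OF I a] .
  note pid = ideal_ideal_power[OF m]
  have RJ: "carrier R \<cdot> J = J"
    using ideal_prod_one[OF J] ideal_prod_commute[OF J oneideal] by simp
  \<comment> \<open>For n = 0 the product m^n J is J, so exponent 0 serves; this choice is what
    later allows an approximation to begin at an arbitrary element.\<close>
  have "\<exists>p2. J \<inter> ideal_power R m p2 \<subseteq> ideal_power R m n \<cdot> J \<and> (n = 0 \<longrightarrow> p2 = 0)"
    using weak_artin_rees[OF m J, of n] RJ by (cases "n = 0") (auto intro!: exI[of _ 0])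
  then obtain p2 where p2: "J \<inter> ideal_power R m p2 \<subseteq> ideal_power R m n \<cdot> J" "n = 0 \<longrightarrow> p2 = 0"
    by blast
  \<comment> \<open>With this p, p - d is at least p2 whenever d is at most n, so one Artin-Rees
    exponent covers all these shifts. For larger d the exponent n - d is 0 and membership in J is
    all that is asked.\<close>
  define p where "p = n + p2"
  have main: "\<exists>N. \<forall>d. \<forall>\<beta>\<in>ideal_power R m (p - d). a \<otimes> \<beta> \<in> I <+>\<^bsub>R\<^esub> ideal_power R m (N - d) \<longrightarrow>
    \<beta> \<in> (ideal_power R m (n - d) \<cdot> J) <+>\<^bsub>R\<^esub> ideal_power R m (N' - d)" for N'
  proof -
    \<comment> \<open>m^M is contained in both m^(N' - d) and m^(p - d): the first makes the error
      harmless, the second keeps j = \<beta> - \<mu> in m^(p - d).\<close>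
    define M where "M = max N' p"
    obtain N0 where N0: "\<And>\<beta>. \<beta> \<in> carrier R \<Longrightarrow> a \<otimes> \<beta> \<in> I <+>\<^bsub>R\<^esub> ideal_power R m N0 \<Longrightarrow>
      \<beta> \<in> J <+>\<^bsub>R\<^esub> ideal_power R m M"
      using colon_approximation[OF m I a, of M] unfolding J_def by blast
    show ?thesis
    \<comment> \<open>For d at most M, the exponent M + N0 - d is still at least N0. For d beyond M,
      N' - d is 0 and the claim is trivial.\<close>
    proof (intro exI[of _ "M + N0"] allI ballI impI)
      fix d \<beta> assume \<beta>: "\<beta> \<in> ideal_power R m (p - d)" and
        ab: "a \<otimes> \<beta> \<in> I <+>\<^bsub>R\<^esub> ideal_power R m (M + N0 - d)"
      have \<beta>c: "\<beta> \<in> carrier R" using ideal.Icarr[OF pid \<beta>] .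
      let ?G = "(ideal_power R m (n - d) \<cdot> J) <+>\<^bsub>R\<^esub> ideal_power R m (N' - d)"
      have idG: "ideal (ideal_power R m (n - d) \<cdot> J) R" using ideal_prod_is_ideal[OF pid J] .
      show "\<beta> \<in> ?G"
      proof (cases "d \<le> M")
        case False
        then have "N' - d = 0" unfolding M_def by simp
        then show ?thesis using set_add_subset_right[OF idG pid, of "N' - d"] \<beta>c by auto
      next
        case True
        have "ideal_power R m (M + N0 - d) \<subseteq> ideal_power R m N0"
          using ideal_power_antimono[OF m] True by simp
        then have "a \<otimes> \<beta> \<in> I <+>\<^bsub>R\<^esub> ideal_power R m N0" using ab unfolding set_add_ideal_iff by blast
        then obtain j \<mu> where j: "j \<in> J" "\<mu> \<in> ideal_power R m M" "\<beta> = j \<oplus> \<mu>"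
          using N0[OF \<beta>c] unfolding set_add_ideal_iff by blast
        have \<mu>: "\<mu> \<in> ideal_power R m (N' - d)" "\<mu> \<in> ideal_power R m (p - d)"
          using subsetD[OF ideal_power_antimono[OF m] j(2), of "N' - d"]
            subsetD[OF ideal_power_antimono[OF m] j(2), of "p - d"]
          unfolding M_def by auto
        have "j \<in> ideal_power R m (n - d) \<cdot> J"
        proof (cases "d \<le> n")
          case True
          have "j = \<beta> \<ominus> \<mu>" unfolding j(3)
            using ideal.Icarr[OF J j(1)] ideal.Icarr[OF pid j(2)] by algebra
          then have "j \<in> ideal_power R m (p - d)" using \<beta> \<mu>(2)
            by (simp add: a_minus_def additive_subgroup.a_closed[OF ideal.axioms(1)[OF pid]]
              additive_subgroup.a_inv_closed[OF ideal.axioms(1)[OF pid]])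
          then have "j \<in> ideal_power R m p2"
            using subsetD[OF ideal_power_antimono[OF m], of p2 "p - d"] True unfolding p_def by simp
          then have "j \<in> ideal_power R m n \<cdot> J" using p2(1) j(1) by blast
          then show ?thesis
            using ideal_prod_mono[OF ideal_power_antimono[OF m, of "n - d" n], of J J] by auto
        next
          case False
          then show ?thesis using RJ j(1) by simp
        qed
        then show ?thesis unfolding set_add_ideal_iff j(3) using \<mu>(1) by blast
      qed
    qed
  qed
  then show ?thesis unfolding J_def by (intro exI[of _ p]) (simp add: p_def p2(2))
qed

end

section \<open>Relations in filtered vector spaces\<close>

text \<open>\<open>V d\<close> is thought of as the step of degree \<open>d\<close> of a decreasing filtration, and \<open>w x\<close> as the
  degree of \<open>x\<close>, cut off at \<open>T\<close>.\<close>

definition weighted_pairs ::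
  "('r, 'x) ring_scheme \<Rightarrow> (nat \<Rightarrow> 'm set) \<Rightarrow> ('m \<Rightarrow> nat) \<Rightarrow> nat \<Rightarrow> ('r \<times> 'm) list list \<Rightarrow> (('m \<Rightarrow> 'r) \<times> 'm) set" where
  "weighted_pairs R V w T D =
     {(\<phi>, y). \<phi> \<in> rel_functions R D \<and> (\<exists>d\<le>T. y \<in> V d \<and> (\<forall>x. d < w x \<longrightarrow> \<phi> x = \<zero>\<^bsub>R\<^esub>))}"

locale vector_space_over = module R M + field R for R (structure) and M (structure)
begin

text \<open>Gaussian elimination with a pivot of least degree d0 among the functions that violate
  \<rho>. Subtracting a multiple of the pivot from a function of degree d \<ge> d0 respects the
  degree condition, because d < w x implies d0 < w x, where the pivot vanishes. The pivot finally
  cancels because \<rho> kills g.\<close>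

lemma weighted_kernel:
  assumes V: "\<And>d. V d \<subseteq> carrier M"
    and D: "\<And>\<rho>'. \<rho>' \<in> set D \<Longrightarrow> set \<rho>' \<subseteq> carrier R \<times> carrier M"
    and \<rho>: "set \<rho> \<subseteq> carrier R \<times> carrier M"
    and g: "g \<in> fun_span M (weighted_pairs R V w T D)" "rel_module M \<rho> g = \<zero>\<^bsub>M\<^esub>"
  shows "g \<in> fun_span M (weighted_pairs R V w T (\<rho> # D))"
proof -
  \<comment> \<open>In \<Gamma> at d0, the pairs whose function violates \<rho> have degree at least
    d0; raising d0 beyond T leaves no violation.\<close>
  define \<Gamma> where "\<Gamma> = (\<lambda>d0. {(\<phi>, y). \<phi> \<in> rel_functions R D \<and>
    (\<exists>d\<le>T. y \<in> V d \<and> (\<forall>x. d < w x \<longrightarrow> \<phi> x = \<zero>) \<and> (rel_ring R \<rho> \<phi> \<noteq> \<zero> \<longrightarrow> d0 \<le> d))})"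
  define \<Gamma>' where "\<Gamma>' = weighted_pairs R V w T (\<rho> # D)"
  have cl: "\<Gamma> d0 \<subseteq> (UNIV \<rightarrow> carrier R) \<times> carrier M" "\<Gamma>' \<subseteq> (UNIV \<rightarrow> carrier R) \<times> carrier M" for d0
    using V unfolding \<Gamma>_def \<Gamma>'_def weighted_pairs_def rel_functions_def by auto
  have split: "g \<in> fun_span M (\<Gamma> (Suc d0)) \<or> (\<exists>\<phi>0 y0 g'. \<phi>0 \<in> rel_functions R D \<and> y0 \<in> V d0 \<and>
      (\<forall>x. d0 < w x \<longrightarrow> \<phi>0 x = \<zero>) \<and> rel_ring R \<rho> \<phi>0 \<noteq> \<zero> \<and>
      g = (\<lambda>x. \<phi>0 x \<odot>\<^bsub>M\<^esub> y0 \<oplus>\<^bsub>M\<^esub> g' x) \<and> g' \<in> fun_span M (\<Gamma> d0))"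
    if "g \<in> fun_span M (\<Gamma> d0)" for g d0
    using that
  proof (induction rule: fun_span.induct)
    case zero
    then show ?case by (simp add: fun_span.zero)
  next
    case (step \<phi> y g)
    obtain d where \<phi>: "\<phi> \<in> rel_functions R D" and d: "d \<le> T" "y \<in> V d"
      "\<forall>x. d < w x \<longrightarrow> \<phi> x = \<zero>" "rel_ring R \<rho> \<phi> \<noteq> \<zero> \<longrightarrow> d0 \<le> d"
      using step(1) unfolding \<Gamma>_def by auto
    show ?case
    proof (cases "rel_ring R \<rho> \<phi> \<noteq> \<zero> \<and> d = d0")
      case True
      then show ?thesis using \<phi> d step(2) by blast
    next
      case False
      then have "(\<phi>, y) \<in> \<Gamma> (Suc d0)" unfolding \<Gamma>_def using \<phi> d by (auto intro!: exI[of _ d])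
      moreover
      { fix \<phi>0 y0 g'
        assume h: "\<phi>0 \<in> rel_functions R D" "y0 \<in> V d0" "\<forall>x. d0 < w x \<longrightarrow> \<phi>0 x = \<zero>"
          "rel_ring R \<rho> \<phi>0 \<noteq> \<zero>" "g = (\<lambda>x. \<phi>0 x \<odot>\<^bsub>M\<^esub> y0 \<oplus>\<^bsub>M\<^esub> g' x)" "g' \<in> fun_span M (\<Gamma> d0)"
        have "(\<lambda>x. \<phi> x \<odot>\<^bsub>M\<^esub> y \<oplus>\<^bsub>M\<^esub> g' x) \<in> fun_span M (\<Gamma> d0)"
          using fun_span.step[OF step(1) h(6)] .
        moreover have "(\<lambda>x. \<phi> x \<odot>\<^bsub>M\<^esub> y \<oplus>\<^bsub>M\<^esub> g x) = (\<lambda>x. \<phi>0 x \<odot>\<^bsub>M\<^esub> y0 \<oplus>\<^bsub>M\<^esub> (\<phi> x \<odot>\<^bsub>M\<^esub> y \<oplus>\<^bsub>M\<^esub> g' x))"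
        proof
          fix x
          have "g' x \<in> carrier M" "\<phi> x \<in> carrier R" "\<phi>0 x \<in> carrier R" "y \<in> carrier M" "y0 \<in> carrier M"
            using fun_span_closed[OF h(6) cl(1)] \<phi> h(1,2) d(2) V unfolding rel_functions_def by auto
          then show "\<phi> x \<odot>\<^bsub>M\<^esub> y \<oplus>\<^bsub>M\<^esub> g x = \<phi>0 x \<odot>\<^bsub>M\<^esub> y0 \<oplus>\<^bsub>M\<^esub> (\<phi> x \<odot>\<^bsub>M\<^esub> y \<oplus>\<^bsub>M\<^esub> g' x)"
            unfolding h(5) by (simp add: M.a_lcomm)
        qed
        ultimately have ?thesis using h(1-4)
          by (intro disjI2 exI[of _ \<phi>0] exI[of _ y0] exI[of _ "\<lambda>x. \<phi> x \<odot>\<^bsub>M\<^esub> y \<oplus>\<^bsub>M\<^esub> g' x"] conjI) }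
      ultimately show ?thesis using step.IH fun_span.step[of \<phi> y "\<Gamma> (Suc d0)" g M] by blast
    qed
  qed
  \<comment> \<open>y' collects the multiples of the pivot that were subtracted; it is also what
    \<rho> still sees of g', up to the factor \<open>rel_ring R \<rho> \<phi>0\<close>.\<close>
  have eliminate: "\<exists>y'\<in>carrier M. rel_module M \<rho> g' = rel_ring R \<rho> \<phi>0 \<odot>\<^bsub>M\<^esub> y' \<and>
      (\<lambda>x. g' x \<oplus>\<^bsub>M\<^esub> (\<ominus> \<phi>0 x) \<odot>\<^bsub>M\<^esub> y') \<in> fun_span M \<Gamma>'"
    if "g' \<in> fun_span M (\<Gamma> d0)" and \<phi>0: "\<phi>0 \<in> rel_functions R D" "\<forall>x. d0 < w x \<longrightarrow> \<phi>0 x = \<zero>"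
      "rel_ring R \<rho> \<phi>0 \<noteq> \<zero>" for g' \<phi>0 d0
    using that(1)
  proof (induction rule: fun_span.induct)
    case zero
    have "\<And>x. \<phi>0 x \<in> carrier R" using \<phi>0(1) by (simp add: rel_functions_def)
    then show ?case using fun_span.zero[of M \<Gamma>']
      by (intro bexI[of _ "\<zero>\<^bsub>M\<^esub>"]) (simp_all add: rel_module_zero[OF \<rho>] rel_ring_closed[OF \<rho>])
  next
    case (step \<phi> y g)
    obtain y' where y': "y' \<in> carrier M" "rel_module M \<rho> g = rel_ring R \<rho> \<phi>0 \<odot>\<^bsub>M\<^esub> y'"
      "(\<lambda>x. g x \<oplus>\<^bsub>M\<^esub> (\<ominus> \<phi>0 x) \<odot>\<^bsub>M\<^esub> y') \<in> fun_span M \<Gamma>'" using step.IH by blast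
    obtain d where \<phi>: "\<phi> \<in> rel_functions R D" and d: "d \<le> T" "y \<in> V d"
      "\<forall>x. d < w x \<longrightarrow> \<phi> x = \<zero>" "rel_ring R \<rho> \<phi> \<noteq> \<zero> \<longrightarrow> d0 \<le> d"
      using step(1) unfolding \<Gamma>_def by auto
    have yc: "y \<in> carrier M" using d(2) V by blast
    have c: "\<And>x. g x \<in> carrier M" "\<And>x. \<phi> x \<in> carrier R" "\<And>x. \<phi>0 x \<in> carrier R"
      using fun_span_closed[OF step(2) cl(1)] \<phi> \<phi>0(1) unfolding rel_functions_def by auto
    define r r0 where "r = rel_ring R \<rho> \<phi>" and "r0 = rel_ring R \<rho> \<phi>0"
    have r: "r \<in> carrier R" "r0 \<in> carrier R" "r0 \<noteq> \<zero>" "r0 \<in> Units R"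
      unfolding r_def r0_def using rel_ring_closed[OF \<rho>] c \<phi>0(3) field_Units by auto
    define q where "q = r \<otimes> inv r0"
    have q: "q \<in> carrier R" "q \<otimes> r0 = r"
      unfolding q_def using r by (auto simp: R.m_assoc)
    define \<psi> where "\<psi> = (\<lambda>x. \<phi> x \<oplus> (\<ominus> q) \<otimes> \<phi>0 x)"
    have \<psi>c: "\<And>x. \<psi> x \<in> carrier R" unfolding \<psi>_def using c q by simp
    have lin: "rel_ring R \<rho>' \<psi> = rel_ring R \<rho>' \<phi> \<oplus> (\<ominus> q) \<otimes> rel_ring R \<rho>' \<phi>0"
      if "set \<rho>' \<subseteq> carrier R \<times> carrier M" for \<rho>'
      unfolding \<psi>_def using c q(1) by (simp add: rel_ring_add[OF that] rel_ring_smult[OF that])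
    have "rel_ring R \<rho> \<psi> = \<zero>"
      using lin[OF \<rho>] q r unfolding r_def[symmetric] r0_def[symmetric] by (simp add: R.l_minus R.r_neg)
    moreover have "rel_ring R \<rho>' \<psi> = \<zero>" if "\<rho>' \<in> set D" for \<rho>'
      using lin[OF D[OF that]] \<phi> \<phi>0(1) that q(1) unfolding rel_functions_def by simp
    ultimately have \<psi>D: "\<psi> \<in> rel_functions R (\<rho> # D)"
      unfolding rel_functions_def using \<psi>c by auto
    \<comment> \<open>Either \<rho> already holds for \<phi> and q = 0, or d0 \<le> d, and the pivot
      vanishes wherever \<phi> has to.\<close>
    have "\<psi> x = \<zero>" if "d < w x" for x
    proof (cases "r = \<zero>")
      case True
      then have "q = \<zero>" unfolding q_def using r by simp
      then show ?thesis unfolding \<psi>_def using d(3) that c by simp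
    next
      case False
      then have "d0 < w x" using d(4) that unfolding r_def by simp
      then show ?thesis unfolding \<psi>_def using d(3) \<phi>0(2) that q by simp
    qed
    then have "(\<psi>, y) \<in> \<Gamma>'" unfolding \<Gamma>'_def weighted_pairs_def using \<psi>D d(1,2) by blast
    from fun_span.step[OF this y'(3)]
    have 1: "(\<lambda>x. \<psi> x \<odot>\<^bsub>M\<^esub> y \<oplus>\<^bsub>M\<^esub> (g x \<oplus>\<^bsub>M\<^esub> (\<ominus> \<phi>0 x) \<odot>\<^bsub>M\<^esub> y')) \<in> fun_span M \<Gamma>'" .
    have e: "\<psi> x \<odot>\<^bsub>M\<^esub> y \<oplus>\<^bsub>M\<^esub> (g x \<oplus>\<^bsub>M\<^esub> (\<ominus> \<phi>0 x) \<odot>\<^bsub>M\<^esub> y') =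
        (\<phi> x \<odot>\<^bsub>M\<^esub> y \<oplus>\<^bsub>M\<^esub> g x) \<oplus>\<^bsub>M\<^esub> (\<ominus> \<phi>0 x) \<odot>\<^bsub>M\<^esub> (q \<odot>\<^bsub>M\<^esub> y \<oplus>\<^bsub>M\<^esub> y')" for x
    proof -
      have "(\<ominus> q) \<otimes> \<phi>0 x = (\<ominus> \<phi>0 x) \<otimes> q" using q(1) c(3)[of x] by (simp add: R.l_minus R.m_comm[of q])
      then show ?thesis unfolding \<psi>_def using c q(1) yc y'(1)
        by (simp add: smult_l_distr smult_r_distr smult_assoc1 M.a_ac)
    qed
    have "rel_module M \<rho> (\<lambda>x. \<phi> x \<odot>\<^bsub>M\<^esub> y \<oplus>\<^bsub>M\<^esub> g x) = r \<odot>\<^bsub>M\<^esub> y \<oplus>\<^bsub>M\<^esub> r0 \<odot>\<^bsub>M\<^esub> y'"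
      unfolding r_def r0_def using c yc y' by (simp add: rel_module_add[OF \<rho>] rel_module_smult[OF \<rho>])
    also have "r \<odot>\<^bsub>M\<^esub> y = r0 \<odot>\<^bsub>M\<^esub> (q \<odot>\<^bsub>M\<^esub> y)"
      using q r yc by (metis R.m_comm smult_assoc1)
    finally have 2: "rel_module M \<rho> (\<lambda>x. \<phi> x \<odot>\<^bsub>M\<^esub> y \<oplus>\<^bsub>M\<^esub> g x) = r0 \<odot>\<^bsub>M\<^esub> (q \<odot>\<^bsub>M\<^esub> y \<oplus>\<^bsub>M\<^esub> y')"
      using q r yc y'(1) by (simp add: smult_r_distr)
    show ?case
      using 1 2 q(1) yc y'(1) unfolding e r0_def
      by (intro bexI[of _ "q \<odot>\<^bsub>M\<^esub> y \<oplus>\<^bsub>M\<^esub> y'"] conjI) simp_all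
  qed
  \<comment> \<open>k counts the degrees not yet examined. At d0 = Suc T no function can violate
    \<rho>, since all degrees are at most T.\<close>
  have "g \<in> fun_span M \<Gamma>'" if "g \<in> fun_span M (\<Gamma> d0)" "rel_module M \<rho> g = \<zero>\<^bsub>M\<^esub>" "k + d0 = Suc T" for g d0 k
    using that
  proof (induction k arbitrary: d0)
    case 0
    have "\<Gamma> d0 \<subseteq> \<Gamma>'" using 0(3)
      unfolding \<Gamma>_def \<Gamma>'_def weighted_pairs_def rel_functions_def by fastforce
    then show ?case using fun_span_mono[OF 0(1)] by blast
  next
    case (Suc k)
    from split[OF Suc.prems(1)] show ?case
    proof (elim disjE exE conjE)
      assume "g \<in> fun_span M (\<Gamma> (Suc d0))"
      then show ?thesis using Suc by simp
    next
      fix \<phi>0 y0 g'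
      assume h: "\<phi>0 \<in> rel_functions R D" "y0 \<in> V d0" "\<forall>x. d0 < w x \<longrightarrow> \<phi>0 x = \<zero>"
          "rel_ring R \<rho> \<phi>0 \<noteq> \<zero>" "g = (\<lambda>x. \<phi>0 x \<odot>\<^bsub>M\<^esub> y0 \<oplus>\<^bsub>M\<^esub> g' x)" "g' \<in> fun_span M (\<Gamma> d0)"
      obtain y' where y': "y' \<in> carrier M" "rel_module M \<rho> g' = rel_ring R \<rho> \<phi>0 \<odot>\<^bsub>M\<^esub> y'"
        "(\<lambda>x. g' x \<oplus>\<^bsub>M\<^esub> (\<ominus> \<phi>0 x) \<odot>\<^bsub>M\<^esub> y') \<in> fun_span M \<Gamma>'"
        using eliminate[OF h(6,1,3,4)] by blast
      define r0 where "r0 = rel_ring R \<rho> \<phi>0"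
      have c: "\<And>x. g' x \<in> carrier M" "\<And>x. \<phi>0 x \<in> carrier R" "y0 \<in> carrier M"
        using fun_span_closed[OF h(6) cl(1)] h(1,2) V unfolding rel_functions_def by auto
      have r0: "r0 \<in> carrier R" "r0 \<in> Units R"
        unfolding r0_def using rel_ring_closed[OF \<rho>] c h(4) field_Units by auto
      have "r0 \<odot>\<^bsub>M\<^esub> (y0 \<oplus>\<^bsub>M\<^esub> y') = \<zero>\<^bsub>M\<^esub>"
        using Suc.prems(2) c y' r0 unfolding h(5) r0_def
        by (simp add: rel_module_add[OF \<rho>] rel_module_smult[OF \<rho>] smult_r_distr)
      then have "inv r0 \<odot>\<^bsub>M\<^esub> (r0 \<odot>\<^bsub>M\<^esub> (y0 \<oplus>\<^bsub>M\<^esub> y')) = \<zero>\<^bsub>M\<^esub>" using r0 by simp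
      then have "y0 \<oplus>\<^bsub>M\<^esub> y' = \<zero>\<^bsub>M\<^esub>"
        using r0 c(3) y'(1) by (simp add: smult_assoc1[symmetric])
      \<comment> \<open>The coefficient of the pivot is forced to be minus y', so the terms with the
        pivot cancel against the subtracted ones.\<close>
      then have y0: "y0 = \<ominus>\<^bsub>M\<^esub> y'" using c(3) y'(1) by (simp add: M.minus_equality)
      have "g = (\<lambda>x. g' x \<oplus>\<^bsub>M\<^esub> (\<ominus> \<phi>0 x) \<odot>\<^bsub>M\<^esub> y')"
        unfolding h(5) y0 using c y'(1) by (simp add: smult_l_minus smult_r_minus M.a_comm)
      then show ?thesis using y'(3) by simp
    qed
  qed
  moreover have "fun_span M (weighted_pairs R V w T D) \<subseteq> fun_span M (\<Gamma> 0)"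
    by (auto elim!: fun_span_mono simp: weighted_pairs_def \<Gamma>_def)
  ultimately show ?thesis using g unfolding \<Gamma>'_def
    by (metis add_0_right subsetD)
qed

lemma weighted_indicator:
  assumes "finite U" "U \<subseteq> carrier M" "\<And>x. x \<in> carrier M \<Longrightarrow> w x \<le> T \<and> x \<in> V (w x)"
  shows "(\<lambda>x. if x \<in> U then x else \<zero>\<^bsub>M\<^esub>) \<in> fun_span M (weighted_pairs R V w T [])"
proof (rule fun_span_indicator[OF assms(1,2)])
  show "(\<lambda>x. if x = a then \<one> else \<zero>, a) \<in> weighted_pairs R V w T []" if "a \<in> U" for a
    using assms(2) assms(3)[of a] that by (auto simp: weighted_pairs_def rel_functions_def)
qed

text \<open>Stands in for a basis adapted to the filtration: each x in U becomes a combination of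
  elements y whose degrees d are at least w x, with coefficients that satisfy the relations of
  D.\<close>

lemma weighted_factorization:
  assumes V: "\<And>d. V d \<subseteq> carrier M" and w: "\<And>x. x \<in> carrier M \<Longrightarrow> w x \<le> T \<and> x \<in> V (w x)"
    and D: "valid_rels R M D" and U: "finite U" "U \<subseteq> carrier M"
  shows "\<exists>g\<in>fun_span M (weighted_pairs R V w T D). \<forall>x\<in>U. g x = x"
  using factorization[where \<Gamma> = "weighted_pairs R V w T", OF D U weighted_indicator[OF _ _ w]
      weighted_kernel[OF V]] by blast

end

section \<open>Filtered relations in the tensor product\<close>

lemma (in abelian_group) list_sum_in_subgroup:
  assumes "additive_subgroup H G" "set xs \<subseteq> H"
  shows "list_sum G xs \<in> H"
  using assms(2) by (induction xs)
    (auto simp: additive_subgroup.zero_closed[OF assms(1)] additive_subgroup.a_closed[OF assms(1)])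

definition tensor_sum :: "('a, 'w) ring_scheme \<Rightarrow> ('b \<Rightarrow> 'c \<Rightarrow> 'a) \<Rightarrow> ('b \<times> 'c) list \<Rightarrow> 'a" where
  "tensor_sum A \<tau> zs = list_sum A (map (\<lambda>(b, c). \<tau> b c) zs)"

lemma tensor_sum_simps [simp]:
  "tensor_sum A \<tau> [] = \<zero>\<^bsub>A\<^esub>"
  "tensor_sum A \<tau> ((b, c) # zs) = \<tau> b c \<oplus>\<^bsub>A\<^esub> tensor_sum A \<tau> zs"
  by (simp_all add: tensor_sum_def)

text \<open>The additive monoid generated by the tensors of pairs in P. It is a group as soon as P
  is stable under negating left entries, so no integer coefficients are carried along.\<close>

definition tensor_sums :: "('a, 'w) ring_scheme \<Rightarrow> ('b \<Rightarrow> 'c \<Rightarrow> 'a) \<Rightarrow> ('b \<times> 'c) set \<Rightarrow> 'a set" where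
  "tensor_sums A \<tau> P = tensor_sum A \<tau> ` {zs. set zs \<subseteq> P}"

lemma tensor_sumsI: "set zs \<subseteq> P \<Longrightarrow> tensor_sum A \<tau> zs \<in> tensor_sums A \<tau> P"
  by (auto simp: tensor_sums_def)

lemma tensor_sums_zero: "\<zero>\<^bsub>A\<^esub> \<in> tensor_sums A \<tau> P"
  using tensor_sumsI[of "[]"] by simp

lemma tensor_sumsE:
  assumes "x \<in> tensor_sums A \<tau> P" obtains zs where "set zs \<subseteq> P" "x = tensor_sum A \<tau> zs"
  using assms by (auto simp: tensor_sums_def)

lemma tensor_sums_mono: "P \<subseteq> Q \<Longrightarrow> tensor_sums A \<tau> P \<subseteq> tensor_sums A \<tau> Q"
  by (auto simp: tensor_sums_def)

text \<open>Records that A is generated by tensors with the expected calculation rules. That sums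
  vanish only for the expected reasons is a separate assumption of
  \<open>filtered_tensor_ring\<close>.\<close>

locale tensor_ring = B: algebra k B + C: algebra k C + A: cring A
  for k :: "('k, 'x) ring_scheme" and B :: "('k, 'b, 'y) module_scheme"
    and C :: "('k, 'c, 'z) module_scheme" and A :: "('a, 'w) ring_scheme" +
  fixes \<tau> :: "'b \<Rightarrow> 'c \<Rightarrow> 'a"
  assumes tau_closed: "b \<in> carrier B \<Longrightarrow> c \<in> carrier C \<Longrightarrow> \<tau> b c \<in> carrier A"
    and tau_add_left: "b \<in> carrier B \<Longrightarrow> b' \<in> carrier B \<Longrightarrow> c \<in> carrier C \<Longrightarrow>
      \<tau> (b \<oplus>\<^bsub>B\<^esub> b') c = \<tau> b c \<oplus>\<^bsub>A\<^esub> \<tau> b' c"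
    and tau_add_right: "b \<in> carrier B \<Longrightarrow> c \<in> carrier C \<Longrightarrow> c' \<in> carrier C \<Longrightarrow>
      \<tau> b (c \<oplus>\<^bsub>C\<^esub> c') = \<tau> b c \<oplus>\<^bsub>A\<^esub> \<tau> b c'"
    and tau_smult: "a \<in> carrier k \<Longrightarrow> b \<in> carrier B \<Longrightarrow> c \<in> carrier C \<Longrightarrow>
      \<tau> (a \<odot>\<^bsub>B\<^esub> b) c = \<tau> b (a \<odot>\<^bsub>C\<^esub> c)"
    and tau_mult: "b \<in> carrier B \<Longrightarrow> b' \<in> carrier B \<Longrightarrow> c \<in> carrier C \<Longrightarrow> c' \<in> carrier C \<Longrightarrow>
      \<tau> b c \<otimes>\<^bsub>A\<^esub> \<tau> b' c' = \<tau> (b \<otimes>\<^bsub>B\<^esub> b') (c \<otimes>\<^bsub>C\<^esub> c')"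
    and tau_one: "\<tau> \<one>\<^bsub>B\<^esub> \<one>\<^bsub>C\<^esub> = \<one>\<^bsub>A\<^esub>"
    and tau_generates: "carrier A \<subseteq> tensor_sums A \<tau> (carrier B \<times> carrier C)"
begin

abbreviation "BC \<equiv> carrier B \<times> carrier C"
abbreviation "tsum \<equiv> tensor_sum A \<tau>"
abbreviation "tsums \<equiv> tensor_sums A \<tau>"

lemma tau_zero_left: "c \<in> carrier C \<Longrightarrow> \<tau> \<zero>\<^bsub>B\<^esub> c = \<zero>\<^bsub>A\<^esub>"
  using tau_add_left[of "\<zero>\<^bsub>B\<^esub>" "\<zero>\<^bsub>B\<^esub>" c] tau_closed[of "\<zero>\<^bsub>B\<^esub>" c] by simp

lemma tau_zero_right: "b \<in> carrier B \<Longrightarrow> \<tau> b \<zero>\<^bsub>C\<^esub> = \<zero>\<^bsub>A\<^esub>"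
  using tau_add_right[of b "\<zero>\<^bsub>C\<^esub>" "\<zero>\<^bsub>C\<^esub>"] tau_closed[of b "\<zero>\<^bsub>C\<^esub>"] by simp

lemma tau_minus_left:
  assumes "b \<in> carrier B" "c \<in> carrier C"
  shows "\<tau> (\<ominus>\<^bsub>B\<^esub> b) c = \<ominus>\<^bsub>A\<^esub> \<tau> b c"
proof -
  have "\<tau> (\<ominus>\<^bsub>B\<^esub> b) c \<oplus>\<^bsub>A\<^esub> \<tau> b c = \<zero>\<^bsub>A\<^esub>"
    using assms tau_add_left[of "\<ominus>\<^bsub>B\<^esub> b" b c] by (simp add: B.l_neg tau_zero_left)
  then show ?thesis using assms tau_closed by (simp add: A.minus_equality)
qed

lemma tsum_closed: "set zs \<subseteq> BC \<Longrightarrow> tsum zs \<in> carrier A"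
  by (induction zs) (auto simp: tau_closed)

lemma tsum_append:
  "set zs \<subseteq> BC \<Longrightarrow> set ws \<subseteq> BC \<Longrightarrow>
   tsum (zs @ ws) = tsum zs \<oplus>\<^bsub>A\<^esub> tsum ws"
  by (induction zs) (auto simp: tau_closed tsum_closed A.a_assoc)

lemma tsum_minus:
  "set zs \<subseteq> BC \<Longrightarrow> tsum (map (\<lambda>(b, c). (\<ominus>\<^bsub>B\<^esub> b, c)) zs) = \<ominus>\<^bsub>A\<^esub> tsum zs"
  by (induction zs) (auto simp: tau_closed tsum_closed A.minus_add tau_minus_left)

lemma tsum_mult:
  "set zs \<subseteq> BC \<Longrightarrow> b \<in> carrier B \<Longrightarrow> c \<in> carrier C \<Longrightarrow>
   \<tau> b c \<otimes>\<^bsub>A\<^esub> tsum zs = tsum (map (\<lambda>(b', c'). (b \<otimes>\<^bsub>B\<^esub> b', c \<otimes>\<^bsub>C\<^esub> c')) zs)"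
  by (induction zs) (auto simp: tau_closed tsum_closed tau_mult A.r_distr)

lemma tsums_closed: "P \<subseteq> BC \<Longrightarrow> tsums P \<subseteq> carrier A"
  unfolding tensor_sums_def by (auto simp del: subset_iff intro!: tsum_closed)

lemma tsums_add:
  assumes "P \<subseteq> BC" "x \<in> tsums P" "y \<in> tsums P"
  shows "x \<oplus>\<^bsub>A\<^esub> y \<in> tsums P"
proof -
  obtain zs ws where zs: "set zs \<subseteq> P" "x = tsum zs" and ws: "set ws \<subseteq> P" "y = tsum ws"
    using assms(2,3) by (elim tensor_sumsE)
  have "x \<oplus>\<^bsub>A\<^esub> y = tsum (zs @ ws)"
    using tsum_append[OF order_trans[OF zs(1) assms(1)] order_trans[OF ws(1) assms(1)]] zs ws by simp
  then show ?thesis using zs ws tensor_sumsI[of "zs @ ws" P] by simp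
qed

lemma tsums_single: "(b, c) \<in> P \<Longrightarrow> P \<subseteq> BC \<Longrightarrow> \<tau> b c \<in> tsums P"
  using tensor_sumsI[of "[(b, c)]" P A \<tau>] tau_closed by auto

lemma tsums_mult:
  assumes P: "P \<subseteq> BC" and Q: "Q \<subseteq> BC"
    and S: "S \<subseteq> BC"
    and PQ: "\<And>b c b' c'. (b, c) \<in> P \<Longrightarrow> (b', c') \<in> Q \<Longrightarrow> (b \<otimes>\<^bsub>B\<^esub> b', c \<otimes>\<^bsub>C\<^esub> c') \<in> S"
    and x: "x \<in> tsums P" and y: "y \<in> tsums Q"
  shows "x \<otimes>\<^bsub>A\<^esub> y \<in> tsums S"
proof -
  obtain ws where ws: "set ws \<subseteq> Q" "y = tsum ws" using y by (rule tensor_sumsE)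
  obtain zs where zs: "set zs \<subseteq> P" "x = tsum zs" using x by (rule tensor_sumsE)
  have yc: "y \<in> carrier A" using ws Q tsum_closed by blast
  have "tsum zs \<otimes>\<^bsub>A\<^esub> y \<in> tsums S" using zs(1)
  proof (induction zs)
    case Nil
    then show ?case using yc by (simp add: tensor_sums_zero)
  next
    case (Cons z zs)
    obtain b c where z: "z = (b, c)" by force
    have bc: "b \<in> carrier B" "c \<in> carrier C" "(b, c) \<in> P" using Cons z P by auto
    have "tsum zs \<in> carrier A" using tsum_closed Cons.prems P by auto
    then have "tsum (z # zs) \<otimes>\<^bsub>A\<^esub> y = \<tau> b c \<otimes>\<^bsub>A\<^esub> y \<oplus>\<^bsub>A\<^esub> tsum zs \<otimes>\<^bsub>A\<^esub> y"
      unfolding z using yc bc tau_closed by (simp add: A.l_distr)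
    moreover have "set (map (\<lambda>(b', c'). (b \<otimes>\<^bsub>B\<^esub> b', c \<otimes>\<^bsub>C\<^esub> c')) ws) \<subseteq> S"
      using PQ[OF bc(3)] ws(1) by fastforce
    then have "\<tau> b c \<otimes>\<^bsub>A\<^esub> y \<in> tsums S"
      unfolding ws(2) tsum_mult[OF order_trans[OF ws(1) Q] bc(1,2)] by (rule tensor_sumsI)
    ultimately show ?case using tsums_add[OF S] Cons by auto
  qed
  then show ?thesis using zs by simp
qed

lemma tsums_minus:
  assumes P: "P \<subseteq> BC" and neg: "\<And>b c. (b, c) \<in> P \<Longrightarrow> (\<ominus>\<^bsub>B\<^esub> b, c) \<in> P"
    and x: "x \<in> tsums P"
  shows "\<ominus>\<^bsub>A\<^esub> x \<in> tsums P"
proof -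
  obtain zs where zs: "set zs \<subseteq> P" "x = tsum zs" using x by (rule tensor_sumsE)
  have "set (map (\<lambda>(b, c). (\<ominus>\<^bsub>B\<^esub> b, c)) zs) \<subseteq> P" using zs(1) neg by auto
  then show ?thesis unfolding zs(2) tsum_minus[OF order_trans[OF zs(1) P], symmetric]
    by (rule tensor_sumsI)
qed

lemma tsums_union:
  assumes P: "P \<subseteq> BC" and Q: "Q \<subseteq> BC"
  shows "tsums P <+>\<^bsub>A\<^esub> tsums Q = tsums (P \<union> Q)"
proof
  show "tsums P <+>\<^bsub>A\<^esub> tsums Q \<subseteq> tsums (P \<union> Q)"
  proof
    fix z assume "z \<in> tsums P <+>\<^bsub>A\<^esub> tsums Q"
    then obtain x y where "x \<in> tsums P" "y \<in> tsums Q" "z = x \<oplus>\<^bsub>A\<^esub> y" by (auto simp: A.set_add_ideal_iff)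
    moreover have "tsums P \<subseteq> tsums (P \<union> Q)" "tsums Q \<subseteq> tsums (P \<union> Q)" by (auto intro!: tensor_sums_mono)
    ultimately show "z \<in> tsums (P \<union> Q)" using tsums_add[of "P \<union> Q" x y] P Q by blast
  qed
  show "tsums (P \<union> Q) \<subseteq> tsums P <+>\<^bsub>A\<^esub> tsums Q"
  proof
    fix z assume "z \<in> tsums (P \<union> Q)"
    then obtain zs where zs: "set zs \<subseteq> P \<union> Q" "z = tsum zs" by (rule tensor_sumsE)
    from zs(1) have "\<exists>x\<in>tsums P. \<exists>y\<in>tsums Q. tsum zs = x \<oplus>\<^bsub>A\<^esub> y"
    proof (induction zs)
      case Nil
      show ?case by (intro bexI[OF _ tensor_sums_zero]) simp
    next
      case (Cons p zs)
      obtain b c where p: "p = (b, c)" by force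
      obtain x y where xy: "x \<in> tsums P" "y \<in> tsums Q" "tsum zs = x \<oplus>\<^bsub>A\<^esub> y" using Cons by auto
      have c: "x \<in> carrier A" "y \<in> carrier A" using xy tsums_closed[OF P] tsums_closed[OF Q] by auto
      have t: "\<tau> b c \<in> carrier A" using Cons.prems P Q tau_closed unfolding p by auto
      from Cons.prems consider "(b, c) \<in> P" | "(b, c) \<in> Q" unfolding p by auto
      then show ?case
      proof cases
        case 1
        have "tsum (p # zs) = (\<tau> b c \<oplus>\<^bsub>A\<^esub> x) \<oplus>\<^bsub>A\<^esub> y" unfolding p using xy(3) t c by (simp add: A.a_assoc)
        then show ?thesis using tsums_add[OF P tsums_single[OF 1 P] xy(1)] xy(2) by blast
      next
        case 2
        have "tsum (p # zs) = x \<oplus>\<^bsub>A\<^esub> (\<tau> b c \<oplus>\<^bsub>A\<^esub> y)" unfolding p using xy(3) t c by (simp add: A.a_lcomm)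
        then show ?thesis using tsums_add[OF Q tsums_single[OF 2 Q] xy(2)] xy(1) by blast
      qed
    qed
    then show "z \<in> tsums P <+>\<^bsub>A\<^esub> tsums Q" unfolding zs(2) A.set_add_ideal_iff by blast
  qed
qed

text \<open>Inverses in the generated group are absorbed by negating the left entry, which stays in
  U.\<close>

lemma tsums_generate:
  assumes U: "U \<subseteq> carrier B" "\<And>b. b \<in> U \<Longrightarrow> \<ominus>\<^bsub>B\<^esub> b \<in> U" and V: "V \<subseteq> carrier C"
  shows "generate (add_monoid A) {\<tau> u v | u v. u \<in> U \<and> v \<in> V} = tsums (U \<times> V)"
proof
  have UV: "U \<times> V \<subseteq> BC" using U V by blast
  show "generate (add_monoid A) {\<tau> u v | u v. u \<in> U \<and> v \<in> V} \<subseteq> tsums (U \<times> V)"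
  proof
    fix x assume "x \<in> generate (add_monoid A) {\<tau> u v | u v. u \<in> U \<and> v \<in> V}"
    then show "x \<in> tsums (U \<times> V)"
    proof (induction rule: generate.induct)
      case one
      then show ?case by (simp add: tensor_sums_zero)
    next
      case (incl x)
      then show ?case using tsums_single[OF _ UV] by blast
    next
      case (inv x)
      then have "x \<in> tsums (U \<times> V)" using tsums_single[OF _ UV] by blast
      then show ?case using tsums_minus[OF UV] U(2) by (auto simp: a_inv_def)
    next
      case (eng x y)
      then show ?case using tsums_add[OF UV] by simp
    qed
  qed
  show "tsums (U \<times> V) \<subseteq> generate (add_monoid A) {\<tau> u v | u v. u \<in> U \<and> v \<in> V}"
  proof
    fix x assume "x \<in> tsums (U \<times> V)"
    then obtain zs where zs: "set zs \<subseteq> U \<times> V" "x = tsum zs" by (rule tensor_sumsE)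
    from zs(1) have "tsum zs \<in> generate (add_monoid A) {\<tau> u v | u v. u \<in> U \<and> v \<in> V}"
    proof (induction zs)
      case Nil
      show ?case using generate.one[of "add_monoid A"] by simp
    next
      case (Cons p zs)
      obtain b c where p: "p = (b, c)" by force
      have "\<tau> b c \<in> generate (add_monoid A) {\<tau> u v | u v. u \<in> U \<and> v \<in> V}"
        using Cons.prems unfolding p by (intro generate.incl) auto
      moreover have "tsum zs \<in> generate (add_monoid A) {\<tau> u v | u v. u \<in> U \<and> v \<in> V}" using Cons by simp
      ultimately show ?case unfolding p using generate.eng[of "\<tau> b c" "add_monoid A"] by simp
    qed
    then show "x \<in> generate (add_monoid A) {\<tau> u v | u v. u \<in> U \<and> v \<in> V}" using zs(2) by simp
  qed
qed

lemma tsums_ideal: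
  assumes m: "ideal m B" and n: "ideal n C"
  shows "ideal (tsums (m \<times> carrier C \<union> carrier B \<times> n)) A"
proof (rule idealI)
  let ?P = "m \<times> carrier C \<union> carrier B \<times> n"
  interpret m: ideal m B by (rule m)
  interpret n: ideal n C by (rule n)
  have P: "?P \<subseteq> BC" by auto
  have mult: "x \<otimes>\<^bsub>A\<^esub> a \<in> tsums ?P" if x: "x \<in> tsums ?P" and a: "a \<in> carrier A" for x a
  proof (rule tsums_mult[OF P order_refl P _ x])
    show "a \<in> tsums BC" using a tau_generates by blast
    show "(b \<otimes>\<^bsub>B\<^esub> b', c \<otimes>\<^bsub>C\<^esub> c') \<in> ?P" if "(b, c) \<in> ?P" "(b', c') \<in> BC" for b c b' c'
      using that m.I_r_closed n.I_r_closed by auto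
  qed
  show "ring A" by (rule A.ring_axioms)
  show "subgroup (tsums ?P) (add_monoid A)"
  proof (rule A.add.subgroupI)
    show "tsums ?P \<subseteq> carrier A" using tsums_closed[OF P] .
    show "tsums ?P \<noteq> {}" using tensor_sums_zero by blast
    show "\<ominus>\<^bsub>A\<^esub> x \<in> tsums ?P" if "x \<in> tsums ?P" for x
      by (rule tsums_minus[OF P _ that]) auto
    show "x \<oplus>\<^bsub>A\<^esub> y \<in> tsums ?P" if "x \<in> tsums ?P" "y \<in> tsums ?P" for x y
      using tsums_add[OF P that] .
  qed
  show "x \<otimes>\<^bsub>A\<^esub> a \<in> tsums ?P" if "x \<in> tsums ?P" "a \<in> carrier A" for x a using mult that .
  then show "a \<otimes>\<^bsub>A\<^esub> x \<in> tsums ?P" if "x \<in> tsums ?P" "a \<in> carrier A" for x a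
    using that tsums_closed[OF P] A.m_comm[of a x] by auto
qed

lemma tau_in_left_power:
  assumes m: "ideal m B" and r: "ideal r A" and mr: "\<And>b. b \<in> m \<Longrightarrow> \<tau> b \<one>\<^bsub>C\<^esub> \<in> r"
  shows "b \<in> ideal_power B m i \<Longrightarrow> \<tau> b \<one>\<^bsub>C\<^esub> \<in> ideal_power A r i"
proof (induction i arbitrary: b)
  case 0
  then show ?case using tau_closed by simp
next
  case (Suc i)
  note mi = B.ideal_ideal_power[OF m, of i]
  have "b \<in> ideal_prod B (ideal_power B m i) m" using Suc.prems by simp
  then show ?case
  proof (induction rule: ideal_prod.induct)
    case (prod u v)
    have "\<tau> (u \<otimes>\<^bsub>B\<^esub> v) \<one>\<^bsub>C\<^esub> = \<tau> u \<one>\<^bsub>C\<^esub> \<otimes>\<^bsub>A\<^esub> \<tau> v \<one>\<^bsub>C\<^esub>"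
      using tau_mult[OF ideal.Icarr[OF mi prod(1)] ideal.Icarr[OF m prod(2)]] by simp
    then show ?case using Suc.IH[OF prod(1)] mr[OF prod(2)] by (simp add: ideal_prod.prod)
  next
    case (sum u v)
    then have "u \<in> carrier B" "v \<in> carrier B" using B.ideal_prod_in_carrier[OF mi m] by auto
    then show ?case using sum tau_add_left ideal_prod.sum[of "\<tau> u \<one>\<^bsub>C\<^esub>" A "ideal_power A r i" r "\<tau> v \<one>\<^bsub>C\<^esub>"] by simp
  qed
qed

lemma tensor_sum_swap: "tensor_sum A (\<lambda>c b. \<tau> b c) (map prod.swap zs) = tsum zs"
  by (induction zs) auto

lemma tensor_sums_swap: "tensor_sums A (\<lambda>c b. \<tau> b c) (prod.swap ` P) = tsums P"
proof
  show "tensor_sums A (\<lambda>c b. \<tau> b c) (prod.swap ` P) \<subseteq> tsums P"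
  proof
    fix x assume "x \<in> tensor_sums A (\<lambda>c b. \<tau> b c) (prod.swap ` P)"
    then obtain zs where zs: "set zs \<subseteq> prod.swap ` P" "x = tensor_sum A (\<lambda>c b. \<tau> b c) zs" by (rule tensor_sumsE)
    have "x = tsum (map prod.swap zs)" using tensor_sum_swap[of "map prod.swap zs"] zs(2) by (simp add: comp_def)
    moreover have "set (map prod.swap zs) \<subseteq> P" using zs(1) by auto
    ultimately show "x \<in> tsums P" by (simp only: tensor_sumsI)
  qed
  show "tsums P \<subseteq> tensor_sums A (\<lambda>c b. \<tau> b c) (prod.swap ` P)"
  proof
    fix x assume "x \<in> tsums P"
    then obtain zs where zs: "set zs \<subseteq> P" "x = tsum zs" by (rule tensor_sumsE)
    then have "set (map prod.swap zs) \<subseteq> prod.swap ` P" by auto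
    then show "x \<in> tensor_sums A (\<lambda>c b. \<tau> b c) (prod.swap ` P)"
      unfolding zs(2) tensor_sum_swap[symmetric] by (rule tensor_sumsI)
  qed
qed

text \<open>The ring A is unchanged and only the arguments of \<tau> trade places. So results about
  the left factor apply to the right one without transport along an isomorphism from B (x) C to C
  (x) B.\<close>

lemma tensor_ring_swap: "tensor_ring k C B A (\<lambda>c b. \<tau> b c)"
proof -
  have "prod.swap ` BC = carrier C \<times> carrier B" by auto
  then have "carrier A \<subseteq> tensor_sums A (\<lambda>c b. \<tau> b c) (carrier C \<times> carrier B)"
    using tensor_sums_swap[of "BC"] tau_generates by simp
  then show ?thesis
    by (intro tensor_ring.intro tensor_ring_axioms.intro B.algebra_axioms C.algebra_axioms A.is_cring)
      (simp_all add: tau_closed tau_add_left tau_add_right tau_smult tau_mult tau_one)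
qed

end

text \<open>Up to exchanging \<open>B\<close> and \<open>C\<close>, the locale is symmetric except for \<open>tensor_sum_zero\<close>, in which
  relations between the right factors are used, and for the noetherian hypothesis.\<close>

locale filtered_tensor_ring = K: field k + tensor_ring k B C A \<tau>
  for k :: "('k, 'x) ring_scheme" and B :: "('k, 'b, 'y) module_scheme"
    and C :: "('k, 'c, 'z) module_scheme" and A :: "('a, 'w) ring_scheme" and \<tau> +
  fixes m :: "'b set" and n :: "'c set" and r :: "'a set"
  assumes tensor_sum_zero: "set zs \<subseteq> carrier B \<times> carrier C \<Longrightarrow> tensor_sum A \<tau> zs = \<zero>\<^bsub>A\<^esub> \<Longrightarrow>
      \<exists>D. valid_rels k C D \<and>
        (\<forall>\<phi>\<in>rel_functions k D. list_sum B (map (\<lambda>(b, c). \<phi> c \<odot>\<^bsub>B\<^esub> b) zs) = \<zero>\<^bsub>B\<^esub>)"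
    and noetherian: "noetherian_ring B"
    and ideal_m: "ideal m B" and ideal_n: "ideal n C" and ideal_r: "ideal r A"
    and r_eq: "r = tensor_sums A \<tau> (m \<times> carrier C \<union> carrier B \<times> n)"
begin

sublocale B: noetherian_cring B
  using noetherian B.is_cring by (simp add: noetherian_cring_def)

section \<open>The powers of r in terms of those of m and n\<close>

abbreviation "mp i \<equiv> ideal_power B m i"
abbreviation "np i \<equiv> ideal_power C n i"
abbreviation "rp i \<equiv> ideal_power A r i"

lemma mp_ideal: "ideal (mp i) B" by (rule B.ideal_ideal_power[OF ideal_m])
lemma np_ideal: "ideal (np i) C" by (rule C.ideal_ideal_power[OF ideal_n])
lemma rp_ideal: "ideal (rp i) A" by (rule A.ideal_ideal_power[OF ideal_r])

text \<open>The generators of the sum of the m^(p-d) (x) n^d. Here d is unbounded: beyond p the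
  pairs range over B \<times> n^d, which is contained in the case d = p.\<close>

definition filtered_pairs :: "nat \<Rightarrow> ('b \<times> 'c) set" where
  "filtered_pairs p = {(b, c). \<exists>d. b \<in> mp (p - d) \<and> c \<in> np d}"

lemma filtered_pairs_subset: "filtered_pairs p \<subseteq> BC"
  unfolding filtered_pairs_def using ideal.Icarr[OF mp_ideal] ideal.Icarr[OF np_ideal] by blast

lemma tau_in_rp: assumes b: "b \<in> mp i" and c: "c \<in> np j" shows "\<tau> b c \<in> rp (i + j)"
proof -
  have P: "m \<times> carrier C \<union> carrier B \<times> n \<subseteq> BC" using ideal.Icarr[OF ideal_m] ideal.Icarr[OF ideal_n] by auto
  have 1: "\<tau> b \<one>\<^bsub>C\<^esub> \<in> rp i"
    by (rule tau_in_left_power[OF ideal_m ideal_r _ b]) (auto simp: r_eq intro: tsums_single[OF _ P])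
  have 2: "\<tau> \<one>\<^bsub>B\<^esub> c \<in> rp j"
    by (rule tensor_ring.tau_in_left_power[OF tensor_ring_swap ideal_n ideal_r _ c])
      (auto simp: r_eq intro: tsums_single[OF _ P])
  have "b \<in> carrier B" "c \<in> carrier C" using ideal.Icarr[OF mp_ideal b] ideal.Icarr[OF np_ideal c] .
  then have "\<tau> b c = \<tau> b \<one>\<^bsub>C\<^esub> \<otimes>\<^bsub>A\<^esub> \<tau> \<one>\<^bsub>B\<^esub> c" using tau_mult[of b "\<one>\<^bsub>B\<^esub>" "\<one>\<^bsub>C\<^esub>" c] by simp
  then show ?thesis using A.ideal_power_mult[OF ideal_r 1 2] by simp
qed

lemma tau_filtered_in_rp: "(b, c) \<in> filtered_pairs p \<Longrightarrow> \<tau> b c \<in> rp p"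
proof -
  assume "(b, c) \<in> filtered_pairs p"
  then obtain d where d: "b \<in> mp (p - d)" "c \<in> np d" unfolding filtered_pairs_def by blast
  have "p \<le> p - d + d" by simp
  then show ?thesis using A.ideal_power_antimono[OF ideal_r] tau_in_rp[OF d] by blast
qed

text \<open>Binomial expansion of the power of m (x) C + B (x) n. A factor from the first summand
  raises p - d by one if d \<le> p, and a factor from the second raises d.\<close>

lemma rp_eq: "rp p = tsums (filtered_pairs p)"
proof
  show "tsums (filtered_pairs p) \<subseteq> rp p"
  proof
    fix x assume "x \<in> tsums (filtered_pairs p)"
    then obtain zs where "set zs \<subseteq> filtered_pairs p" "x = tsum zs" by (rule tensor_sumsE)
    then show "x \<in> rp p" unfolding tensor_sum_def
      by (simp only:, intro A.list_sum_in_subgroup ideal.axioms(1)[OF rp_ideal])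
        (auto dest: tau_filtered_in_rp)
  qed
  show "rp p \<subseteq> tsums (filtered_pairs p)"
  proof (induction p)
    case 0
    have "BC \<subseteq> filtered_pairs 0" unfolding filtered_pairs_def by (auto intro!: exI[of _ 0])
    from subset_trans[OF tau_generates tensor_sums_mono[OF this]] show ?case by simp
  next
    case (Suc p)
    show ?case
    proof
      fix x assume "x \<in> rp (Suc p)"
      then have "x \<in> ideal_prod A (rp p) r" by simp
      then show "x \<in> tsums (filtered_pairs (Suc p))"
      proof (induction rule: ideal_prod.induct)
        case (prod u v)
        show ?case
        proof (rule tsums_mult[OF filtered_pairs_subset _ filtered_pairs_subset])
          show "u \<in> tsums (filtered_pairs p)" using prod Suc by blast
          show "v \<in> tsums (m \<times> carrier C \<union> carrier B \<times> n)" using prod r_eq by simp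
          show "m \<times> carrier C \<union> carrier B \<times> n \<subseteq> BC"
            using ideal.Icarr[OF ideal_m] ideal.Icarr[OF ideal_n] by auto
        next
          fix b c b' c'
          assume "(b, c) \<in> filtered_pairs p" and b': "(b', c') \<in> m \<times> carrier C \<union> carrier B \<times> n"
          then obtain d where d: "b \<in> mp (p - d)" "c \<in> np d" unfolding filtered_pairs_def by blast
          have cc: "b \<in> carrier B" "c \<in> carrier C" using ideal.Icarr[OF mp_ideal d(1)] ideal.Icarr[OF np_ideal d(2)] .
          from b' show "(b \<otimes>\<^bsub>B\<^esub> b', c \<otimes>\<^bsub>C\<^esub> c') \<in> filtered_pairs (Suc p)"
          proof
            assume h: "(b', c') \<in> m \<times> carrier C"
            have "b \<otimes>\<^bsub>B\<^esub> b' \<in> mp (Suc p - d)"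
            proof (cases "d \<le> p")
              case True
              then show ?thesis using d(1) h by (simp add: Suc_diff_le ideal_prod.prod)
            next
              case False
              then show ?thesis using cc h ideal.Icarr[OF ideal_m] by simp
            qed
            moreover have "c \<otimes>\<^bsub>C\<^esub> c' \<in> np d" using ideal.I_r_closed[OF np_ideal d(2)] h by auto
            ultimately show ?thesis unfolding filtered_pairs_def by blast
          next
            assume h: "(b', c') \<in> carrier B \<times> n"
            have "b \<otimes>\<^bsub>B\<^esub> b' \<in> mp (Suc p - Suc d)" using ideal.I_r_closed[OF mp_ideal d(1)] h by auto
            moreover have "c \<otimes>\<^bsub>C\<^esub> c' \<in> np (Suc d)" using d(2) h by (simp add: ideal_prod.prod)
            ultimately show ?thesis unfolding filtered_pairs_def by blast
          qed
        qed
      next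
        case (sum u v)
        then show ?case using tsums_add[OF filtered_pairs_subset] by blast
      qed
    qed
  qed
qed

section \<open>Contraction along the right factor and approximation of colons\<close>

lemma smult_in_ideal:
  assumes "ideal I B" "b \<in> I" "a \<in> carrier k"
  shows "a \<odot>\<^bsub>B\<^esub> b \<in> I"
proof -
  have b: "b \<in> carrier B" using ideal.Icarr[OF assms(1,2)] .
  have "a \<odot>\<^bsub>B\<^esub> b = (a \<odot>\<^bsub>B\<^esub> \<one>\<^bsub>B\<^esub>) \<otimes>\<^bsub>B\<^esub> b" using b assms(3) by (simp add: B.smult_assoc2)
  then show ?thesis using ideal.I_l_closed[OF assms(1,2)] assms(3) by simp
qed

text \<open>This is id (x) \<phi> on lists of pairs. As \<phi> is an arbitrary function, the value
  depends on the list and not only on the tensor it represents; \<open>tensor_sum_zero\<close>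
  controls this for suitable \<phi>.\<close>

definition contract :: "('c \<Rightarrow> 'k) \<Rightarrow> ('b \<times> 'c) list \<Rightarrow> 'b" where
  "contract \<phi> zs = list_sum B (map (\<lambda>(b, c). \<phi> c \<odot>\<^bsub>B\<^esub> b) zs)"

lemma contract_simps [simp]:
  "contract \<phi> [] = \<zero>\<^bsub>B\<^esub>" "contract \<phi> ((b, c) # zs) = \<phi> c \<odot>\<^bsub>B\<^esub> b \<oplus>\<^bsub>B\<^esub> contract \<phi> zs"
  by (simp_all add: contract_def)

lemma contract_closed:
  "set zs \<subseteq> BC \<Longrightarrow> (\<And>c. \<phi> c \<in> carrier k) \<Longrightarrow> contract \<phi> zs \<in> carrier B"
  by (induction zs) auto

lemma contract_in_ideal:
  assumes "ideal I B" "\<And>b c. (b, c) \<in> set zs \<Longrightarrow> \<phi> c \<odot>\<^bsub>B\<^esub> b \<in> I"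
  shows "contract \<phi> zs \<in> I"
  unfolding contract_def using assms by (intro B.list_sum_in_subgroup ideal.axioms(1)) auto

lemma contract_append:
  "set zs \<subseteq> BC \<Longrightarrow> set ws \<subseteq> BC \<Longrightarrow> (\<And>c. \<phi> c \<in> carrier k) \<Longrightarrow>
   contract \<phi> (zs @ ws) = contract \<phi> zs \<oplus>\<^bsub>B\<^esub> contract \<phi> ws"
  by (induction zs) (auto simp: contract_closed B.a_assoc)

lemma contract_minus:
  "set zs \<subseteq> BC \<Longrightarrow> (\<And>c. \<phi> c \<in> carrier k) \<Longrightarrow>
   contract \<phi> (map (\<lambda>(b, c). (\<ominus>\<^bsub>B\<^esub> b, c)) zs) = \<ominus>\<^bsub>B\<^esub> contract \<phi> zs"
  by (induction zs) (auto simp: contract_closed B.minus_add B.smult_r_minus)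

lemma contract_mult:
  assumes a: "a \<in> carrier B"
  shows "set zs \<subseteq> BC \<Longrightarrow> (\<And>c. \<phi> c \<in> carrier k) \<Longrightarrow>
   contract \<phi> (map (\<lambda>(b, c). (a \<otimes>\<^bsub>B\<^esub> b, c)) zs) = a \<otimes>\<^bsub>B\<^esub> contract \<phi> zs"
proof (induction zs)
  case (Cons z zs)
  obtain b c where z: "z = (b, c)" by force
  have "\<phi> c \<odot>\<^bsub>B\<^esub> (a \<otimes>\<^bsub>B\<^esub> b) = a \<otimes>\<^bsub>B\<^esub> (\<phi> c \<odot>\<^bsub>B\<^esub> b)"
    using Cons.prems a z B.smult_assoc2[of "\<phi> c" b a] by (simp add: B.m_comm)
  then show ?case using Cons a z by (simp add: contract_closed B.r_distr)
qed (use a in simp)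

text \<open>Scalars move from the right factor to the left, and the list collapses to a single
  tensor with right factor y.\<close>

lemma tau_contract:
  "set zs \<subseteq> BC \<Longrightarrow> (\<And>c. \<phi> c \<in> carrier k) \<Longrightarrow> y \<in> carrier C \<Longrightarrow>
   tsum (map (\<lambda>(b, c). (b, \<phi> c \<odot>\<^bsub>C\<^esub> y)) zs) = \<tau> (contract \<phi> zs) y"
  by (induction zs) (auto simp: contract_closed tau_add_left tau_smult[symmetric] tau_zero_left)

lemma tsum_map_add:
  "set zs \<subseteq> BC \<Longrightarrow> (\<And>c. f c \<in> carrier C) \<Longrightarrow> (\<And>c. g c \<in> carrier C) \<Longrightarrow>
   tsum (map (\<lambda>(b, c). (b, f c \<oplus>\<^bsub>C\<^esub> g c)) zs) = tsum (map (\<lambda>(b, c). (b, f c)) zs) \<oplus>\<^bsub>A\<^esub> tsum (map (\<lambda>(b, c). (b, g c)) zs)"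
proof (induction zs)
  case (Cons z zs)
  obtain b c where z: "z = (b, c)" by force
  have "tsum (map (\<lambda>(b, c). (b, f c)) zs) \<in> carrier A" "tsum (map (\<lambda>(b, c). (b, g c)) zs) \<in> carrier A"
    using Cons.prems by (auto intro!: tsum_closed)
  then show ?case using Cons z by (simp add: tau_add_right tau_closed A.a_ac)
qed simp

lemma tsum_map_zero:
  "set zs \<subseteq> BC \<Longrightarrow> tsum (map (\<lambda>(b, c). (b, \<zero>\<^bsub>C\<^esub>)) zs) = \<zero>\<^bsub>A\<^esub>"
  by (induction zs) (auto simp: tau_zero_right)

sublocale C: vector_space_over k C
  by unfold_locales

text \<open>Rewrite u as a sum of \<beta> (x) y with y in n^d and \<beta> in m^(p-d) such that a
  \<beta> lies in I + m^(N-d) for each term separately. Then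
  \<open>shifted_colon_approximation\<close> in B treats every \<beta>; its bounds are uniform in d,
  so one p and one N serve all terms.\<close>

lemma tensor_colon_approximation:
  assumes I: "ideal I B" and a: "a \<in> carrier B"
  defines "J \<equiv> colon_ideal B I a"
  shows "\<exists>p\<ge>q. (q = 0 \<longrightarrow> p = 0) \<and> (\<forall>N'. \<exists>N. \<forall>u\<in>rp p.
    \<tau> a \<one>\<^bsub>C\<^esub> \<otimes>\<^bsub>A\<^esub> u \<in> tsums (I \<times> carrier C \<union> filtered_pairs N) \<longrightarrow>
    u \<in> tsums ({(b, c). \<exists>d. b \<in> ideal_prod B (mp (q - d)) J \<and> c \<in> np d} \<union> filtered_pairs N'))"
proof -
  define JF where "JF = {(b, c). \<exists>d. b \<in> ideal_prod B (mp (q - d)) J \<and> c \<in> np d}"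
  have J: "ideal J B" unfolding J_def using B.ideal_colon_ideal[OF I a] .
  have JFc: "JF \<subseteq> BC" unfolding JF_def
    using B.ideal_prod_in_carrier[OF mp_ideal J] ideal.Icarr[OF np_ideal] by blast
  obtain p where p: "p \<ge> q" "q = 0 \<longrightarrow> p = 0" and approx: "\<And>N'. \<exists>N. \<forall>d. \<forall>\<beta>\<in>mp (p - d).
      a \<otimes>\<^bsub>B\<^esub> \<beta> \<in> I <+>\<^bsub>B\<^esub> mp (N - d) \<longrightarrow> \<beta> \<in> ideal_prod B (mp (q - d)) J <+>\<^bsub>B\<^esub> mp (N' - d)"
    using B.shifted_colon_approximation[OF ideal_m I a, of q] unfolding J_def by blast
  have "\<exists>N. \<forall>u\<in>rp p. \<tau> a \<one>\<^bsub>C\<^esub> \<otimes>\<^bsub>A\<^esub> u \<in> tsums (I \<times> carrier C \<union> filtered_pairs N) \<longrightarrow>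
    u \<in> tsums (JF \<union> filtered_pairs N')" for N'
  proof -
    obtain N where N: "\<And>d \<beta>. \<beta> \<in> mp (p - d) \<Longrightarrow> a \<otimes>\<^bsub>B\<^esub> \<beta> \<in> I <+>\<^bsub>B\<^esub> mp (N - d) \<Longrightarrow>
      \<beta> \<in> ideal_prod B (mp (q - d)) J <+>\<^bsub>B\<^esub> mp (N' - d)" using approx[of N'] by blast
    have Tc: "JF \<union> filtered_pairs N' \<subseteq> BC" using JFc filtered_pairs_subset by blast
    show ?thesis
    proof (intro exI[of _ N] ballI impI)
      fix u assume u: "u \<in> rp p" and au: "\<tau> a \<one>\<^bsub>C\<^esub> \<otimes>\<^bsub>A\<^esub> u \<in> tsums (I \<times> carrier C \<union> filtered_pairs N)"
      obtain zs where zs: "set zs \<subseteq> filtered_pairs p" "u = tsum zs"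
        using u unfolding rp_eq by (rule tensor_sumsE)
      obtain ws where ws: "set ws \<subseteq> I \<times> carrier C \<union> filtered_pairs N" "\<tau> a \<one>\<^bsub>C\<^esub> \<otimes>\<^bsub>A\<^esub> u = tsum ws"
        using au by (rule tensor_sumsE)
      have zsc: "set zs \<subseteq> BC" using zs filtered_pairs_subset by blast
      have wsc: "set ws \<subseteq> BC"
        using ws(1) filtered_pairs_subset[of N] ideal.Icarr[OF I] by blast
      define azs where "azs = map (\<lambda>(b, c). (a \<otimes>\<^bsub>B\<^esub> b, c)) zs"
      define nws where "nws = map (\<lambda>(b, c). (\<ominus>\<^bsub>B\<^esub> b, c)) ws"
      have azsc: "set azs \<subseteq> BC" unfolding azs_def using zsc a by auto
      have nwsc: "set nws \<subseteq> BC" unfolding nws_def using wsc by auto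
      have "map (\<lambda>(b', c'). (a \<otimes>\<^bsub>B\<^esub> b', \<one>\<^bsub>C\<^esub> \<otimes>\<^bsub>C\<^esub> c')) zs = azs"
        unfolding azs_def using zsc by (intro map_cong) auto
      then have "tsum azs = tsum ws"
        using tsum_mult[OF zsc a, of "\<one>\<^bsub>C\<^esub>"] ws(2) zs(2) by simp
      \<comment> \<open>The difference of two expressions for a u is a vanishing sum of tensors, and
        D is the reason for it among elements of C.\<close>
      then have "tsum (azs @ nws) = \<zero>\<^bsub>A\<^esub>"
        using tsum_append[OF azsc nwsc] tsum_minus[OF wsc] tsum_closed[OF wsc]
        unfolding nws_def by (simp add: A.r_neg)
      then obtain D where D: "valid_rels k C D"
        and kill: "\<And>\<phi>. \<phi> \<in> rel_functions k D \<Longrightarrow> contract \<phi> (azs @ nws) = \<zero>\<^bsub>B\<^esub>"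
        using tensor_sum_zero[of "azs @ nws"] azsc nwsc unfolding contract_def by auto
      \<comment> \<open>T bounds both exponents p and N, so that the estimate \<open>vanish\<close>
        covers the terms of u and those of a u. The cutoff is needed for the maximum: c may lie in
        all powers of n.\<close>
      define T where "T = N + p"
      define w where "w = (\<lambda>c. Max {d. d \<le> T \<and> c \<in> np d})"
      have fin: "finite {d. d \<le> T \<and> c \<in> np d}" for c by simp
      have w: "w c \<le> T \<and> c \<in> np (w c)" if "c \<in> carrier C" for c
      proof -
        have "0 \<in> {d. d \<le> T \<and> c \<in> np d}" using that by simp
        then show ?thesis using Max_in[OF fin[of c]] unfolding w_def by blast
      qed
      have w_ge: "d \<le> w c" if "d \<le> T" "c \<in> np d" for c d
        unfolding w_def using that by (intro Max_ge[OF fin]) simp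
      \<comment> \<open>If \<phi> c is nonzero then w c \<le> d, while w c is at least the degree d0
        of c, up to the cutoff. So b, which lies in m^(P-d0), lies in m^(P-d).\<close>
      have vanish: "\<phi> c \<odot>\<^bsub>B\<^esub> b \<in> mp (P - d)"
        if bc: "(b, c) \<in> filtered_pairs P" and P: "P \<le> T" and \<phi>: "\<And>c. \<phi> c \<in> carrier k"
          "\<And>c. d < w c \<Longrightarrow> \<phi> c = \<zero>\<^bsub>k\<^esub>" for b c P d \<phi>
      proof -
        obtain d0 where d0: "b \<in> mp (P - d0)" "c \<in> np d0" using bc unfolding filtered_pairs_def by blast
        have bcar: "b \<in> carrier B" using ideal.Icarr[OF mp_ideal d0(1)] .
        show ?thesis
        proof (cases "d < w c")
          case True
          then show ?thesis using \<phi>(2) bcar additive_subgroup.zero_closed[OF ideal.axioms(1)[OF mp_ideal]] by simp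
        next
          case False
          have "min d0 T \<le> w c"
            using w_ge[of "min d0 T" c] C.ideal_power_antimono[OF ideal_n, of "min d0 T" d0] d0(2) by auto
          then have "P - d \<le> P - d0" using False P by auto
          then have "b \<in> mp (P - d)" using B.ideal_power_antimono[OF ideal_m] d0(1) by blast
          then show ?thesis using smult_in_ideal[OF mp_ideal] \<phi>(1) by blast
        qed
      qed
      have "finite (snd ` set zs)" "snd ` set zs \<subseteq> carrier C" using zsc by auto
      from C.weighted_factorization[OF _ w D this] ideal.Icarr[OF np_ideal]
      obtain g where g: "g \<in> fun_span C (weighted_pairs k np w T D)" "\<And>x. x \<in> snd ` set zs \<Longrightarrow> g x = x"
        by blast
      have "tsum (map (\<lambda>(b, c). (b, g c)) zs) \<in> tsums (JF \<union> filtered_pairs N')"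
        using g(1)
      proof (induction rule: fun_span.induct)
        case zero
        then show ?case using tsum_map_zero[OF zsc] by (simp add: tensor_sums_zero)
      next
        case (step \<phi> y g)
        obtain d where \<phi>: "\<phi> \<in> rel_functions k D" and d: "d \<le> T" "y \<in> np d" "\<And>c. d < w c \<Longrightarrow> \<phi> c = \<zero>\<^bsub>k\<^esub>"
          using step(1) unfolding weighted_pairs_def by blast
        have \<phi>c: "\<And>c. \<phi> c \<in> carrier k" using \<phi> by (simp add: rel_functions_def)
        have yc: "y \<in> carrier C" using ideal.Icarr[OF np_ideal d(2)] .
        have gc: "g c \<in> carrier C" for c
        proof (rule C.fun_span_closed[OF step(2)])
          show "weighted_pairs k np w T D \<subseteq> (UNIV \<rightarrow> carrier k) \<times> carrier C"
            unfolding weighted_pairs_def rel_functions_def using ideal.Icarr[OF np_ideal] by auto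
        qed
        \<comment> \<open>\<beta> is the left factor that accompanies y when every right entry c is
          replaced by its combination of elements y.\<close>
        define \<beta> where "\<beta> = contract \<phi> zs"
        have \<beta>: "\<beta> \<in> mp (p - d)" unfolding \<beta>_def
        proof (rule contract_in_ideal[OF mp_ideal])
          fix b c assume "(b, c) \<in> set zs"
          then have "(b, c) \<in> filtered_pairs p" using zs(1) by blast
          then show "\<phi> c \<odot>\<^bsub>B\<^esub> b \<in> mp (p - d)"
            by (rule vanish) (use \<phi>c d(3) in \<open>auto simp: T_def\<close>)
        qed
        have \<beta>c: "\<beta> \<in> carrier B" using ideal.Icarr[OF mp_ideal \<beta>] .
        \<comment> \<open>Contraction with \<phi> kills the vanishing sum, which turns the relation
          for a u into one for a \<beta> in B.\<close>
        have "a \<otimes>\<^bsub>B\<^esub> \<beta> \<oplus>\<^bsub>B\<^esub> (\<ominus>\<^bsub>B\<^esub> contract \<phi> ws) = \<zero>\<^bsub>B\<^esub>"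
          using kill[OF \<phi>] contract_append[OF azsc nwsc \<phi>c] contract_mult[OF a zsc \<phi>c] contract_minus[OF wsc \<phi>c]
          unfolding azs_def nws_def \<beta>_def by simp
        then have "a \<otimes>\<^bsub>B\<^esub> \<beta> = contract \<phi> ws"
          using contract_closed[OF wsc \<phi>c] a \<beta>c by (simp add: B.r_right_minus_eq a_minus_def[symmetric])
        moreover have "contract \<phi> ws \<in> I <+>\<^bsub>B\<^esub> mp (N - d)"
        proof (rule contract_in_ideal[OF B.add_ideals[OF I mp_ideal]])
          fix b c assume "(b, c) \<in> set ws"
          then consider "b \<in> I" | "(b, c) \<in> filtered_pairs N" using ws(1) by blast
          then show "\<phi> c \<odot>\<^bsub>B\<^esub> b \<in> I <+>\<^bsub>B\<^esub> mp (N - d)"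
          proof cases
            case 1
            then show ?thesis using smult_in_ideal[OF I] \<phi>c B.set_add_subset_left[OF I mp_ideal] by blast
          next
            case 2
            then have "\<phi> c \<odot>\<^bsub>B\<^esub> b \<in> mp (N - d)"
              by (rule vanish) (use \<phi>c d(3) in \<open>auto simp: T_def\<close>)
            then show ?thesis using B.set_add_subset_right[OF I mp_ideal] by blast
          qed
        qed
        ultimately obtain j \<mu> where j: "j \<in> ideal_prod B (mp (q - d)) J" and \<mu>: "\<mu> \<in> mp (N' - d)"
          and \<beta>e: "\<beta> = j \<oplus>\<^bsub>B\<^esub> \<mu>" using N[OF \<beta>] unfolding B.set_add_ideal_iff by metis
        have jc: "j \<in> carrier B" "\<mu> \<in> carrier B"
          using B.ideal_prod_in_carrier[OF mp_ideal J] j ideal.Icarr[OF mp_ideal \<mu>] by auto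
        have "\<tau> j y \<in> tsums (JF \<union> filtered_pairs N')"
          using j d(2) by (intro tsums_single[OF _ Tc]) (auto simp: JF_def)
        moreover have "\<tau> \<mu> y \<in> tsums (JF \<union> filtered_pairs N')"
          using \<mu> d(2) by (intro tsums_single[OF _ Tc]) (auto simp: filtered_pairs_def)
        moreover have "tsum (map (\<lambda>(b, c). (b, \<phi> c \<odot>\<^bsub>C\<^esub> y)) zs) = \<tau> j y \<oplus>\<^bsub>A\<^esub> \<tau> \<mu> y"
          using tau_contract[OF zsc \<phi>c yc] tau_add_left[OF jc yc] \<beta>e unfolding \<beta>_def by simp
        ultimately show ?case
          using tsum_map_add[OF zsc, of "\<lambda>c. \<phi> c \<odot>\<^bsub>C\<^esub> y" g] step.IH tsums_add[OF Tc] \<phi>c yc gc by simp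
      qed
      \<comment> \<open>g fixes the right entries of u, so the rewritten sum is u itself.\<close>
      moreover have "map (\<lambda>(b, c). (b, g c)) zs = zs"
        using g(2) by (intro map_idI) force
      ultimately show "u \<in> tsums (JF \<union> filtered_pairs N')" using zs(2) by simp
    qed
  qed
  then show ?thesis using p unfolding JF_def by blast
qed

end

section \<open>Adic completions\<close>

locale adic_ring = cring A for A (structure) +
  fixes r :: "'a set"
  assumes ideal_r: "ideal r A"
begin

abbreviation "rp i \<equiv> ideal_power A r i"
abbreviation "Ac \<equiv> adic_completion A r"

definition coherent :: "(nat \<Rightarrow> 'a) \<Rightarrow> bool" where
  "coherent u \<longleftrightarrow> (\<forall>i. u i \<in> carrier A) \<and> (\<forall>i. u (Suc i) \<ominus> u i \<in> rp i)"

definition cosets :: "(nat \<Rightarrow> 'a) \<Rightarrow> nat \<Rightarrow> 'a set" where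
  "cosets u = (\<lambda>i. rp i +> u i)"

text \<open>The kernel of the projection to A / r^i. It is used instead of r^i times the completion,
  from which it may differ when r is not finitely generated.\<close>

definition fil :: "nat \<Rightarrow> (nat \<Rightarrow> 'a set) set" where
  "fil i = {x \<in> carrier Ac. x i = rp i}"

lemma rp_ideal: "ideal (rp i) A" by (rule ideal_ideal_power[OF ideal_r])

lemma rp_closed:
  "x \<in> rp i \<Longrightarrow> y \<in> rp i \<Longrightarrow> x \<oplus> y \<in> rp i" "x \<in> rp i \<Longrightarrow> \<ominus> x \<in> rp i" "\<zero> \<in> rp i"
  "x \<in> rp i \<Longrightarrow> x \<in> carrier A" "x \<in> rp i \<Longrightarrow> a \<in> carrier A \<Longrightarrow> a \<otimes> x \<in> rp i"
  "x \<in> rp i \<Longrightarrow> a \<in> carrier A \<Longrightarrow> x \<otimes> a \<in> rp i"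
proof -
  interpret I: ideal "rp i" A by (rule rp_ideal)
  show "x \<in> rp i \<Longrightarrow> y \<in> rp i \<Longrightarrow> x \<oplus> y \<in> rp i" "x \<in> rp i \<Longrightarrow> \<ominus> x \<in> rp i" "\<zero> \<in> rp i"
    "x \<in> rp i \<Longrightarrow> x \<in> carrier A" "x \<in> rp i \<Longrightarrow> a \<in> carrier A \<Longrightarrow> a \<otimes> x \<in> rp i"
    "x \<in> rp i \<Longrightarrow> a \<in> carrier A \<Longrightarrow> x \<otimes> a \<in> rp i"
    by (auto simp: I.I_l_closed I.I_r_closed)
qed

lemma rp_antimono: "i \<le> j \<Longrightarrow> x \<in> rp j \<Longrightarrow> x \<in> rp i"
  using ideal_power_antimono[OF ideal_r] by blast

lemma diff_self_in_rp: "a \<in> carrier A \<Longrightarrow> a \<ominus> a \<in> rp i"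
  using rp_closed(3)[of i] by (simp add: a_minus_def r_neg)

lemma coherentD: "coherent u \<Longrightarrow> u i \<in> carrier A" "coherent u \<Longrightarrow> u (Suc i) \<ominus> u i \<in> rp i"
  by (auto simp: coherent_def)

lemma coset_eq_iff: "a \<in> carrier A \<Longrightarrow> b \<in> carrier A \<Longrightarrow> rp i +> a = rp i +> b \<longleftrightarrow> a \<ominus> b \<in> rp i"
  using quotient_eq_iff_same_a_r_cos[OF rp_ideal] by simp

lemma coset_zero: "rp i +> \<zero> = rp i"
  using a_rcos_zero[OF rp_ideal rp_closed(3)] .

lemma coset_eq_zero_iff: "a \<in> carrier A \<Longrightarrow> rp i +> a = rp i \<longleftrightarrow> a \<in> rp i"
  using coset_eq_iff[of a \<zero> i] coset_zero by (simp add: a_minus_def)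

lemma mem_coset_iff:
  assumes "a \<in> carrier A" "b \<in> carrier A"
  shows "b \<in> rp i +> a \<longleftrightarrow> b \<ominus> a \<in> rp i"
proof
  assume "b \<in> rp i +> a"
  then obtain x where "x \<in> rp i" "b = x \<oplus> a" by (auto simp: a_r_coset_def r_coset_def)
  then show "b \<ominus> a \<in> rp i" using assms rp_closed(4)[of x i] by (simp add: a_minus_def a_assoc r_neg)
next
  assume "b \<ominus> a \<in> rp i"
  moreover have "b = (b \<ominus> a) \<oplus> a" using assms by (simp add: a_minus_def a_assoc l_neg)
  ultimately show "b \<in> rp i +> a" by (auto simp: a_r_coset_def r_coset_def)
qed

text \<open>Lets calculations in the inverse limit be done on sequences of representatives, where
  the operations are pointwise.\<close>

lemma completion_carrier: "x \<in> carrier Ac \<longleftrightarrow> (\<exists>u. coherent u \<and> x = cosets u)"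
proof
  assume "\<exists>u. coherent u \<and> x = cosets u"
  then obtain u where u: "coherent u" "x = cosets u" by blast
  have "rp (Suc i) +> u (Suc i) \<subseteq> rp i +> u i" for i
  proof -
    have "rp i +> u (Suc i) = rp i +> u i"
      using coset_eq_iff coherentD[OF u(1)] by blast
    moreover have "rp (Suc i) +> u (Suc i) \<subseteq> rp i +> u (Suc i)"
      using rp_antimono[of i "Suc i"] by (auto simp: a_r_coset_def r_coset_def)
    ultimately show ?thesis by simp
  qed
  moreover have "rp i +> u i \<in> a_rcosets (rp i)" for i
    using a_rcosetsI[of "rp i" "u i"] coherentD(1)[OF u(1)] rp_closed(4) by blast
  ultimately show "x \<in> carrier Ac"
    unfolding u(2) by (simp add: adic_completion_def FactRing_def cosets_def)
next
  assume x: "x \<in> carrier Ac"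
  then have "\<forall>i. \<exists>a\<in>carrier A. x i = rp i +> a"
    by (auto simp: adic_completion_def FactRing_def A_RCOSETS_def RCOSETS_def a_r_coset_def)
  then obtain u where u: "\<And>i. u i \<in> carrier A" "\<And>i. x i = rp i +> u i" by metis
  have "u (Suc i) \<ominus> u i \<in> rp i" for i
  proof -
    have "u (Suc i) \<in> x (Suc i)"
      unfolding u(2) using mem_coset_iff[OF u(1) u(1)] diff_self_in_rp[OF u(1)] by blast
    moreover have "x (Suc i) \<subseteq> x i" using x by (simp add: adic_completion_def)
    ultimately have "u (Suc i) \<in> rp i +> u i" using u(2) by auto
    then show ?thesis using mem_coset_iff u(1) by blast
  qed
  then show "\<exists>u. coherent u \<and> x = cosets u"
    using u by (intro exI[of _ u]) (auto simp: coherent_def cosets_def)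
qed

lemma coherent_const: "a \<in> carrier A \<Longrightarrow> coherent (\<lambda>_. a)"
  by (simp add: coherent_def rp_closed(3) a_minus_def r_neg)

lemma coherent_add:
  assumes "coherent u" "coherent v"
  shows "coherent (\<lambda>i. u i \<oplus> v i)"
proof -
  have "(u (Suc i) \<oplus> v (Suc i)) \<ominus> (u i \<oplus> v i) = (u (Suc i) \<ominus> u i) \<oplus> (v (Suc i) \<ominus> v i)" for i
    using coherentD(1)[OF assms(1), of i] coherentD(1)[OF assms(1), of "Suc i"]
      coherentD(1)[OF assms(2), of i] coherentD(1)[OF assms(2), of "Suc i"] by algebra
  then show ?thesis using assms rp_closed(1) by (simp add: coherent_def)
qed

lemma coherent_mult:
  assumes "coherent u" "coherent v"
  shows "coherent (\<lambda>i. u i \<otimes> v i)"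
proof -
  have "(u (Suc i) \<otimes> v (Suc i)) \<ominus> (u i \<otimes> v i) = (u (Suc i) \<ominus> u i) \<otimes> v (Suc i) \<oplus> u i \<otimes> (v (Suc i) \<ominus> v i)" for i
    using coherentD(1)[OF assms(1), of i] coherentD(1)[OF assms(1), of "Suc i"]
      coherentD(1)[OF assms(2), of i] coherentD(1)[OF assms(2), of "Suc i"] by algebra
  then show ?thesis using assms rp_closed by (simp add: coherent_def)
qed

lemma coherent_minus:
  assumes "coherent u"
  shows "coherent (\<lambda>i. \<ominus> u i)"
proof -
  have "(\<ominus> u (Suc i)) \<ominus> (\<ominus> u i) = \<ominus> (u (Suc i) \<ominus> u i)" for i
    using coherentD(1)[OF assms(1), of i] coherentD(1)[OF assms(1), of "Suc i"] by algebra
  then show ?thesis using assms rp_closed(2) by (simp add: coherent_def)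
qed

lemma cosets_add:
  "coherent u \<Longrightarrow> coherent v \<Longrightarrow> cosets u \<oplus>\<^bsub>Ac\<^esub> cosets v = cosets (\<lambda>i. u i \<oplus> v i)"
  using ideal.a_rcos_sum[OF rp_ideal]
  by (simp add: adic_completion_def cosets_def FactRing_def coherent_def)

lemma cosets_mult:
  "coherent u \<Longrightarrow> coherent v \<Longrightarrow> cosets u \<otimes>\<^bsub>Ac\<^esub> cosets v = cosets (\<lambda>i. u i \<otimes> v i)"
  using ideal.rcoset_mult_add[OF rp_ideal]
  by (simp add: adic_completion_def cosets_def FactRing_def coherent_def)

lemma cosets_zero: "\<zero>\<^bsub>Ac\<^esub> = cosets (\<lambda>_. \<zero>)"
  by (simp add: adic_completion_def cosets_def FactRing_def coset_zero)

lemma cosets_one: "\<one>\<^bsub>Ac\<^esub> = cosets (\<lambda>_. \<one>)"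
  by (simp add: adic_completion_def cosets_def FactRing_def)

lemma completionE:
  assumes "x \<in> carrier Ac" obtains u where "coherent u" "x = cosets u" "\<forall>i. u i \<in> carrier A"
  using assms coherentD(1) by (auto simp: completion_carrier)

lemma cosets_carrier: "coherent u \<Longrightarrow> cosets u \<in> carrier Ac"
  by (auto simp: completion_carrier)

lemma completion_cring: "cring Ac"
proof (rule cringI)
  note [simp] = cosets_add cosets_mult cosets_zero cosets_one coherent_const coherent_add
    coherent_mult coherent_minus cosets_carrier
  show "abelian_group Ac"
  proof (rule abelian_groupI)
    fix x y z assume x: "x \<in> carrier Ac" and y: "y \<in> carrier Ac" and z: "z \<in> carrier Ac"
    obtain u v w where u: "coherent u" "x = cosets u" "\<forall>i. u i \<in> carrier A"
      and v: "coherent v" "y = cosets v" "\<forall>i. v i \<in> carrier A"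
      and w: "coherent w" "z = cosets w" "\<forall>i. w i \<in> carrier A"
      using x y z by (meson completionE)
    show "x \<oplus>\<^bsub>Ac\<^esub> y \<in> carrier Ac" "x \<oplus>\<^bsub>Ac\<^esub> y \<oplus>\<^bsub>Ac\<^esub> z = x \<oplus>\<^bsub>Ac\<^esub> (y \<oplus>\<^bsub>Ac\<^esub> z)" "x \<oplus>\<^bsub>Ac\<^esub> y = y \<oplus>\<^bsub>Ac\<^esub> x"
      using u v w by (simp_all add: a_ac)
  next
    fix x assume "x \<in> carrier Ac"
    then obtain u where u: "coherent u" "x = cosets u" "\<forall>i. u i \<in> carrier A" by (rule completionE)
    show "\<zero>\<^bsub>Ac\<^esub> \<oplus>\<^bsub>Ac\<^esub> x = x" using u by simp
    show "\<exists>y\<in>carrier Ac. y \<oplus>\<^bsub>Ac\<^esub> x = \<zero>\<^bsub>Ac\<^esub>"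
      using u by (intro bexI[of _ "cosets (\<lambda>i. \<ominus> u i)"]) (simp_all add: l_neg)
  qed simp
  show "comm_monoid Ac"
  proof (rule comm_monoidI)
    fix x y z assume x: "x \<in> carrier Ac" and y: "y \<in> carrier Ac" and z: "z \<in> carrier Ac"
    obtain u v w where u: "coherent u" "x = cosets u" "\<forall>i. u i \<in> carrier A"
      and v: "coherent v" "y = cosets v" "\<forall>i. v i \<in> carrier A"
      and w: "coherent w" "z = cosets w" "\<forall>i. w i \<in> carrier A"
      using x y z by (meson completionE)
    show "x \<otimes>\<^bsub>Ac\<^esub> y \<in> carrier Ac" "x \<otimes>\<^bsub>Ac\<^esub> y \<otimes>\<^bsub>Ac\<^esub> z = x \<otimes>\<^bsub>Ac\<^esub> (y \<otimes>\<^bsub>Ac\<^esub> z)" "x \<otimes>\<^bsub>Ac\<^esub> y = y \<otimes>\<^bsub>Ac\<^esub> x"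
      using u v w by (simp_all add: m_ac)
  next
    fix x assume "x \<in> carrier Ac"
    then obtain u where u: "coherent u" "x = cosets u" "\<forall>i. u i \<in> carrier A" by (rule completionE)
    show "\<one>\<^bsub>Ac\<^esub> \<otimes>\<^bsub>Ac\<^esub> x = x" using u by simp
  qed simp
  fix x y z assume x: "x \<in> carrier Ac" and y: "y \<in> carrier Ac" and z: "z \<in> carrier Ac"
  obtain u v w where u: "coherent u" "x = cosets u" "\<forall>i. u i \<in> carrier A"
    and v: "coherent v" "y = cosets v" "\<forall>i. v i \<in> carrier A"
    and w: "coherent w" "z = cosets w" "\<forall>i. w i \<in> carrier A"
    using x y z by (meson completionE)
  show "(x \<oplus>\<^bsub>Ac\<^esub> y) \<otimes>\<^bsub>Ac\<^esub> z = x \<otimes>\<^bsub>Ac\<^esub> z \<oplus>\<^bsub>Ac\<^esub> y \<otimes>\<^bsub>Ac\<^esub> z"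
    using u v w by (simp add: l_distr)
qed

sublocale Ac: cring Ac by (rule completion_cring)

lemma cosets_minus:
  assumes "coherent u"
  shows "\<ominus>\<^bsub>Ac\<^esub> cosets u = cosets (\<lambda>i. \<ominus> u i)"
proof (rule Ac.minus_equality)
  show "cosets (\<lambda>i. \<ominus> u i) \<oplus>\<^bsub>Ac\<^esub> cosets u = \<zero>\<^bsub>Ac\<^esub>"
    using assms by (simp add: cosets_add coherent_minus cosets_zero l_neg coherentD(1))
qed (use assms in \<open>simp_all add: cosets_carrier coherent_minus\<close>)

lemma cosets_diff:
  "coherent u \<Longrightarrow> coherent v \<Longrightarrow> cosets u \<ominus>\<^bsub>Ac\<^esub> cosets v = cosets (\<lambda>i. u i \<ominus> v i)"
  by (simp add: a_minus_def cosets_minus cosets_add coherent_minus)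

lemma completion_map_eq: "completion_map A r a = cosets (\<lambda>_. a)"
  by (simp add: completion_map_def cosets_def)

lemma completion_map_hom: "completion_map A r \<in> ring_hom A Ac"
  by (rule ring_hom_memI)
    (simp_all add: completion_map_eq cosets_carrier coherent_const cosets_add cosets_mult cosets_one)

lemma cosets_in_fil_iff: "coherent u \<Longrightarrow> cosets u \<in> fil i \<longleftrightarrow> u i \<in> rp i"
proof -
  assume u: "coherent u"
  have "cosets u i = rp i +> u i" by (simp add: cosets_def)
  then show ?thesis
    using cosets_carrier[OF u] coset_eq_zero_iff[OF coherentD(1)[OF u], of i i] by (simp add: fil_def)
qed

lemma completion_map_in_fil_iff: "a \<in> carrier A \<Longrightarrow> completion_map A r a \<in> fil i \<longleftrightarrow> a \<in> rp i"
  by (simp add: completion_map_eq cosets_in_fil_iff coherent_const)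

lemma filE:
  assumes "x \<in> fil i" obtains u where "coherent u" "x = cosets u" "u i \<in> rp i"
proof -
  have "x \<in> carrier Ac" using assms by (simp add: fil_def)
  then obtain u where "coherent u" "x = cosets u" by (rule completionE)
  then show ?thesis using that assms cosets_in_fil_iff by blast
qed

lemma fil_ideal: "ideal (fil i) Ac"
proof (rule idealI)
  have zero: "\<zero>\<^bsub>Ac\<^esub> \<in> fil i"
    by (simp add: cosets_zero cosets_in_fil_iff coherent_const rp_closed(3))
  have mult: "a \<otimes>\<^bsub>Ac\<^esub> x \<in> fil i" if x: "x \<in> fil i" and a: "a \<in> carrier Ac" for a x
  proof -
    obtain u where u: "coherent u" "x = cosets u" "u i \<in> rp i" using x by (rule filE)
    obtain v where v: "coherent v" "a = cosets v" "\<forall>i. v i \<in> carrier A" using a by (rule completionE)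
    show ?thesis using u v by (simp add: cosets_mult cosets_in_fil_iff coherent_mult rp_closed(5))
  qed
  show "subgroup (fil i) (add_monoid Ac)"
  proof (rule Ac.add.subgroupI)
    show "fil i \<subseteq> carrier Ac" by (auto simp: fil_def)
    show "fil i \<noteq> {}" using zero by blast
    show "\<ominus>\<^bsub>Ac\<^esub> x \<in> fil i" if "x \<in> fil i" for x
      using that by (elim filE) (simp add: cosets_minus cosets_in_fil_iff coherent_minus rp_closed(2))
    show "x \<oplus>\<^bsub>Ac\<^esub> y \<in> fil i" if x: "x \<in> fil i" and y: "y \<in> fil i" for x y
    proof -
      obtain u where u: "coherent u" "x = cosets u" "u i \<in> rp i" using x by (rule filE)
      obtain v where v: "coherent v" "y = cosets v" "v i \<in> rp i" using y by (rule filE)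
      show ?thesis using u v by (simp add: cosets_add cosets_in_fil_iff coherent_add rp_closed(1))
    qed
  qed
  show "a \<otimes>\<^bsub>Ac\<^esub> x \<in> fil i" if "x \<in> fil i" "a \<in> carrier Ac" for a x using mult that .
  show "x \<otimes>\<^bsub>Ac\<^esub> a \<in> fil i" if "x \<in> fil i" "a \<in> carrier Ac" for a x
    using mult[OF that] that by (simp add: fil_def Ac.m_comm)
  show "ring Ac" by (rule Ac.ring_axioms)
qed

lemma coherent_le: "coherent u \<Longrightarrow> i \<le> j \<Longrightarrow> u j \<ominus> u i \<in> rp i"
proof (induction j)
  case 0
  then show ?case using coherentD(1)[of u 0] by (simp add: a_minus_def r_neg)
next
  case (Suc j)
  show ?case
  proof (cases "i = Suc j")
    case True
    show ?thesis unfolding True by (rule diff_self_in_rp[OF coherentD(1)[OF Suc.prems(1)]])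
  next
    case False
    have "u (Suc j) \<ominus> u i = (u (Suc j) \<ominus> u j) \<oplus> (u j \<ominus> u i)"
      using coherentD(1)[OF Suc.prems(1), of i] coherentD(1)[OF Suc.prems(1), of j]
        coherentD(1)[OF Suc.prems(1), of "Suc j"] by algebra
    moreover have "u (Suc j) \<ominus> u j \<in> rp i"
      using rp_antimono[of i j] coherentD(2)[OF Suc.prems(1)] False Suc.prems(2) by simp
    ultimately show ?thesis using Suc False rp_closed(1) by simp
  qed
qed

lemma fil_antimono:
  assumes "i \<le> j" "x \<in> fil j"
  shows "x \<in> fil i"
proof -
  obtain u where u: "coherent u" "x = cosets u" "u j \<in> rp j" using assms(2) by (rule filE)
  have "u i = u j \<ominus> (u j \<ominus> u i)"
    using coherentD(1)[OF u(1), of i] coherentD(1)[OF u(1), of j] by algebra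
  moreover have "u j \<ominus> (u j \<ominus> u i) \<in> rp i" unfolding a_minus_def[of A "u j" "u j \<ominus> u i"]
    using coherent_le[OF u(1) assms(1)] rp_antimono[OF assms(1) u(3)] rp_closed(1,2) by blast
  ultimately show ?thesis using u cosets_in_fil_iff by simp
qed

lemma fil_0: "fil 0 = carrier Ac"
proof -
  have "x \<in> fil 0" if "x \<in> carrier Ac" for x
    using that by (elim completionE) (simp add: cosets_in_fil_iff)
  then show ?thesis by (auto simp: fil_def)
qed

lemma fil_separated:
  assumes "\<And>i. x \<in> fil i"
  shows "x = \<zero>\<^bsub>Ac\<^esub>"
proof -
  have "x i = rp i" for i using assms[of i] by (simp add: fil_def)
  then show ?thesis by (auto simp: adic_completion_def FactRing_def)
qed

text \<open>The i-th representative, taken as a constant sequence, agrees with x at level i.\<close>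

lemma completion_approx:
  assumes "x \<in> carrier Ac"
  obtains a where "a \<in> carrier A" "x \<ominus>\<^bsub>Ac\<^esub> completion_map A r a \<in> fil i"
proof -
  obtain u where u: "coherent u" "x = cosets u" "\<forall>i. u i \<in> carrier A" using assms by (rule completionE)
  note uc = spec[OF u(3), of i]
  have "coherent (\<lambda>j. u j \<ominus> u i)"
    using coherent_add[OF u(1) coherent_minus[OF coherent_const[OF uc]]] by (simp add: a_minus_def)
  then have "x \<ominus>\<^bsub>Ac\<^esub> completion_map A r (u i) \<in> fil i"
    using u coherent_const[OF uc] uc
    by (simp add: completion_map_eq cosets_diff cosets_in_fil_iff diff_self_in_rp)
  then show ?thesis using that uc by blast
qed

text \<open>The limit is the diagonal of the representatives. Its consecutive differences split into
  one step within a sequence and one step between sequences, both in r^i.\<close>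

lemma completion_complete:
  assumes "\<And>i. s i \<in> carrier Ac" "\<And>i. s (Suc i) \<ominus>\<^bsub>Ac\<^esub> s i \<in> fil i"
  shows "\<exists>l\<in>carrier Ac. \<forall>i. l \<ominus>\<^bsub>Ac\<^esub> s i \<in> fil i"
proof -
  have "\<forall>i. \<exists>u. coherent u \<and> s i = cosets u" using assms(1) completion_carrier by blast
  then obtain u where u: "\<And>i. coherent (u i)" "\<And>i. s i = cosets (u i)" by metis
  have uc: "u i j \<in> carrier A" for i j using u(1) coherentD(1) by blast
  have diff: "coherent (\<lambda>j. v j \<ominus> w j)" if "coherent v" "coherent w" for v w
    using coherent_add[OF that(1) coherent_minus[OF that(2)]] by (simp add: a_minus_def)
  have "u (Suc i) i \<ominus> u i i \<in> rp i" for i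
    using assms(2)[of i] u diff by (simp add: cosets_diff cosets_in_fil_iff)
  moreover have "u (Suc i) (Suc i) \<ominus> u (Suc i) i \<in> rp i" for i using coherentD(2)[OF u(1)] .
  moreover have "u (Suc i) (Suc i) \<ominus> u i i = (u (Suc i) (Suc i) \<ominus> u (Suc i) i) \<oplus> (u (Suc i) i \<ominus> u i i)" for i
    using uc[of "Suc i" "Suc i"] uc[of "Suc i" i] uc[of i i] by algebra
  ultimately have l: "coherent (\<lambda>i. u i i)" unfolding coherent_def using uc rp_closed(1) by simp
  have "cosets (\<lambda>i. u i i) \<ominus>\<^bsub>Ac\<^esub> s i \<in> fil i" for i
    using u l diff uc by (simp add: cosets_diff cosets_in_fil_iff diff_self_in_rp)
  then show ?thesis using cosets_carrier[OF l] by blast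
qed

end

section \<open>Rings as modules along a homomorphism\<close>

lemma module_via_simps [simp]:
  "carrier (module_via h A) = carrier A" "\<zero>\<^bsub>module_via h A\<^esub> = \<zero>\<^bsub>A\<^esub>"
  "x \<oplus>\<^bsub>module_via h A\<^esub> y = x \<oplus>\<^bsub>A\<^esub> y" "b \<odot>\<^bsub>module_via h A\<^esub> x = h b \<otimes>\<^bsub>A\<^esub> x"
  by (simp_all add: module_via_def ring.extend_def module.fields_def)

lemma module_module_via:
  assumes "cring R" "cring A" and h: "h \<in> ring_hom R A"
  shows "module R (module_via h A)"
proof -
  interpret A: cring A by fact
  show ?thesis
  proof (rule moduleI)
    show "abelian_group (module_via h A)"
      by (rule abelian_groupI) (auto simp: A.a_ac intro: exI A.l_neg bexI[of _ "\<ominus>\<^bsub>A\<^esub> x" for x])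
  qed (use assms(1) h in \<open>simp_all add: ring_hom_closed ring_hom_add ring_hom_mult ring_hom_one
        A.l_distr A.r_distr A.m_assoc\<close>)
qed

section \<open>Algebras with a complete filtration\<close>

text \<open>Keeps just what successive approximation uses: a decreasing, separated and complete
  filtration by ideals. Convergence is normalized so that the i-th term differs from the limit by an
  element of \<open>fil i\<close>.\<close>

locale filtered_algebra = B: cring B + cring S
  for B :: "('b, 'y) ring_scheme" and S :: "'s ring" (structure) +
  fixes h :: "'b \<Rightarrow> 's" and fil :: "nat \<Rightarrow> 's set"
  assumes h_hom: "h \<in> ring_hom B S" and fil_ideal: "ideal (fil i) S"
    and fil_antimono: "i \<le> j \<Longrightarrow> x \<in> fil j \<Longrightarrow> x \<in> fil i" and fil_0: "fil 0 = carrier S"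
    and fil_separated: "(\<And>i. x \<in> fil i) \<Longrightarrow> x = \<zero>"
    and fil_complete: "(\<And>i. s i \<in> carrier S) \<Longrightarrow> (\<And>i. s (Suc i) \<ominus> s i \<in> fil i) \<Longrightarrow>
      \<exists>l\<in>carrier S. \<forall>i. l \<ominus> s i \<in> fil i"
begin

abbreviation "M \<equiv> module_via h S"

lemma module_M: "module B M"
  using module_module_via[OF B.is_cring is_cring h_hom] .

sublocale M: module B M by (rule module_M)

lemma h_closed: "b \<in> carrier B \<Longrightarrow> h b \<in> carrier S"
  using ring_hom_closed[OF h_hom] .

lemma fil_closed:
  "x \<in> fil i \<Longrightarrow> x \<in> carrier S" "x \<in> fil i \<Longrightarrow> y \<in> fil i \<Longrightarrow> x \<oplus> y \<in> fil i"
  "x \<in> fil i \<Longrightarrow> \<ominus> x \<in> fil i" "\<zero> \<in> fil i"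
  "x \<in> fil i \<Longrightarrow> y \<in> fil i \<Longrightarrow> x \<ominus> y \<in> fil i"
  "x \<in> fil i \<Longrightarrow> a \<in> carrier S \<Longrightarrow> a \<otimes> x \<in> fil i"
proof -
  interpret F: ideal "fil i" S by (rule fil_ideal)
  show "x \<in> fil i \<Longrightarrow> x \<in> carrier S" "x \<in> fil i \<Longrightarrow> y \<in> fil i \<Longrightarrow> x \<oplus> y \<in> fil i"
    "x \<in> fil i \<Longrightarrow> \<ominus> x \<in> fil i" "\<zero> \<in> fil i" "x \<in> fil i \<Longrightarrow> a \<in> carrier S \<Longrightarrow> a \<otimes> x \<in> fil i"
    by (auto simp: F.I_l_closed)
  then show "x \<in> fil i \<Longrightarrow> y \<in> fil i \<Longrightarrow> x \<ominus> y \<in> fil i"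
    by (auto simp: a_minus_def)
qed

lemma fil_Pi: "w \<in> G \<rightarrow> fil i \<Longrightarrow> w \<in> G \<rightarrow> carrier S"
  using fil_closed(1) by blast

definition comb :: "'b set \<Rightarrow> ('b \<Rightarrow> 's) \<Rightarrow> 's" where
  "comb G w = (\<Oplus>\<gamma>\<in>G. h \<gamma> \<otimes> w \<gamma>)"

lemma ideal_span_single:
  "i \<in> I \<Longrightarrow> y \<in> carrier S \<Longrightarrow> h i \<otimes> y \<oplus> \<zero> \<in> ideal_span M I"
  using ideal_span.step[OF _ _ ideal_span.zero, of i I y M] by simp

context
  fixes G :: "'b set"
  assumes G: "finite G" "G \<subseteq> carrier B"
begin

lemma hG: "\<gamma> \<in> G \<Longrightarrow> h \<gamma> \<in> carrier S"
  using h_closed G(2) by blast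

lemma comb_closed: "w \<in> G \<rightarrow> carrier S \<Longrightarrow> comb G w \<in> carrier S"
  unfolding comb_def using hG by (intro finsum_closed) auto

lemma comb_add:
  assumes "v \<in> G \<rightarrow> carrier S" "w \<in> G \<rightarrow> carrier S"
  shows "comb G (\<lambda>\<gamma>. v \<gamma> \<oplus> w \<gamma>) = comb G v \<oplus> comb G w"
proof -
  have "comb G (\<lambda>\<gamma>. v \<gamma> \<oplus> w \<gamma>) = (\<Oplus>\<gamma>\<in>G. h \<gamma> \<otimes> v \<gamma> \<oplus> h \<gamma> \<otimes> w \<gamma>)"
    unfolding comb_def using assms hG by (intro finsum_cong') (auto simp: r_distr Pi_def)
  also have "\<dots> = comb G v \<oplus> comb G w"
    unfolding comb_def using assms hG by (intro finsum_addf) auto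
  finally show ?thesis .
qed

lemma comb_cong: "w \<in> G \<rightarrow> carrier S \<Longrightarrow> (\<And>\<gamma>. \<gamma> \<in> G \<Longrightarrow> v \<gamma> = w \<gamma>) \<Longrightarrow> comb G v = comb G w"
  unfolding comb_def using hG by (intro finsum_cong') auto

lemma comb_zero: "comb G (\<lambda>_. \<zero>) = \<zero>"
proof -
  have "comb G (\<lambda>_. \<zero>) = (\<Oplus>\<gamma>\<in>G. \<zero>)"
    unfolding comb_def using hG by (intro finsum_cong') auto
  then show ?thesis by (simp add: finsum_zero)
qed

lemma comb_minus:
  assumes w: "w \<in> G \<rightarrow> carrier S"
  shows "comb G (\<lambda>\<gamma>. \<ominus> w \<gamma>) = \<ominus> comb G w"
proof -
  have m: "(\<lambda>\<gamma>. \<ominus> w \<gamma>) \<in> G \<rightarrow> carrier S" using w by auto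
  have "comb G (\<lambda>\<gamma>. \<ominus> w \<gamma> \<oplus> w \<gamma>) = comb G (\<lambda>_. \<zero>)"
    using w by (intro comb_cong) (auto simp: l_neg Pi_def)
  then have "comb G (\<lambda>\<gamma>. \<ominus> w \<gamma>) \<oplus> comb G w = \<zero>" using comb_add[OF m w] comb_zero by simp
  then show ?thesis using minus_equality comb_closed[OF w] comb_closed[OF m] by metis
qed

text \<open>The steps of the filtration are ideals. This is the continuity that makes the
  combination of limits the limit of the combinations.\<close>

lemma comb_fil:
  assumes "w \<in> G \<rightarrow> fil i"
  shows "comb G w \<in> fil i"
proof -
  have "(\<Oplus>\<gamma>\<in>F. h \<gamma> \<otimes> w \<gamma>) \<in> fil i" if "F \<subseteq> G" for F
    using finite_subset[OF that G(1)] that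
  proof (induction F rule: finite_induct)
    case (insert \<gamma> F)
    have t: "h x \<otimes> w x \<in> fil i" if "x \<in> insert \<gamma> F" for x
      using insert.prems that assms hG fil_closed(6) by blast
    then have "(\<Oplus>\<gamma>\<in>insert \<gamma> F. h \<gamma> \<otimes> w \<gamma>) = h \<gamma> \<otimes> w \<gamma> \<oplus> (\<Oplus>\<gamma>\<in>F. h \<gamma> \<otimes> w \<gamma>)"
      using insert.hyps fil_closed(1) by (intro finsum_insert) auto
    then show ?case using insert t fil_closed(2) by simp
  qed (simp add: fil_closed(4))
  then show ?thesis unfolding comb_def by blast
qed

lemma comb_single:
  assumes "\<gamma> \<in> G" "x \<in> carrier S"
  shows "comb G (\<lambda>\<gamma>'. if \<gamma>' = \<gamma> then x else \<zero>) = h \<gamma> \<otimes> x"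
proof -
  have "comb G (\<lambda>\<gamma>'. if \<gamma>' = \<gamma> then x else \<zero>) = (\<Oplus>\<gamma>'\<in>G. if \<gamma> = \<gamma>' then h \<gamma>' \<otimes> x else \<zero>)"
    unfolding comb_def using hG assms(2) by (intro finsum_cong') auto
  also have "\<dots> = h \<gamma> \<otimes> x" using hG G(1) assms by (intro finsum_singleton) auto
  finally show ?thesis .
qed

text \<open>Used with a and I, to show that corrections do not leave the hypothesis a z in I M, and
  with 1 and (I : a), to place the final combination.\<close>

lemma comb_ideal_span:
  assumes w: "w \<in> G \<rightarrow> carrier S" and a: "a \<in> carrier B" and I: "I \<subseteq> carrier B"
    and aI: "\<And>\<gamma>. \<gamma> \<in> G \<Longrightarrow> \<gamma> \<otimes>\<^bsub>B\<^esub> a \<in> I"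
  shows "h a \<otimes> comb G w \<in> ideal_span M I"
proof -
  have summand: "h a \<otimes> (h \<gamma> \<otimes> w \<gamma>) \<in> ideal_span M I" "h a \<otimes> (h \<gamma> \<otimes> w \<gamma>) \<in> carrier S" if \<gamma>: "\<gamma> \<in> G" for \<gamma>
  proof -
    have c: "\<gamma> \<in> carrier B" "w \<gamma> \<in> carrier S" "h a \<in> carrier S" using \<gamma> G(2) w h_closed a by auto
    have "h a \<otimes> (h \<gamma> \<otimes> w \<gamma>) = h (\<gamma> \<otimes>\<^bsub>B\<^esub> a) \<otimes> w \<gamma> \<oplus> \<zero>"
      using ring_hom_mult[OF h_hom c(1) a] c hG[OF \<gamma>] by (simp add: m_ac)
    then show "h a \<otimes> (h \<gamma> \<otimes> w \<gamma>) \<in> ideal_span M I" using ideal_span_single[OF aI[OF \<gamma>] c(2)] by simp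
    show "h a \<otimes> (h \<gamma> \<otimes> w \<gamma>) \<in> carrier S" using c hG[OF \<gamma>] by simp
  qed
  have "(\<Oplus>\<gamma>\<in>F. h a \<otimes> (h \<gamma> \<otimes> w \<gamma>)) \<in> ideal_span M I" if "F \<subseteq> G" for F
    using finite_subset[OF that G(1)] that
  proof (induction F rule: finite_induct)
    case empty
    then show ?case using ideal_span.zero[of M I] by simp
  next
    case (insert \<gamma> F)
    then have "(\<Oplus>\<gamma>\<in>insert \<gamma> F. h a \<otimes> (h \<gamma> \<otimes> w \<gamma>)) = h a \<otimes> (h \<gamma> \<otimes> w \<gamma>) \<oplus> (\<Oplus>\<gamma>\<in>F. h a \<otimes> (h \<gamma> \<otimes> w \<gamma>))"
      using summand(2) by (intro finsum_insert) auto
    then show ?case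
      using M.ideal_span_add[OF summand(1)[of \<gamma>] insert.IH I] insert.prems by simp
  qed
  moreover have "h a \<otimes> comb G w = (\<Oplus>\<gamma>\<in>G. h a \<otimes> (h \<gamma> \<otimes> w \<gamma>))"
    unfolding comb_def using G(1) hG w h_closed[OF a] by (intro finsum_rdistr) auto
  ultimately show ?thesis by auto
qed

text \<open>Subtract combinations of the fixed generators G until nothing remains. Since G lies in
  (I : a), each remainder again satisfies the hypothesis. The coefficients of stage q lie in
  \<open>fil q\<close>, so their sums converge, and separation annihilates the limit of the
  remainders.\<close>

lemma colon_by_approximation:
  assumes I: "ideal I B" and a: "a \<in> carrier B" and GJ: "G \<subseteq> colon_ideal B I a"
    and step: "\<And>q. \<exists>p\<ge>q. (q = 0 \<longrightarrow> p = 0) \<and> (\<forall>N. \<forall>z\<in>fil p. h a \<otimes> z \<in> ideal_span M I \<longrightarrow>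
      (\<exists>w\<in>G \<rightarrow> fil q. z \<oplus> comb G w \<in> fil N))"
    and y: "y \<in> carrier S" "h a \<otimes> y \<in> ideal_span M I"
  shows "y \<in> ideal_span M (colon_ideal B I a)"
proof -
  have Ic: "I \<subseteq> carrier B" using ideal.Icarr[OF I] by blast
  have aG: "\<gamma> \<otimes>\<^bsub>B\<^esub> a \<in> I" if "\<gamma> \<in> G" for \<gamma> using GJ that by (auto simp: colon_ideal_def)
  have "\<forall>q. \<exists>p\<ge>q. (q = 0 \<longrightarrow> p = 0) \<and> (\<forall>N. \<forall>z\<in>fil p. h a \<otimes> z \<in> ideal_span M I \<longrightarrow>
      (\<exists>w\<in>G \<rightarrow> fil q. z \<oplus> comb G w \<in> fil N))" using step by blast
  from choice[OF this] obtain p where p': "\<forall>q. q \<le> p q \<and> (q = 0 \<longrightarrow> p q = 0) \<and>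
    (\<forall>N. \<forall>z\<in>fil (p q). h a \<otimes> z \<in> ideal_span M I \<longrightarrow> (\<exists>w\<in>G \<rightarrow> fil q. z \<oplus> comb G w \<in> fil N))" ..
  have p: "q \<le> p q" "p 0 = 0" for q using spec[OF p', of q] spec[OF p', of 0] by (blast, blast)
  \<comment> \<open>Stage q starts in fil (p q) and ends in fil (p (Suc q)), where the next stage
    can begin. This target may be chosen because the precision N is arbitrary once p q is
    fixed.\<close>
  define W where "W = (\<lambda>q z. SOME w. w \<in> G \<rightarrow> fil q \<and> z \<oplus> comb G w \<in> fil (p (Suc q)))"
  have W: "W q z \<in> G \<rightarrow> fil q \<and> z \<oplus> comb G (W q z) \<in> fil (p (Suc q))"
    if "z \<in> fil (p q)" "h a \<otimes> z \<in> ideal_span M I" for q z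
  proof -
    have "\<exists>w. w \<in> G \<rightarrow> fil q \<and> z \<oplus> comb G w \<in> fil (p (Suc q))" using spec[OF p', of q] that by blast
    from someI_ex[OF this] show ?thesis unfolding W_def .
  qed
  define Z where "Z = rec_nat y (\<lambda>q z. z \<oplus> comb G (W q z))"
  have Z0: "Z 0 = y" and ZS: "Z (Suc q) = Z q \<oplus> comb G (W q (Z q))" for q
    unfolding Z_def by simp_all
  have inv: "Z q \<in> fil (p q) \<and> h a \<otimes> Z q \<in> ideal_span M I" for q
  proof (induction q)
    case 0
    then show ?case using Z0 p(2) fil_0 y by simp
  next
    case (Suc q)
    have w: "W q (Z q) \<in> G \<rightarrow> carrier S" and zf: "Z (Suc q) \<in> fil (p (Suc q))"
      using W[of "Z q" q] Suc ZS fil_Pi[of "W q (Z q)" G q] by auto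
    have "Z q \<in> carrier S" using Suc fil_closed(1) by blast
    then have "h a \<otimes> Z (Suc q) = h a \<otimes> Z q \<oplus> h a \<otimes> comb G (W q (Z q))"
      unfolding ZS using comb_closed[OF w] h_closed[OF a] by (simp add: r_distr)
    then show ?case
      using M.ideal_span_add[OF _ comb_ideal_span[OF w a Ic aG] Ic, of "h a \<otimes> Z q"] Suc zf by simp
  qed
  define V where "V = (\<lambda>q. W q (Z q))"
  have V: "V q \<in> G \<rightarrow> fil q" for q using W inv unfolding V_def by blast
  \<comment> \<open>Partial sums of the coefficients, one series for each generator.\<close>
  define U where "U = (\<lambda>q \<gamma>. rec_nat \<zero> (\<lambda>q s. s \<oplus> V q \<gamma>) q)"
  have U0: "U 0 \<gamma> = \<zero>" and US: "U (Suc q) \<gamma> = U q \<gamma> \<oplus> V q \<gamma>" for q \<gamma> unfolding U_def by simp_all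
  have Uc: "U q \<in> G \<rightarrow> carrier S" for q
  proof (induction q)
    case (Suc q)
    then show ?case using fil_Pi[OF V, of q] by (auto simp: US)
  qed (simp add: U0)
  have yUZ: "y \<oplus> comb G (U q) = Z q" for q
  proof (induction q)
    case 0
    then show ?case using y(1) comb_zero by (simp add: Z0 U0[abs_def])
  next
    case (Suc q)
    have "comb G (U (Suc q)) = comb G (U q) \<oplus> comb G (V q)"
      using comb_add[OF Uc fil_Pi[OF V]] by (simp add: US[abs_def])
    then have "y \<oplus> comb G (U (Suc q)) = (y \<oplus> comb G (U q)) \<oplus> comb G (V q)"
      using y(1) comb_closed[OF Uc] comb_closed[OF fil_Pi[OF V]] by (simp add: a_assoc)
    then show ?case unfolding Suc.IH ZS V_def .
  qed
  have "\<exists>l\<in>carrier S. \<forall>i. l \<ominus> U i \<gamma> \<in> fil i" if \<gamma>: "\<gamma> \<in> G" for \<gamma>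
  proof (rule fil_complete)
    show "U i \<gamma> \<in> carrier S" for i using Uc \<gamma> by blast
    have "(s \<oplus> v) \<ominus> s = v" if "s \<in> carrier S" "v \<in> carrier S" for s v
      using that by algebra
    then have "U (Suc i) \<gamma> \<ominus> U i \<gamma> = V i \<gamma>" for i
      unfolding US using Uc fil_Pi[OF V] \<gamma> by blast
    then show "U (Suc i) \<gamma> \<ominus> U i \<gamma> \<in> fil i" for i using V \<gamma> by auto
  qed
  then have "\<forall>\<gamma>\<in>G. \<exists>l. l \<in> carrier S \<and> (\<forall>i. l \<ominus> U i \<gamma> \<in> fil i)" by blast
  from bchoice[OF this] obtain l where l: "\<forall>\<gamma>\<in>G. l \<gamma> \<in> carrier S \<and> (\<forall>i. l \<gamma> \<ominus> U i \<gamma> \<in> fil i)" ..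
  have lc: "l \<in> G \<rightarrow> carrier S" and ld: "(\<lambda>\<gamma>. l \<gamma> \<ominus> U i \<gamma>) \<in> G \<rightarrow> fil i" for i using l by auto
  \<comment> \<open>The remainder Z i and the tail of the coefficient series both contribute only
    terms of \<open>fil i\<close>.\<close>
  have "y \<oplus> comb G l \<in> fil i" for i
  proof -
    have split: "x = u \<oplus> (x \<ominus> u)" if "x \<in> carrier S" "u \<in> carrier S" for x u using that by algebra
    then have "comb G l = comb G (\<lambda>\<gamma>. U i \<gamma> \<oplus> (l \<gamma> \<ominus> U i \<gamma>))"
    proof (intro comb_cong)
      show "(\<lambda>\<gamma>. U i \<gamma> \<oplus> (l \<gamma> \<ominus> U i \<gamma>)) \<in> G \<rightarrow> carrier S"
        using Uc[of i] fil_Pi[OF ld, of i] by (auto simp: Pi_iff)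
      show "l \<gamma> = U i \<gamma> \<oplus> (l \<gamma> \<ominus> U i \<gamma>)" if "\<gamma> \<in> G" for \<gamma> 
        using lc Uc[of i] that by (intro split) auto
    qed
    also have "\<dots> = comb G (U i) \<oplus> comb G (\<lambda>\<gamma>. l \<gamma> \<ominus> U i \<gamma>)"
      using comb_add[OF Uc fil_Pi[OF ld]] .
    finally have "y \<oplus> comb G l = Z i \<oplus> comb G (\<lambda>\<gamma>. l \<gamma> \<ominus> U i \<gamma>)"
      unfolding yUZ[symmetric] using y(1) comb_closed[OF Uc] comb_closed[OF fil_Pi[OF ld]] by (simp add: a_assoc)
    moreover have "Z i \<in> fil i" using fil_antimono[OF p(1)] inv by blast
    ultimately show ?thesis using fil_closed(2) comb_fil[OF ld] by simp
  qed
  then have "y \<oplus> comb G l = \<zero>" by (rule fil_separated)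
  then have "y = comb G (\<lambda>\<gamma>. \<ominus> l \<gamma>)"
    unfolding comb_minus[OF lc] using y(1) comb_closed[OF lc] minus_equality by metis
  moreover have "h \<one>\<^bsub>B\<^esub> \<otimes> comb G (\<lambda>\<gamma>. \<ominus> l \<gamma>) \<in> ideal_span M (colon_ideal B I a)"
  proof (rule comb_ideal_span)
    show "colon_ideal B I a \<subseteq> carrier B" by (auto simp: colon_ideal_def)
    show "\<gamma> \<otimes>\<^bsub>B\<^esub> \<one>\<^bsub>B\<^esub> \<in> colon_ideal B I a" if "\<gamma> \<in> G" for \<gamma>
      using subsetD[OF GJ that] subsetD[OF G(2) that] by simp
  qed (use lc in auto)
  moreover have "comb G (\<lambda>\<gamma>. \<ominus> l \<gamma>) \<in> carrier S" using lc by (intro comb_closed) auto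
  ultimately show ?thesis using ring_hom_one[OF h_hom] by simp
qed

end

end

section \<open>Flatness of the completed tensor product\<close>

context filtered_tensor_ring
begin

sublocale adic: adic_ring A r by (intro adic_ring.intro adic_ring_axioms.intro A.is_cring ideal_r)

abbreviation "Ac \<equiv> adic_completion A r"
abbreviation "\<iota> \<equiv> completion_map A r"
abbreviation "h b \<equiv> completion_map A r (\<tau> b \<one>\<^bsub>C\<^esub>)"
abbreviation "fil \<equiv> adic.fil"

lemma h_hom: "(\<lambda>b. h b) \<in> ring_hom B Ac"
proof -
  note [simp] = ring_hom_closed[OF adic.completion_map_hom] tau_closed
  show ?thesis
  proof (rule ring_hom_memI)
    fix b b' assume b: "b \<in> carrier B" "b' \<in> carrier B"
    show "h b \<in> carrier Ac" using b by simp
    show "h (b \<otimes>\<^bsub>B\<^esub> b') = h b \<otimes>\<^bsub>Ac\<^esub> h b'"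
      using b ring_hom_mult[OF adic.completion_map_hom, symmetric] by (simp add: tau_mult)
    show "h (b \<oplus>\<^bsub>B\<^esub> b') = h b \<oplus>\<^bsub>Ac\<^esub> h b'"
      using b ring_hom_add[OF adic.completion_map_hom] by (simp add: tau_add_left)
  next
    show "h \<one>\<^bsub>B\<^esub> = \<one>\<^bsub>Ac\<^esub>" using ring_hom_one[OF adic.completion_map_hom] by (simp add: tau_one)
  qed
qed

sublocale F: filtered_algebra B Ac "\<lambda>b. h b" fil
proof (rule filtered_algebra.intro[OF B.is_cring adic.completion_cring filtered_algebra_axioms.intro])
  show "x \<in> fil i" if "i \<le> j" "x \<in> fil j" for i j x using adic.fil_antimono that .
  show "x = \<zero>\<^bsub>Ac\<^esub>" if "\<And>i. x \<in> fil i" for x using adic.fil_separated that .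
  show "\<exists>l\<in>carrier Ac. \<forall>i. l \<ominus>\<^bsub>Ac\<^esub> s i \<in> fil i"
    if "\<And>i. s i \<in> carrier Ac" "\<And>i. s (Suc i) \<ominus>\<^bsub>Ac\<^esub> s i \<in> fil i" for s
    using adic.completion_complete that .
qed (simp_all add: h_hom adic.fil_ideal adic.fil_0)

lemma iota_hom: "x \<in> carrier A \<Longrightarrow> \<iota> x \<in> carrier Ac"
  "x \<in> carrier A \<Longrightarrow> y \<in> carrier A \<Longrightarrow> \<iota> (x \<oplus>\<^bsub>A\<^esub> y) = \<iota> x \<oplus>\<^bsub>Ac\<^esub> \<iota> y"
  "x \<in> carrier A \<Longrightarrow> y \<in> carrier A \<Longrightarrow> \<iota> (x \<otimes>\<^bsub>A\<^esub> y) = \<iota> x \<otimes>\<^bsub>Ac\<^esub> \<iota> y"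
  by (rule ring_hom_closed[OF adic.completion_map_hom] ring_hom_add[OF adic.completion_map_hom]
      ring_hom_mult[OF adic.completion_map_hom]; assumption)+

section \<open>Transfer between A and its completion\<close>

lemma filtered_pairs_antimono: "i \<le> j \<Longrightarrow> filtered_pairs j \<subseteq> filtered_pairs i"
proof -
  assume "i \<le> j"
  then have "mp (j - d) \<subseteq> mp (i - d)" for d by (intro B.ideal_power_antimono[OF ideal_m]) simp
  then show ?thesis unfolding filtered_pairs_def by blast
qed

text \<open>In a finite sum of products i y, replacing each y by an element of A that is close to it
  changes the sum only within \<open>fil N\<close>. This turns membership in I times the completion
  into membership in I (x) C + r^N.\<close>

lemma ideal_span_level:
  assumes idI: "ideal I B" and t: "t \<in> ideal_span F.M I" and v: "v \<in> carrier A" "t \<ominus>\<^bsub>Ac\<^esub> \<iota> v \<in> fil N"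
  shows "v \<in> tsums (I \<times> carrier C \<union> filtered_pairs N)"
  using t v
proof (induction arbitrary: v rule: ideal_span.induct)
  case zero
  have e: "\<iota> v = \<ominus>\<^bsub>Ac\<^esub> (\<zero>\<^bsub>Ac\<^esub> \<ominus>\<^bsub>Ac\<^esub> \<iota> v)" using iota_hom(1)[OF zero(1)] by (simp add: a_minus_def)
  have "\<iota> v \<in> fil N" by (subst e) (rule F.fil_closed(3)[OF zero(2)[unfolded module_via_simps]])
  then have "v \<in> tsums (filtered_pairs N)"
    using adic.completion_map_in_fil_iff[OF zero(1)] rp_eq by simp
  then show ?case by (rule subsetD[OF tensor_sums_mono[OF Un_upper2]])
next
  case (step i y t)
  have I: "I \<subseteq> carrier B" using ideal.Icarr[OF idI] by blast
  have P: "I \<times> carrier C \<union> filtered_pairs N \<subseteq> BC"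
    using I filtered_pairs_subset by blast
  have i: "i \<in> carrier B" using step(1) I by blast
  have yc: "y \<in> carrier Ac" using step(2) by simp
  have tc: "t \<in> carrier Ac" using F.M.ideal_span_closed[OF step(3) I] by simp
  obtain x where x: "x \<in> carrier A" "y \<ominus>\<^bsub>Ac\<^esub> \<iota> x \<in> fil N" using adic.completion_approx[OF yc] .
  define u where "u = \<tau> i \<one>\<^bsub>C\<^esub> \<otimes>\<^bsub>A\<^esub> x"
  have ic: "\<tau> i \<one>\<^bsub>C\<^esub> \<in> carrier A" using i tau_closed by simp
  have uc: "u \<in> carrier A" unfolding u_def using ic x by simp
  \<comment> \<open>Once the term i x is removed, v' approximates the rest t of the sum; for this
    reason v is generalized in the induction.\<close>
  define v' where "v' = v \<ominus>\<^bsub>A\<^esub> u"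
  have v'c: "v' \<in> carrier A" and vv': "v = u \<oplus>\<^bsub>A\<^esub> v'"
    unfolding v'_def using step(5) uc by (simp, algebra)
  have cc: "h i \<in> carrier Ac" "\<iota> x \<in> carrier Ac" "\<iota> v' \<in> carrier Ac"
    using F.h_closed[OF i] iota_hom(1) x v'c by auto
  have "\<iota> v = h i \<otimes>\<^bsub>Ac\<^esub> \<iota> x \<oplus>\<^bsub>Ac\<^esub> \<iota> v'"
    unfolding vv' using iota_hom(2)[OF uc v'c] iota_hom(3)[OF ic x(1)] unfolding u_def by simp
  moreover have "t \<ominus>\<^bsub>Ac\<^esub> \<iota> v' = ((h i \<otimes>\<^bsub>Ac\<^esub> y \<oplus>\<^bsub>Ac\<^esub> t) \<ominus>\<^bsub>Ac\<^esub> (h i \<otimes>\<^bsub>Ac\<^esub> \<iota> x \<oplus>\<^bsub>Ac\<^esub> \<iota> v')) \<ominus>\<^bsub>Ac\<^esub> h i \<otimes>\<^bsub>Ac\<^esub> (y \<ominus>\<^bsub>Ac\<^esub> \<iota> x)"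
    using cc yc tc by algebra
  ultimately have "t \<ominus>\<^bsub>Ac\<^esub> \<iota> v' \<in> fil N"
    using step(6) F.fil_closed(5) F.fil_closed(6)[OF x(2) cc(1)] by simp
  then have v': "v' \<in> tsums (I \<times> carrier C \<union> filtered_pairs N)" using step.IH v'c by blast
  have "u \<in> tsums (I \<times> carrier C)"
    unfolding u_def
  proof (rule tsums_mult[of "{(i, \<one>\<^bsub>C\<^esub>)}" BC])
    show "\<tau> i \<one>\<^bsub>C\<^esub> \<in> tsums {(i, \<one>\<^bsub>C\<^esub>)}" using i by (intro tsums_single) auto
    show "x \<in> tsums BC" using x tau_generates by blast
  next
    fix b c b' c' assume "(b, c) \<in> {(i, \<one>\<^bsub>C\<^esub>)}" "(b', c') \<in> BC"
    then show "(b \<otimes>\<^bsub>B\<^esub> b', c \<otimes>\<^bsub>C\<^esub> c') \<in> I \<times> carrier C"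
      using ideal.I_r_closed[OF idI step(1)] by auto
  qed (use i I in auto)
  then have "u \<in> tsums (I \<times> carrier C \<union> filtered_pairs N)"
    by (rule subsetD[OF tensor_sums_mono[OF Un_upper1]])
  then show ?case unfolding vv' using tsums_add[OF P _ v'] by blast
qed

text \<open>A generator of m^(q-d) J (x) n^d is a combination of elements \<gamma> in G whose
  coefficients come from m^(q-d) (x) n^d, which is contained in r^q. So the coefficients have order
  q, and the remaining summand r^N is absorbed by the precision N.\<close>

lemma colon_expansion:
  assumes G: "finite G" "G \<subseteq> carrier B" and J: "J = genideal B G"
    and u: "u \<in> tsums ({(b, c). \<exists>d. b \<in> ideal_prod B (mp (q - d)) J \<and> c \<in> np d} \<union> filtered_pairs N)"
  shows "\<exists>w\<in>G \<rightarrow> fil q. \<iota> u \<oplus>\<^bsub>Ac\<^esub> F.comb G w \<in> fil N"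
proof -
  define H where "H = {v \<in> carrier A. \<exists>w\<in>G \<rightarrow> fil q. \<iota> v \<oplus>\<^bsub>Ac\<^esub> F.comb G w \<in> fil N}"
  have idJ: "ideal J B" unfolding J using B.genideal_ideal[OF G(2)] .
  have H_add: "v \<oplus>\<^bsub>A\<^esub> v' \<in> H" if v: "v \<in> H" and v': "v' \<in> H" for v v'
  proof -
    obtain w where w: "w \<in> G \<rightarrow> fil q" "\<iota> v \<oplus>\<^bsub>Ac\<^esub> F.comb G w \<in> fil N" and vc: "v \<in> carrier A"
      using v unfolding H_def by blast
    obtain w' where w': "w' \<in> G \<rightarrow> fil q" "\<iota> v' \<oplus>\<^bsub>Ac\<^esub> F.comb G w' \<in> fil N" and vc': "v' \<in> carrier A"
      using v' unfolding H_def by blast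
    note c = F.fil_Pi[OF w(1)] F.fil_Pi[OF w'(1)]
    have "\<iota> (v \<oplus>\<^bsub>A\<^esub> v') \<oplus>\<^bsub>Ac\<^esub> F.comb G (\<lambda>\<gamma>. w \<gamma> \<oplus>\<^bsub>Ac\<^esub> w' \<gamma>) =
        (\<iota> v \<oplus>\<^bsub>Ac\<^esub> F.comb G w) \<oplus>\<^bsub>Ac\<^esub> (\<iota> v' \<oplus>\<^bsub>Ac\<^esub> F.comb G w')"
      using iota_hom vc vc' F.comb_closed[OF G c(1)] F.comb_closed[OF G c(2)] F.comb_add[OF G c]
      by (simp add: adic.Ac.a_ac)
    then have "\<iota> (v \<oplus>\<^bsub>A\<^esub> v') \<oplus>\<^bsub>Ac\<^esub> F.comb G (\<lambda>\<gamma>. w \<gamma> \<oplus>\<^bsub>Ac\<^esub> w' \<gamma>) \<in> fil N"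
      using F.fil_closed(2)[OF w(2) w'(2)] by simp
    moreover have "(\<lambda>\<gamma>. w \<gamma> \<oplus>\<^bsub>Ac\<^esub> w' \<gamma>) \<in> G \<rightarrow> fil q" using w(1) w'(1) F.fil_closed(2) by blast
    ultimately show ?thesis unfolding H_def using A.a_closed[OF vc vc'] by blast
  qed
  have H_rp: "v \<in> H" if "v \<in> rp N" for v
  proof -
    have vc: "v \<in> carrier A" using ideal.Icarr[OF rp_ideal that] .
    have "\<iota> v \<oplus>\<^bsub>Ac\<^esub> F.comb G (\<lambda>_. \<zero>\<^bsub>Ac\<^esub>) \<in> fil N"
      using adic.completion_map_in_fil_iff[OF vc] that iota_hom(1)[OF vc] by (simp add: F.comb_zero[OF G])
    then show ?thesis unfolding H_def using vc F.fil_closed(4)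
      by (intro CollectI conjI bexI[of _ "\<lambda>_. \<zero>\<^bsub>Ac\<^esub>"]) auto
  qed
  \<comment> \<open>Quantifying over all b in m^(q-d) allows a ring factor of j to be absorbed in b.
    This makes K an ideal, and inspecting the generators G of J is enough.\<close>
  define K where "K = {j \<in> carrier B. \<forall>b c d. b \<in> mp (q - d) \<longrightarrow> c \<in> np d \<longrightarrow> \<tau> (b \<otimes>\<^bsub>B\<^esub> j) c \<in> H}"
  have mpc: "b \<in> carrier B" if "b \<in> mp i" for b i using ideal.Icarr[OF mp_ideal that] .
  have npc: "c \<in> carrier C" if "c \<in> np i" for c i using ideal.Icarr[OF np_ideal that] .
  have K_mult: "b' \<otimes>\<^bsub>B\<^esub> j \<in> K" if j: "j \<in> K" and b': "b' \<in> carrier B" for j b'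
  proof -
    have "\<tau> (b \<otimes>\<^bsub>B\<^esub> (b' \<otimes>\<^bsub>B\<^esub> j)) c \<in> H" if bc: "b \<in> mp (q - d)" "c \<in> np d" for b c d
    proof -
      have "b \<otimes>\<^bsub>B\<^esub> b' \<in> mp (q - d)" using ideal.I_r_closed[OF mp_ideal bc(1) b'] .
      then show ?thesis using j bc(2) mpc[OF bc(1)] b' unfolding K_def by (auto simp: B.m_assoc[symmetric])
    qed
    then show ?thesis using j b' unfolding K_def by blast
  qed
  have K_ideal: "ideal K B"
  proof (rule idealI)
    show "ring B" by (rule B.ring_axioms)
    show "subgroup K (add_monoid B)"
    proof (rule B.add.subgroupI)
      show "K \<subseteq> carrier B" unfolding K_def by blast
      have "\<zero>\<^bsub>B\<^esub> \<in> K" unfolding K_def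
        using H_rp[OF additive_subgroup.zero_closed[OF ideal.axioms(1)[OF rp_ideal]]] mpc npc
        by (auto simp: tau_zero_left)
      then show "K \<noteq> {}" by blast
      show "\<ominus>\<^bsub>B\<^esub> j \<in> K" if "j \<in> K" for j
        using K_mult[OF that, of "\<ominus>\<^bsub>B\<^esub> \<one>\<^bsub>B\<^esub>"] that unfolding K_def by (simp add: B.l_minus)
      show "i \<oplus>\<^bsub>B\<^esub> j \<in> K" if "i \<in> K" "j \<in> K" for i j
        using that mpc npc H_add unfolding K_def by (auto simp: B.r_distr tau_add_left)
    qed
    show "x \<otimes>\<^bsub>B\<^esub> j \<in> K" if "j \<in> K" "x \<in> carrier B" for j x using K_mult that .
    show "j \<otimes>\<^bsub>B\<^esub> x \<in> K" if "j \<in> K" "x \<in> carrier B" for j x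
      using K_mult[OF that] that unfolding K_def by (simp add: B.m_comm)
  qed
  have "G \<subseteq> K"
  proof
    fix \<gamma> assume \<gamma>: "\<gamma> \<in> G"
    have \<gamma>c: "\<gamma> \<in> carrier B" using \<gamma> G(2) by blast
    have "\<tau> (b \<otimes>\<^bsub>B\<^esub> \<gamma>) c \<in> H" if bc: "b \<in> mp (q - d)" "c \<in> np d" for b c d
    proof -
      \<comment> \<open>The correction is added to the element, so the coefficient carries a minus
        sign. It has order q because b (x) c is in r^q.\<close>
      define x where "x = \<ominus>\<^bsub>Ac\<^esub> \<iota> (\<tau> b c)"
      have tc: "\<tau> b c \<in> carrier A" "\<tau> \<gamma> \<one>\<^bsub>C\<^esub> \<in> carrier A" using tau_closed mpc npc bc \<gamma>c by auto
      have "\<tau> b c \<in> rp q" using tau_filtered_in_rp[of b c q] bc unfolding filtered_pairs_def by blast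
      then have x: "x \<in> fil q" unfolding x_def
        using adic.completion_map_in_fil_iff[OF tc(1)] F.fil_closed(3) by blast
      define w where "w = (\<lambda>\<gamma>'. if \<gamma>' = \<gamma> then x else \<zero>\<^bsub>Ac\<^esub>)"
      have w: "w \<in> G \<rightarrow> fil q" unfolding w_def using x F.fil_closed(4) by auto
      have s: "F.comb G w = h \<gamma> \<otimes>\<^bsub>Ac\<^esub> x"
        unfolding w_def using F.comb_single[OF G \<gamma> F.fil_closed(1)[OF x]] .
      have "\<tau> (b \<otimes>\<^bsub>B\<^esub> \<gamma>) c = \<tau> \<gamma> \<one>\<^bsub>C\<^esub> \<otimes>\<^bsub>A\<^esub> \<tau> b c"
        using \<gamma>c mpc[OF bc(1)] npc[OF bc(2)] by (simp add: tau_mult B.m_comm)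
      then have "\<iota> (\<tau> (b \<otimes>\<^bsub>B\<^esub> \<gamma>) c) = h \<gamma> \<otimes>\<^bsub>Ac\<^esub> \<iota> (\<tau> b c)" using iota_hom(3) tc by simp
      then have "\<iota> (\<tau> (b \<otimes>\<^bsub>B\<^esub> \<gamma>) c) \<oplus>\<^bsub>Ac\<^esub> F.comb G w = \<zero>\<^bsub>Ac\<^esub>"
        unfolding s x_def using iota_hom(1) tc F.h_closed[OF \<gamma>c] by (simp add: adic.Ac.r_minus adic.Ac.r_neg)
      moreover have "\<tau> (b \<otimes>\<^bsub>B\<^esub> \<gamma>) c \<in> carrier A" using tau_closed mpc npc bc \<gamma>c by auto
      ultimately show ?thesis unfolding H_def using w F.fil_closed(4)
        by (intro CollectI conjI bexI[of _ w]) auto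
    qed
    then show "\<gamma> \<in> K" unfolding K_def using \<gamma>c by blast
  qed
  then have JK: "J \<subseteq> K" unfolding J using B.genideal_minimal[OF K_ideal] by blast
  have pairs: "\<tau> b c \<in> H" if "b \<in> ideal_prod B (mp (q - d)) J" "c \<in> np d" for b c d
    using that(1)
  proof (induction rule: ideal_prod.induct)
    case (prod i j)
    then show ?case using JK that(2) unfolding K_def by blast
  next
    case (sum s t)
    then have "s \<in> carrier B" "t \<in> carrier B" using B.ideal_prod_in_carrier[OF mp_ideal idJ] by auto
    then show ?case using H_add sum tau_add_left npc[OF that(2)] by simp
  qed
  obtain zs where zs: "u = tsum zs"
    "set zs \<subseteq> {(b, c). \<exists>d. b \<in> ideal_prod B (mp (q - d)) J \<and> c \<in> np d} \<union> filtered_pairs N"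
    using u by (elim tensor_sumsE)
  from zs(2) have "tsum zs \<in> H"
  proof (induction zs)
    case Nil
    show ?case using H_rp[OF additive_subgroup.zero_closed[OF ideal.axioms(1)[OF rp_ideal]]] by simp
  next
    case (Cons z zs)
    obtain b c where z: "z = (b, c)" by force
    have "\<tau> b c \<in> H" using Cons.prems pairs H_rp tau_filtered_in_rp unfolding z by auto
    then show ?case using Cons H_add unfolding z by simp
  qed
  then show ?thesis unfolding H_def zs(1) by blast
qed

text \<open>Replace z by a nearby u in A, apply the approximate colon property there, and return
  with coefficients in the completion.\<close>

lemma completion_colon_step:
  assumes I: "ideal I B" and a: "a \<in> carrier B"
    and G: "finite G" "G \<subseteq> carrier B" "colon_ideal B I a = genideal B G"
  shows "\<exists>p\<ge>q. (q = 0 \<longrightarrow> p = 0) \<and> (\<forall>N. \<forall>z\<in>fil p. h a \<otimes>\<^bsub>Ac\<^esub> z \<in> ideal_span F.M I \<longrightarrow>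
    (\<exists>w\<in>G \<rightarrow> fil q. z \<oplus>\<^bsub>Ac\<^esub> F.comb G w \<in> fil N))"
proof -
  define JF where "JF = {(b, c). \<exists>d. b \<in> ideal_prod B (mp (q - d)) (colon_ideal B I a) \<and> c \<in> np d}"
  obtain p where p: "p \<ge> q" "q = 0 \<longrightarrow> p = 0"
    and approx: "\<And>N. \<exists>L. \<forall>u\<in>rp p. \<tau> a \<one>\<^bsub>C\<^esub> \<otimes>\<^bsub>A\<^esub> u \<in> tsums (I \<times> carrier C \<union> filtered_pairs L) \<longrightarrow>
      u \<in> tsums (JF \<union> filtered_pairs N)"
    using tensor_colon_approximation[OF I a, of q] unfolding JF_def by blast
  have "\<exists>w\<in>G \<rightarrow> fil q. z \<oplus>\<^bsub>Ac\<^esub> F.comb G w \<in> fil N"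
    if z: "z \<in> fil p" and az: "h a \<otimes>\<^bsub>Ac\<^esub> z \<in> ideal_span F.M I" for z N
  proof -
    obtain L0 where L0: "\<And>u. u \<in> rp p \<Longrightarrow>
      \<tau> a \<one>\<^bsub>C\<^esub> \<otimes>\<^bsub>A\<^esub> u \<in> tsums (I \<times> carrier C \<union> filtered_pairs L0) \<Longrightarrow> u \<in> tsums (JF \<union> filtered_pairs N)"
      using approx by blast
    \<comment> \<open>The precision has to satisfy three demands: L0 for the hypothesis on a u, p to
      keep u in r^p, and N so that z and u agree in the conclusion.\<close>
    define L where "L = max L0 (max p N)"
    have zc: "z \<in> carrier Ac" using F.fil_closed(1)[OF z] .
    obtain u where u: "u \<in> carrier A" "z \<ominus>\<^bsub>Ac\<^esub> \<iota> u \<in> fil L" using adic.completion_approx[OF zc] .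
    have uN: "z \<ominus>\<^bsub>Ac\<^esub> \<iota> u \<in> fil N" "z \<ominus>\<^bsub>Ac\<^esub> \<iota> u \<in> fil p"
      using adic.fil_antimono[OF _ u(2)] unfolding L_def by auto
    have cc: "\<iota> u \<in> carrier Ac" "h a \<in> carrier Ac" "\<tau> a \<one>\<^bsub>C\<^esub> \<in> carrier A"
      using iota_hom(1)[OF u(1)] F.h_closed[OF a] tau_closed a by auto
    have "\<iota> u = z \<ominus>\<^bsub>Ac\<^esub> (z \<ominus>\<^bsub>Ac\<^esub> \<iota> u)" using zc cc by algebra
    then have "\<iota> u \<in> fil p" using F.fil_closed(5)[OF z uN(2)] by simp
    then have up: "u \<in> rp p" using adic.completion_map_in_fil_iff[OF u(1)] by simp
    have "h a \<otimes>\<^bsub>Ac\<^esub> z \<ominus>\<^bsub>Ac\<^esub> \<iota> (\<tau> a \<one>\<^bsub>C\<^esub> \<otimes>\<^bsub>A\<^esub> u) = h a \<otimes>\<^bsub>Ac\<^esub> (z \<ominus>\<^bsub>Ac\<^esub> \<iota> u)"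
      unfolding iota_hom(3)[OF cc(3) u(1)] using zc cc by algebra
    then have "h a \<otimes>\<^bsub>Ac\<^esub> z \<ominus>\<^bsub>Ac\<^esub> \<iota> (\<tau> a \<one>\<^bsub>C\<^esub> \<otimes>\<^bsub>A\<^esub> u) \<in> fil L" using F.fil_closed(6)[OF u(2) cc(2)] by simp
    then have "\<tau> a \<one>\<^bsub>C\<^esub> \<otimes>\<^bsub>A\<^esub> u \<in> tsums (I \<times> carrier C \<union> filtered_pairs L)"
      using cc(3) u(1) by (intro ideal_span_level[OF I az]) auto
    moreover have "filtered_pairs L \<subseteq> filtered_pairs L0" unfolding L_def by (intro filtered_pairs_antimono) simp
    then have "I \<times> carrier C \<union> filtered_pairs L \<subseteq> I \<times> carrier C \<union> filtered_pairs L0" by blast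
    ultimately have "\<tau> a \<one>\<^bsub>C\<^esub> \<otimes>\<^bsub>A\<^esub> u \<in> tsums (I \<times> carrier C \<union> filtered_pairs L0)"
      using tensor_sums_mono subsetD by metis
    then have "u \<in> tsums (JF \<union> filtered_pairs N)" using L0[OF up] by blast
    from colon_expansion[OF G this[unfolded JF_def]]
    obtain w where w: "w \<in> G \<rightarrow> fil q" "\<iota> u \<oplus>\<^bsub>Ac\<^esub> F.comb G w \<in> fil N" by blast
    have s: "F.comb G w \<in> carrier Ac" using F.comb_closed[OF G(1,2) F.fil_Pi[OF w(1)]] .
    have "z \<oplus>\<^bsub>Ac\<^esub> F.comb G w = (z \<ominus>\<^bsub>Ac\<^esub> \<iota> u) \<oplus>\<^bsub>Ac\<^esub> (\<iota> u \<oplus>\<^bsub>Ac\<^esub> F.comb G w)"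
      using zc cc(1) s by (simp add: a_minus_def adic.Ac.a_assoc adic.Ac.r_neg1)
    then have "z \<oplus>\<^bsub>Ac\<^esub> F.comb G w \<in> fil N" using F.fil_closed(2)[OF uN(1) w(2)] by (simp only:)
    then show ?thesis using w(1) by blast
  qed
  then show ?thesis using p by blast
qed

theorem colon_flat_completion: "colon_flat B F.M"
  unfolding colon_flat_def
proof (intro allI ballI impI, elim conjE)
  fix I a y assume y: "y \<in> carrier F.M" and I: "ideal I B" and a: "a \<in> carrier B"
    and ay: "a \<odot>\<^bsub>F.M\<^esub> y \<in> ideal_span F.M I"
  obtain G where G: "finite G" "G \<subseteq> carrier B" "colon_ideal B I a = genideal B G"
    using B.finetely_gen[OF B.ideal_colon_ideal[OF I a]] by blast
  have "G \<subseteq> colon_ideal B I a" using B.genideal_self[OF G(2)] G(3) by simp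
  then show "y \<in> ideal_span F.M (colon_ideal B I a)"
    using y ay by (intro F.colon_by_approximation[OF G(1,2) I a _ completion_colon_step[OF I a G]]) simp_all
qed

theorem flat_completion: "flat_module B F.M TYPE('p) TYPE('q)"
  using colon_flat_imp_flat[OF F.module_M colon_flat_completion] .

end

section \<open>The tensor product of algebras\<close>

definition pair_mult ::
  "('b, 'y) ring_scheme \<Rightarrow> ('c, 'z) ring_scheme \<Rightarrow> ('b \<times> 'c \<Rightarrow>\<^sub>0 int) \<Rightarrow> ('b \<times> 'c \<Rightarrow>\<^sub>0 int) \<Rightarrow> 'b \<times> 'c \<Rightarrow>\<^sub>0 int" where
  "pair_mult B C f g = frag_extend (\<lambda>(b, c).
     frag_extend (\<lambda>(b', c'). frag_of (b \<otimes>\<^bsub>B\<^esub> b', c \<otimes>\<^bsub>C\<^esub> c')) g) f"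

lemma pair_ring_simps:
  "carrier (pair_ring B C) = {z. Poly_Mapping.keys z \<subseteq> carrier B \<times> carrier C}"
  "f \<otimes>\<^bsub>pair_ring B C\<^esub> g = pair_mult B C f g" "\<one>\<^bsub>pair_ring B C\<^esub> = frag_of (\<one>\<^bsub>B\<^esub>, \<one>\<^bsub>C\<^esub>)"
  "\<zero>\<^bsub>pair_ring B C\<^esub> = 0" "f \<oplus>\<^bsub>pair_ring B C\<^esub> g = f + g"
  by (auto simp: pair_ring_def pair_mult_def)

lemma pair_mult_simps:
  "pair_mult B C 0 g = 0" "pair_mult B C f 0 = 0"
  "pair_mult B C (f + f') g = pair_mult B C f g + pair_mult B C f' g"
  "pair_mult B C (f - f') g = pair_mult B C f g - pair_mult B C f' g"
  "pair_mult B C (- f) g = - pair_mult B C f g"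
  "pair_mult B C (frag_of (b, c)) (frag_of (b', c')) = frag_of (b \<otimes>\<^bsub>B\<^esub> b', c \<otimes>\<^bsub>C\<^esub> c')"
  by (simp_all add: pair_mult_def frag_extend_add frag_extend_diff frag_extend_minus frag_extend_eq_0 split: prod.splits)

lemma pair_mult_diff_right:
  "pair_mult B C f (g - g') = pair_mult B C f g - pair_mult B C f g'"
proof (induction f rule: frag_induction[OF subset_UNIV])
  case (2 x)
  then show ?case by (cases x) (simp add: pair_mult_def frag_extend_diff)
qed (simp_all add: pair_mult_simps algebra_simps)

lemma keys_diff_subset: "Poly_Mapping.keys x \<subseteq> S \<Longrightarrow> Poly_Mapping.keys y \<subseteq> S \<Longrightarrow> Poly_Mapping.keys (x - y) \<subseteq> S"
  using keys_diff[of x y] by blast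

text \<open>The product is biadditive, so the ring laws reduce to single pairs, where they are those
  of B and C. The auxiliary facts release one argument at a time from being a single pair.\<close>

lemma pair_ring_cring:
  assumes "cring B" "cring C"
  shows "cring (pair_ring B C)"
proof (rule cringI)
  interpret B: cring B by fact
  interpret C: cring C by fact
  let ?S = "carrier B \<times> carrier C"
  note bil = pair_mult_simps pair_mult_diff_right
  have mult1: "Poly_Mapping.keys (pair_mult B C (frag_of p) g) \<subseteq> ?S"
    if "Poly_Mapping.keys g \<subseteq> ?S" "p \<in> ?S" for p g
    using that
  proof (induction g rule: frag_induct)
    case (of q)
    then show ?case by (cases p; cases q) (simp add: bil)
  qed (simp_all add: bil keys_diff_subset)
  have mult: "Poly_Mapping.keys (pair_mult B C f g) \<subseteq> ?S"
    if "Poly_Mapping.keys f \<subseteq> ?S" "Poly_Mapping.keys g \<subseteq> ?S" for f g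
    using that(1) by (induction f rule: frag_induct) (simp_all add: bil keys_diff_subset mult1 that(2))
  have comm1: "pair_mult B C (frag_of p) g = pair_mult B C g (frag_of p)"
    if "Poly_Mapping.keys g \<subseteq> ?S" "p \<in> ?S" for p g
    using that by (induction g rule: frag_induct) (auto simp: bil B.m_comm C.m_comm)
  have comm: "pair_mult B C f g = pair_mult B C g f"
    if "Poly_Mapping.keys f \<subseteq> ?S" "Poly_Mapping.keys g \<subseteq> ?S" for f g
    using that(1) by (induction f rule: frag_induct) (simp_all add: bil comm1 that(2))
  have assoc1: "pair_mult B C (pair_mult B C (frag_of p) (frag_of q)) g = pair_mult B C (frag_of p) (pair_mult B C (frag_of q) g)"
    if "Poly_Mapping.keys g \<subseteq> ?S" "p \<in> ?S" "q \<in> ?S" for p q g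
    using that by (induction g rule: frag_induct) (auto simp: bil B.m_assoc C.m_assoc)
  have assoc2: "pair_mult B C (pair_mult B C (frag_of p) f) g = pair_mult B C (frag_of p) (pair_mult B C f g)"
    if "Poly_Mapping.keys f \<subseteq> ?S" "Poly_Mapping.keys g \<subseteq> ?S" "p \<in> ?S" for p f g
    using that(1) by (induction f rule: frag_induct) (simp_all add: bil assoc1 that(2,3))
  have assoc: "pair_mult B C (pair_mult B C e f) g = pair_mult B C e (pair_mult B C f g)"
    if "Poly_Mapping.keys e \<subseteq> ?S" "Poly_Mapping.keys f \<subseteq> ?S" "Poly_Mapping.keys g \<subseteq> ?S" for e f g
    using that(1) by (induction e rule: frag_induct) (simp_all add: bil assoc2 that(2,3))
  have one: "pair_mult B C (frag_of (\<one>\<^bsub>B\<^esub>, \<one>\<^bsub>C\<^esub>)) g = g" if "Poly_Mapping.keys g \<subseteq> ?S" for g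
    using that by (induction g rule: frag_induct) (auto simp: bil)
  show "abelian_group (pair_ring B C)"
  proof (rule abelian_groupI)
    show "\<exists>y\<in>carrier (pair_ring B C). y \<oplus>\<^bsub>pair_ring B C\<^esub> x = \<zero>\<^bsub>pair_ring B C\<^esub>"
      if "x \<in> carrier (pair_ring B C)" for x
      using that by (intro bexI[of _ "- x"]) (auto simp: pair_ring_simps)
    show "x \<oplus>\<^bsub>pair_ring B C\<^esub> y \<in> carrier (pair_ring B C)"
      if "x \<in> carrier (pair_ring B C)" "y \<in> carrier (pair_ring B C)" for x y
      using that keys_add[of x y] by (auto simp: pair_ring_simps)
  qed (simp_all add: pair_ring_simps add.assoc add.commute)
  show "comm_monoid (pair_ring B C)"
    by (rule comm_monoidI, simp_all add: pair_ring_simps mult assoc one) (rule comm)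
  show "(x \<oplus>\<^bsub>pair_ring B C\<^esub> y) \<otimes>\<^bsub>pair_ring B C\<^esub> z =
      x \<otimes>\<^bsub>pair_ring B C\<^esub> z \<oplus>\<^bsub>pair_ring B C\<^esub> y \<otimes>\<^bsub>pair_ring B C\<^esub> z" for x y z
    by (simp add: pair_ring_simps pair_mult_simps)
qed

lemma pair_ring_minus:
  assumes "cring B" "cring C" "x \<in> carrier (pair_ring B C)"
  shows "\<ominus>\<^bsub>pair_ring B C\<^esub> x = - x"
proof -
  interpret P: cring "pair_ring B C" using pair_ring_cring assms by blast
  show ?thesis using assms(3) by (intro P.minus_equality) (auto simp: pair_ring_simps)
qed

section \<open>The tensor algebra as a quotient of the monoid ring\<close>

locale algebra_pair = B: algebra k B + C: algebra k C
  for k :: "('k, 'x) ring_scheme" and B :: "('k, 'b, 'y) module_scheme" and C :: "('k, 'c, 'z) module_scheme"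
begin

abbreviation "P \<equiv> pair_ring B C"
abbreviation "S \<equiv> tensor_subgroup k B C"
abbreviation "T \<equiv> tensor_algebra k B C"
abbreviation "\<tau> \<equiv> pure_tensor k B C"

sublocale P: cring P by (rule pair_ring_cring[OF B.is_cring C.is_cring])

lemma P_minus: "x \<in> carrier P \<Longrightarrow> \<ominus>\<^bsub>P\<^esub> x = - x" "x \<in> carrier P \<Longrightarrow> y \<in> carrier P \<Longrightarrow> x \<ominus>\<^bsub>P\<^esub> y = x - y"
  using pair_ring_minus[OF B.is_cring C.is_cring] by (auto simp: a_minus_def pair_ring_simps)

lemma tensor_subgroup_carrier: "S \<subseteq> carrier P"
  using tensor_subgroup_keys[OF B.module C.module] by (auto simp: pair_ring_simps)

lemma frag_of_carrier: "b \<in> carrier B \<Longrightarrow> c \<in> carrier C \<Longrightarrow> frag_of (b, c) \<in> carrier P"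
  by (simp add: pair_ring_simps)

lemma tensor_rels_mult:
  assumes z: "z \<in> tensor_rels k B C" and b: "b \<in> carrier B" and c: "c \<in> carrier C"
  shows "pair_mult B C z (frag_of (b, c)) \<in> S"
proof -
  note rels = tensor_rel_add_left[OF B.module C.module] tensor_rel_add_right[OF B.module C.module]
    tensor_rel_smult[OF B.module C.module]
  from z consider
      (l) x x' y where "z = frag_of (x \<oplus>\<^bsub>B\<^esub> x', y) - frag_of (x, y) - frag_of (x', y)"
        "x \<in> carrier B" "x' \<in> carrier B" "y \<in> carrier C"
    | (r) x y y' where "z = frag_of (x, y \<oplus>\<^bsub>C\<^esub> y') - frag_of (x, y) - frag_of (x, y')"
        "x \<in> carrier B" "y \<in> carrier C" "y' \<in> carrier C"
    | (s) a x y where "z = frag_of (a \<odot>\<^bsub>B\<^esub> x, y) - frag_of (x, a \<odot>\<^bsub>C\<^esub> y)"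
        "a \<in> carrier k" "x \<in> carrier B" "y \<in> carrier C"
    unfolding tensor_rels_def by blast
  then show ?thesis
    by cases (use b c rels in \<open>simp_all add: pair_mult_simps B.l_distr C.l_distr B.smult_assoc2 C.smult_assoc2\<close>)
qed

lemma tensor_subgroup_mult:
  assumes z: "z \<in> S" and x: "x \<in> carrier P"
  shows "pair_mult B C z x \<in> S"
proof -
  note sub = tensor_subgroup_zero[OF B.module C.module] tensor_subgroup_add[OF B.module C.module]
    tensor_subgroup_diff[OF B.module C.module] tensor_subgroup_uminus[OF B.module C.module]
  have 1: "pair_mult B C z (frag_of p) \<in> S" if p: "p \<in> carrier B \<times> carrier C" for p
    using p tensor_rels_mult sub unfolding pair_mult_def
    by (intro tensor_subgroup_image[OF B.module C.module z]) auto
  have "Poly_Mapping.keys x \<subseteq> carrier B \<times> carrier C" using x by (simp add: pair_ring_simps)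
  then show ?thesis
    by (induction x rule: frag_induct) (simp_all add: pair_mult_simps pair_mult_diff_right sub 1)
qed

lemma tensor_subgroup_ideal: "ideal S P"
proof (rule idealI)
  show "ring P" by (rule P.ring_axioms)
  show "subgroup S (add_monoid P)"
  proof (rule P.add.subgroupI)
    show "S \<subseteq> carrier P" by (rule tensor_subgroup_carrier)
    show "S \<noteq> {}" using tensor_subgroup_zero[OF B.module C.module] by blast
    show "\<ominus>\<^bsub>P\<^esub> z \<in> S" if "z \<in> S" for z
      using that tensor_subgroup_carrier tensor_subgroup_uminus[OF B.module C.module] P_minus(1) by auto
    show "z \<oplus>\<^bsub>P\<^esub> w \<in> S" if "z \<in> S" "w \<in> S" for z w
      using that tensor_subgroup_add[OF B.module C.module] by (simp add: pair_ring_simps)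
  qed
  show "z \<otimes>\<^bsub>P\<^esub> x \<in> S" if "z \<in> S" "x \<in> carrier P" for z x
    using tensor_subgroup_mult[OF that] by (simp add: pair_ring_simps)
  then show "x \<otimes>\<^bsub>P\<^esub> z \<in> S" if "z \<in> S" "x \<in> carrier P" for z x
    using that tensor_subgroup_carrier P.m_comm[of x z] by auto
qed

lemma genideal_tensor_rels: "genideal P (tensor_rels k B C) = S"
proof
  have sub: "tensor_rels k B C \<subseteq> S" using tensor_rels_in_subgroup[OF B.module C.module] by blast
  then show "genideal P (tensor_rels k B C) \<subseteq> S" by (rule P.genideal_minimal[OF tensor_subgroup_ideal])
  have rc: "tensor_rels k B C \<subseteq> carrier P" using sub tensor_subgroup_carrier by blast
  interpret G: ideal "genideal P (tensor_rels k B C)" P by (rule P.genideal_ideal[OF rc])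
  show "S \<subseteq> genideal P (tensor_rels k B C)"
  proof
    fix z assume z: "z \<in> S"
    \<comment> \<open>\<open>frag_extend frag_of\<close> is the identity; in this form the inclusion
      is an instance of \<open>tensor_subgroup_image\<close>.\<close>
    have "frag_extend frag_of z \<in> genideal P (tensor_rels k B C)"
    proof (rule tensor_subgroup_image[OF B.module C.module z])
      show "frag_extend frag_of z \<in> genideal P (tensor_rels k B C)" if "z \<in> tensor_rels k B C" for z
        using that P.genideal_self[OF rc] by (auto simp: frag_expansion[symmetric])
      show "0 \<in> genideal P (tensor_rels k B C)" using G.zero_closed by (simp add: pair_ring_simps)
      show "u - v \<in> genideal P (tensor_rels k B C)"
        if "u \<in> genideal P (tensor_rels k B C)" "v \<in> genideal P (tensor_rels k B C)" for u v
        using G.a_closed[OF that(1) G.a_inv_closed[OF that(2)]] P_minus(2)[OF G.Icarr[OF that(1)] G.Icarr[OF that(2)]]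
        unfolding a_minus_def by (simp only:)
    qed
    then show "z \<in> genideal P (tensor_rels k B C)" by (simp add: frag_expansion[symmetric])
  qed
qed

lemma tensor_algebra_eq: "T = P Quot S"
  by (simp add: tensor_algebra_def genideal_tensor_rels)

lemma pure_tensor_eq: "\<tau> b c = S +>\<^bsub>P\<^esub> frag_of (b, c)"
  by (simp add: pure_tensor_def genideal_tensor_rels)

sublocale T: cring T
  unfolding tensor_algebra_eq by (rule ideal.quotient_is_cring[OF tensor_subgroup_ideal P.is_cring])

lemma coset_hom: "(+>\<^bsub>P\<^esub>) S \<in> ring_hom P T"
  unfolding tensor_algebra_eq by (rule ideal.rcos_ring_hom[OF tensor_subgroup_ideal])

lemma coset_eq_iff:
  "x \<in> carrier P \<Longrightarrow> y \<in> carrier P \<Longrightarrow> S +>\<^bsub>P\<^esub> x = S +>\<^bsub>P\<^esub> y \<longleftrightarrow> x - y \<in> S"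
  using P.quotient_eq_iff_same_a_r_cos[OF tensor_subgroup_ideal] P_minus(2) by simp

lemma coset_eq_zero_iff: "x \<in> carrier P \<Longrightarrow> S +>\<^bsub>P\<^esub> x = \<zero>\<^bsub>T\<^esub> \<longleftrightarrow> x \<in> S"
proof -
  assume x: "x \<in> carrier P"
  have "\<zero>\<^bsub>T\<^esub> = S +>\<^bsub>P\<^esub> \<zero>\<^bsub>P\<^esub>"
    using P.a_rcos_zero[OF tensor_subgroup_ideal, of 0] tensor_subgroup_zero[OF B.module C.module]
    by (simp add: tensor_algebra_eq FactRing_def pair_ring_simps)
  then show ?thesis using coset_eq_iff[OF x P.zero_closed] by (simp add: pair_ring_simps)
qed

lemma coset_add: "x \<in> carrier P \<Longrightarrow> y \<in> carrier P \<Longrightarrow> S +>\<^bsub>P\<^esub> (x + y) = (S +>\<^bsub>P\<^esub> x) \<oplus>\<^bsub>T\<^esub> (S +>\<^bsub>P\<^esub> y)"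
  using ring_hom_add[OF coset_hom] by (simp add: pair_ring_simps)

lemma coset_closed: "x \<in> carrier P \<Longrightarrow> S +>\<^bsub>P\<^esub> x \<in> carrier T"
  using ring_hom_closed[OF coset_hom] .

lemma tensor_sum_eq:
  assumes "set zs \<subseteq> carrier B \<times> carrier C"
  shows "tensor_sum T \<tau> zs = S +>\<^bsub>P\<^esub> sum_list (map frag_of zs) \<and> sum_list (map frag_of zs) \<in> carrier P"
  using assms
proof (induction zs)
  case Nil
  have "S +>\<^bsub>P\<^esub> 0 = \<zero>\<^bsub>T\<^esub>"
    using coset_eq_zero_iff[of 0] tensor_subgroup_zero[OF B.module C.module] by (simp add: pair_ring_simps)
  then show ?case by (simp add: pair_ring_simps)
next
  case (Cons z zs)
  obtain b c where z: "z = (b, c)" by force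
  have f: "frag_of (b, c) \<in> carrier P" using Cons.prems frag_of_carrier unfolding z by auto
  have IH: "tensor_sum T \<tau> zs = S +>\<^bsub>P\<^esub> sum_list (map frag_of zs)" "sum_list (map frag_of zs) \<in> carrier P"
    using Cons by auto
  have "frag_of (b, c) + sum_list (map frag_of zs) \<in> carrier P"
    using P.a_closed[OF f IH(2)] by (simp add: pair_ring_simps)
  then show ?case using coset_add[OF f IH(2)]
    unfolding z tensor_sum_simps IH(1) by (simp add: pure_tensor_eq)
qed

lemma tensor_ring_axioms': "tensor_ring k B C T \<tau>"
proof (intro tensor_ring.intro tensor_ring_axioms.intro B.algebra_axioms C.algebra_axioms T.is_cring)
  note rels = tensor_rel_add_left[OF B.module C.module] tensor_rel_add_right[OF B.module C.module]
    tensor_rel_smult[OF B.module C.module]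
  show closed: "\<tau> b c \<in> carrier T" if "b \<in> carrier B" "c \<in> carrier C" for b c
    using coset_closed[OF frag_of_carrier[OF that]] by (simp add: pure_tensor_eq)
  show add_left: "\<tau> (b \<oplus>\<^bsub>B\<^esub> b') c = \<tau> b c \<oplus>\<^bsub>T\<^esub> \<tau> b' c"
    if h: "b \<in> carrier B" "b' \<in> carrier B" "c \<in> carrier C" for b b' c
  proof -
    have f: "frag_of (b, c) \<in> carrier P" "frag_of (b', c) \<in> carrier P" "frag_of (b \<oplus>\<^bsub>B\<^esub> b', c) \<in> carrier P"
      using frag_of_carrier h by auto
    have "frag_of (b, c) + frag_of (b', c) \<in> carrier P"
      using P.a_closed[OF f(1,2)] by (simp add: pair_ring_simps)
    then show ?thesis unfolding pure_tensor_eq coset_add[OF f(1,2), symmetric]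
      using coset_eq_iff[OF f(3)] rels(1)[OF h] by (simp add: diff_diff_eq)
  qed
  show "\<tau> b (c \<oplus>\<^bsub>C\<^esub> c') = \<tau> b c \<oplus>\<^bsub>T\<^esub> \<tau> b c'"
    if h: "b \<in> carrier B" "c \<in> carrier C" "c' \<in> carrier C" for b c c'
  proof -
    have f: "frag_of (b, c) \<in> carrier P" "frag_of (b, c') \<in> carrier P" "frag_of (b, c \<oplus>\<^bsub>C\<^esub> c') \<in> carrier P"
      using frag_of_carrier h by auto
    have "frag_of (b, c) + frag_of (b, c') \<in> carrier P"
      using P.a_closed[OF f(1,2)] by (simp add: pair_ring_simps)
    then show ?thesis unfolding pure_tensor_eq coset_add[OF f(1,2), symmetric]
      using coset_eq_iff[OF f(3)] rels(2)[OF h] by (simp add: diff_diff_eq)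
  qed
  show "\<tau> (a \<odot>\<^bsub>B\<^esub> b) c = \<tau> b (a \<odot>\<^bsub>C\<^esub> c)" if h: "a \<in> carrier k" "b \<in> carrier B" "c \<in> carrier C" for a b c
    unfolding pure_tensor_eq using coset_eq_iff rels(3)[OF h] frag_of_carrier h by simp
  show "\<tau> b c \<otimes>\<^bsub>T\<^esub> \<tau> b' c' = \<tau> (b \<otimes>\<^bsub>B\<^esub> b') (c \<otimes>\<^bsub>C\<^esub> c')"
    if "b \<in> carrier B" "b' \<in> carrier B" "c \<in> carrier C" "c' \<in> carrier C" for b b' c c'
    using ring_hom_mult[OF coset_hom frag_of_carrier frag_of_carrier, of b c b' c'] that
    by (simp add: pure_tensor_eq pair_ring_simps pair_mult_simps)
  show "\<tau> \<one>\<^bsub>B\<^esub> \<one>\<^bsub>C\<^esub> = \<one>\<^bsub>T\<^esub>"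
    using ring_hom_one[OF coset_hom] by (simp add: pure_tensor_eq pair_ring_simps)
  show "carrier T \<subseteq> tensor_sums T \<tau> (carrier B \<times> carrier C)"
  proof
    \<comment> \<open>Representatives have integer coefficients, whereas \<open>tensor_sum\<close>
      admits no signs. Modulo S, a negative term is a positive one with its left entry
      negated.\<close>
    have pos_neg: "\<exists>zs. set zs \<subseteq> carrier B \<times> carrier C \<and> z - sum_list (map frag_of zs) \<in> S"
      if "Poly_Mapping.keys z \<subseteq> carrier B \<times> carrier C" for z
      using that
    proof (induction z rule: frag_induct)
      case zero
      show ?case using tensor_subgroup_zero[OF B.module C.module] by (intro exI[of _ "[]"]) simp
    next
      case (of p)
      then show ?case using tensor_subgroup_zero[OF B.module C.module] by (intro exI[of _ "[p]"]) simp
    next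
      case (diff x y)
      obtain zs ws where zs: "set zs \<subseteq> carrier B \<times> carrier C" "x - sum_list (map frag_of zs) \<in> S"
        and ws: "set ws \<subseteq> carrier B \<times> carrier C" "y - sum_list (map frag_of ws) \<in> S" using diff by blast
      define nws where "nws = map (\<lambda>(b, c). (\<ominus>\<^bsub>B\<^esub> b, c)) ws"
      have "sum_list (map frag_of nws) + sum_list (map frag_of ws) \<in> S" unfolding nws_def using ws(1)
      proof (induction ws)
        case Nil
        then show ?case using tensor_subgroup_zero[OF B.module C.module] by simp
      next
        case (Cons w ws)
        obtain b c where w: "w = (b, c)" by force
        have bc: "b \<in> carrier B" "c \<in> carrier C" using Cons.prems unfolding w by auto
        \<comment> \<open>Both 0 (x) c and the additivity relation at -b and b lie in S; their
          difference is the sum of the pairs (-b, c) and (b, c).\<close>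
        have "frag_of (\<zero>\<^bsub>B\<^esub>, c) - (frag_of (\<ominus>\<^bsub>B\<^esub> b \<oplus>\<^bsub>B\<^esub> b, c) - frag_of (\<ominus>\<^bsub>B\<^esub> b, c) - frag_of (b, c)) \<in> S"
          using tensor_subgroup_diff[OF B.module C.module tensor_zero_left[OF B.module C.module] rels(1)] bc by simp
        then have "frag_of (\<ominus>\<^bsub>B\<^esub> b, c) + frag_of (b, c) \<in> S" using bc by (simp add: B.l_neg add.commute)
        moreover have "sum_list (map frag_of (map (\<lambda>(b, c). (\<ominus>\<^bsub>B\<^esub> b, c)) ws)) + sum_list (map frag_of ws) \<in> S"
          using Cons by simp
        ultimately show ?case using tensor_subgroup_add[OF B.module C.module] unfolding w
          by (fastforce simp: algebra_simps)
      qed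
      then have "(x - sum_list (map frag_of zs)) - (y - sum_list (map frag_of ws)) -
          (sum_list (map frag_of nws) + sum_list (map frag_of ws)) \<in> S"
        using zs(2) ws(2) tensor_subgroup_diff[OF B.module C.module] by blast
      moreover have "set nws \<subseteq> carrier B \<times> carrier C" unfolding nws_def using ws(1) by auto
      ultimately show ?case using zs(1) by (intro exI[of _ "zs @ nws"]) (simp add: algebra_simps)
    qed
    fix x assume "x \<in> carrier T"
    then obtain z where z: "z \<in> carrier P" "x = S +>\<^bsub>P\<^esub> z"
      by (auto simp: tensor_algebra_eq FactRing_def A_RCOSETS_def RCOSETS_def a_r_coset_def)
    then obtain zs where zs: "set zs \<subseteq> carrier B \<times> carrier C" "z - sum_list (map frag_of zs) \<in> S"
      using pos_neg[of z] by (auto simp: pair_ring_simps)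
    then have "x = tensor_sum T \<tau> zs" using z tensor_sum_eq[OF zs(1)] coset_eq_iff[of z] by simp
    then show "x \<in> tensor_sums T \<tau> (carrier B \<times> carrier C)" using zs(1) by (simp add: tensor_sumsI)
  qed
qed

sublocale tensor_ring k B C T \<tau> by (rule tensor_ring_axioms')

lemma tensor_sum_zero_left:
  assumes zs: "set zs \<subseteq> carrier B \<times> carrier C" "tensor_sum T \<tau> zs = \<zero>\<^bsub>T\<^esub>"
  shows "\<exists>D. valid_rels k B D \<and>
    (\<forall>\<phi>\<in>rel_functions k D. list_sum C (map (\<lambda>(b, c). \<phi> b \<odot>\<^bsub>C\<^esub> c) zs) = \<zero>\<^bsub>C\<^esub>)"
proof -
  have "S +>\<^bsub>P\<^esub> sum_list (map frag_of zs) = \<zero>\<^bsub>T\<^esub>"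
    using conjunct1[OF tensor_sum_eq[OF zs(1)]] zs(2) by (rule trans[OF sym])
  then have sum_in: "sum_list (map frag_of zs) \<in> S"
    by (rule iffD1[OF coset_eq_zero_iff[OF conjunct2[OF tensor_sum_eq[OF zs(1)]]]])
  from tensor_zero_criterion[OF B.module C.module sum_in]
  obtain D where D: "valid_rels k B D"
    and kill: "\<And>\<phi>. \<phi> \<in> rel_functions k D \<Longrightarrow> frag_slice B C \<phi> (sum_list (map frag_of zs)) = \<zero>\<^bsub>C\<^esub>" by blast
  have "list_sum C (map (\<lambda>(b, c). \<phi> b \<odot>\<^bsub>C\<^esub> c) zs) = \<zero>\<^bsub>C\<^esub>" if \<phi>: "\<phi> \<in> rel_functions k D" for \<phi>
  proof -
    have \<phi>c: "\<phi> \<in> UNIV \<rightarrow> carrier k" using \<phi> B.rel_functions_subset by blast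
    have "frag_slice B C \<phi> (sum_list (map frag_of ws)) = list_sum C (map (\<lambda>(b, c). \<phi> b \<odot>\<^bsub>C\<^esub> c) ws)"
      if "set ws \<subseteq> carrier B \<times> carrier C" for ws
      using that
    proof (induction ws)
      case Nil
      then show ?case using frag_slice_zero[OF B.module C.module \<phi>c] by simp
    next
      case (Cons w ws)
      obtain b c where w: "w = (b, c)" by force
      have "Poly_Mapping.keys (sum_list (map frag_of ws)) \<subseteq> carrier B \<times> carrier C"
        using tensor_sum_eq[of ws] Cons.prems by (simp add: pair_ring_simps)
      then show ?case using Cons frag_slice_of[OF B.module C.module \<phi>c]
          frag_slice_add(1)[OF B.module C.module \<phi>c, of "frag_of (b, c)"] unfolding w by simp
    qed
    then show ?thesis using kill[OF \<phi>] zs(1) by simp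
  qed
  then show ?thesis using D by blast
qed

end

section \<open>Exchange of the factors and the conclusion\<close>

lemma tensor_subgroup_swap:
  assumes M: "module R M" and N: "module R N" and z: "z \<in> tensor_subgroup R M N"
  shows "frag_extend (\<lambda>(x, y). frag_of (y, x)) z \<in> tensor_subgroup R N M"
proof (rule tensor_subgroup_image[OF M N z])
  note rels = tensor_rel_add_left[OF N M] tensor_rel_add_right[OF N M] tensor_rel_smult[OF N M]
  have smult: "frag_of (y, a \<odot>\<^bsub>M\<^esub> x) - frag_of (a \<odot>\<^bsub>N\<^esub> y, x) \<in> tensor_subgroup R N M"
    if "a \<in> carrier R" "x \<in> carrier M" "y \<in> carrier N" for a x y
    using tensor_subgroup_uminus[OF N M rels(3)] that by fastforce
  show "frag_extend (\<lambda>(x, y). frag_of (y, x)) z \<in> tensor_subgroup R N M" if "z \<in> tensor_rels R M N" for z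
    using that unfolding tensor_rels_def
    by (elim UnE CollectE exE conjE) (simp_all add: frag_extend_diff rels smult)
qed (use tensor_subgroup_zero[OF N M] tensor_subgroup_diff[OF N M] in auto)

context algebra_pair
begin

text \<open>\<open>tensor_zero_criterion\<close> yields relations among left factors. Exchanging the
  entries of all pairs turns it into a statement about right factors, the form assumed in
  \<open>filtered_tensor_ring\<close>.\<close>

lemma tensor_sum_zero_right:
  assumes zs: "set zs \<subseteq> carrier B \<times> carrier C" "tensor_sum T \<tau> zs = \<zero>\<^bsub>T\<^esub>"
  shows "\<exists>D. valid_rels k C D \<and>
    (\<forall>\<phi>\<in>rel_functions k D. list_sum B (map (\<lambda>(b, c). \<phi> c \<odot>\<^bsub>B\<^esub> b) zs) = \<zero>\<^bsub>B\<^esub>)"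
proof -
  interpret swap: algebra_pair k C B by unfold_locales
  have "S +>\<^bsub>P\<^esub> sum_list (map frag_of zs) = \<zero>\<^bsub>T\<^esub>"
    using conjunct1[OF tensor_sum_eq[OF zs(1)]] zs(2) by (rule trans[OF sym])
  then have sum_in: "sum_list (map frag_of zs) \<in> S"
    by (rule iffD1[OF coset_eq_zero_iff[OF conjunct2[OF tensor_sum_eq[OF zs(1)]]]])
  have "frag_extend (\<lambda>(x, y). frag_of (y, x)) (sum_list (map frag_of ws)) =
      sum_list (map frag_of (map prod.swap ws))" for ws :: "('b \<times> 'c) list"
    by (induction ws) (auto simp: frag_extend_add)
  from this[of zs] have "sum_list (map frag_of (map prod.swap zs)) \<in> tensor_subgroup k C B"
    using tensor_subgroup_swap[OF B.module C.module sum_in] by simp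
  moreover have zs': "set (map prod.swap zs) \<subseteq> carrier C \<times> carrier B" using zs(1) by auto
  ultimately have "tensor_sum (tensor_algebra k C B) (pure_tensor k C B) (map prod.swap zs) = \<zero>\<^bsub>tensor_algebra k C B\<^esub>"
    using swap.tensor_sum_eq[OF zs'] swap.coset_eq_zero_iff by metis
  from swap.tensor_sum_zero_left[OF zs' this] show ?thesis by (simp add: comp_def case_prod_unfold)
qed

lemma tensor_ideal_eq:
  assumes "ideal m B" "ideal n C"
  shows "tensor_ideal k B C m n = tsums (m \<times> carrier C \<union> carrier B \<times> n)"
proof -
  interpret m: ideal m B by fact
  interpret n: ideal n C by fact
  have "tensor_image k B C m (carrier C) = tsums (m \<times> carrier C)"
    unfolding tensor_image_def by (rule tsums_generate) auto
  moreover have "tensor_image k B C (carrier B) n = tsums (carrier B \<times> n)"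
    unfolding tensor_image_def by (rule tsums_generate) auto
  ultimately show ?thesis unfolding tensor_ideal_def by (subst tsums_union[symmetric]) auto
qed

text \<open>Both claims instantiate \<open>filtered_tensor_ring\<close> with the same ring and the
  same ideal; for flatness over C the map \<tau> is read with its arguments reversed. Hence the
  completion and its embeddings are literally those of the statement.\<close>

theorem completed_tensor_flat:
  assumes k: "field k" and m: "ideal m B" and n: "ideal n C"
  shows "noetherian_ring B \<Longrightarrow>
      flat_module B (module_via (completed_inl k B C m n) (completed_tensor k B C m n)) TYPE('p) TYPE('q)"
    and "noetherian_ring C \<Longrightarrow>
      flat_module C (module_via (completed_inr k B C m n) (completed_tensor k B C m n)) TYPE('p) TYPE('q)"
proof -
  let ?r = "tensor_ideal k B C m n"
  let ?\<sigma> = "\<lambda>c b. \<tau> b c"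
  have r: "ideal ?r T" using tsums_ideal[OF m n] tensor_ideal_eq[OF m n] by simp
  {
    assume B: "noetherian_ring B"
    interpret F: filtered_tensor_ring k B C T \<tau> m n ?r
      using k tensor_sum_zero_right B m n r tensor_ideal_eq[OF m n]
      by (intro filtered_tensor_ring.intro filtered_tensor_ring_axioms.intro tensor_ring_axioms') auto
    show "flat_module B (module_via (completed_inl k B C m n) (completed_tensor k B C m n)) TYPE('p) TYPE('q)"
      unfolding completed_tensor_def completed_inl_def using F.flat_completion by simp
  next
    assume C: "noetherian_ring C"
    have "prod.swap ` (m \<times> carrier C \<union> carrier B \<times> n) = n \<times> carrier B \<union> carrier C \<times> m" by auto
    then have r_eq: "?r = tensor_sums T ?\<sigma> (n \<times> carrier B \<union> carrier C \<times> m)"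
      using tensor_sums_swap[of "m \<times> carrier C \<union> carrier B \<times> n"] tensor_ideal_eq[OF m n] by simp
    have zero: "\<exists>D. valid_rels k B D \<and>
        (\<forall>\<phi>\<in>rel_functions k D. list_sum C (map (\<lambda>(c, b). \<phi> b \<odot>\<^bsub>C\<^esub> c) zs) = \<zero>\<^bsub>C\<^esub>)"
      if zs: "set zs \<subseteq> carrier C \<times> carrier B" "tensor_sum T ?\<sigma> zs = \<zero>\<^bsub>T\<^esub>" for zs
    proof -
      have "tensor_sum T \<tau> (map prod.swap zs) = \<zero>\<^bsub>T\<^esub>"
        using tensor_sum_swap[of "map prod.swap zs"] zs(2) by (simp add: comp_def)
      moreover have "set (map prod.swap zs) \<subseteq> carrier B \<times> carrier C" using zs(1) by auto
      ultimately show ?thesis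
        using tensor_sum_zero_left[of "map prod.swap zs"] by (simp add: comp_def case_prod_unfold)
    qed
    interpret G: filtered_tensor_ring k C B T ?\<sigma> n m ?r
      using k zero C m n r r_eq
      by (intro filtered_tensor_ring.intro filtered_tensor_ring_axioms.intro tensor_ring_swap) auto
    show "flat_module C (module_via (completed_inr k B C m n) (completed_tensor k B C m n)) TYPE('p) TYPE('q)"
      unfolding completed_tensor_def completed_inr_def using G.flat_completion by simp
  }
qed

end

theorem mainTheorem2:
  fixes k :: "('k, 'x) ring_scheme"
    and B :: "('k, 'b, 'y) module_scheme" and TB :: "'b topology" and m :: "'b set"
    and C :: "('k, 'c, 'z) module_scheme" and TC :: "'c topology" and n :: "'c set"
  assumes "field k"
    and "algebra k B" and "noetherian_ring B" and "preadic_ring B TB"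
    and "ideal_of_definition B TB m"
    and "algebra k C" and "noetherian_ring C" and "preadic_ring C TC"
    and "ideal_of_definition C TC n"
    and "noetherian_ring (tensor_algebra k (quotient_algebra B m) (quotient_algebra C n))"
  shows "flat_module B (module_via (completed_inl k B C m n) (completed_tensor k B C m n))
           TYPE('p) TYPE('q) \<and>
         flat_module C (module_via (completed_inr k B C m n) (completed_tensor k B C m n))
           TYPE('p) TYPE('q)"
proof -
  interpret algebra_pair k B C using assms by (simp add: algebra_pair_def)
  have "ideal m B" "ideal n C" using assms by (simp_all add: ideal_of_definition_def)
  then show ?thesis using completed_tensor_flat assms by blast
qed

end
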